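(* Let $\phi(x)e^{-i\omega t}$, $\omega\in\mathbb{R}$, $\phi\in H^1(\mathbb{R}^n,\mathbb{C}^N)$, $n\ge1$, be a solitary wave solution of the nonlinear Dirac equation $$i\partial_t\psi=-i\sum_{j=1}^n\alpha_j\partial_j\psi+g(\psi^*\beta\psi)\beta\psi .$$ Then, with $T_j$, $T$, $V$, $Q$, $G$ as in the context, $$\frac{n-1}{n}T(\phi)+V(\phi)=\omega Q(\phi),$$ $$T_j(\phi)=\frac1n T(\phi)=\int_{\mathbb{R}^n}\big(G(\phi^*\beta\phi)-\phi^*\beta\phi\;g(\phi^*\beta\phi)\big)\,dx,\qquad 1\le j\le n.$$
   Context: Here $\psi(x,t)\in\mathbb{C}^N$, $N$ is even, $g:\mathbb{R}\to\mathbb{R}$ is smooth with $g(0)=m>0$, and $\alpha_j,\beta$ are Hermitian $N\times N$ (Dirac) matrices with $\alpha_j\alpha_k+\alpha_k\alpha_j=2\delta_{jk}I_N$, $\alpha_j\beta+\beta\alpha_j=0$, $\beta^2=I_N$, $\beta=\mathrm{diag}(I_{N/2},-I_{N/2})$. That $\phi(x)e^{-i\omega t}$ is a solitary wave means $-i\sum_j\alpha_j\partial_j\phi-\omega\phi+g(\phi^*\beta\phi)\beta\phi=0$. $G$ is the antiderivative of $g$ with $G(0)=0$. The functionals are $$T_j(\psi)=-i\int_{\mathbb{R}^n}\psi^*\alpha_j\partial_j\psi\,dx\ \text{ (no summation)},\quad T(\psi)=\sum_{j=1}^nT_j(\psi),\quad V(\psi)=\int_{\mathbb{R}^n}G(\psi^*\beta\psi)\,dx,\quad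 Q(\psi)=\int_{\mathbb{R}^n}\psi^*\psi\,dx .$$ The energy is $E=T+V$, and the stationary equation for $\phi$ is equivalently written as $E'(\phi)=\omega Q'(\phi)$, where primes denote Fréchet derivatives with respect to $(\mathrm{Re}\,\psi,\mathrm{Im}\,\psi)$. *)

theory Defs
  imports "HOL-Analysis.Analysis"
begin

primrec C_k :: "nat \<Rightarrow> ('a::euclidean_space \<Rightarrow> real) \<Rightarrow> bool" where
  "C_k 0 f \<longleftrightarrow> continuous_on UNIV f"
| "C_k (Suc k) f \<longleftrightarrow> (\<forall>x. f differentiable (at x)) \<and>
     (\<forall>b\<in>Basis. C_k k (\<lambda>x. frechet_derivative f (at x) b))"

definition smooth :: "('a::euclidean_space \<Rightarrow> real) \<Rightarrow> bool" where
  "smooth f \<longleftrightarrow> (\<forall>k. C_k k f)"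

definition test_function :: "('a::euclidean_space \<Rightarrow> real) \<Rightarrow> bool" where
  "test_function f \<longleftrightarrow> smooth f \<and> compact (closure {x. f x \<noteq> 0})"

text \<open>Function spaces on \<open>\<real>\<^sup>n\<close>. Elements are represented by Borel functions; every class
  modulo null sets contains one.\<close>

definition L1_loc :: "(real ^ 'n \<Rightarrow> 'b::euclidean_space) \<Rightarrow> bool" where
  "L1_loc f \<longleftrightarrow> f \<in> borel_measurable lborel \<and> (\<forall>K. compact K \<longrightarrow> set_integrable lborel K f)"

definition L2 :: "(real ^ 'n \<Rightarrow> 'b::euclidean_space) \<Rightarrow> bool" where
  "L2 f \<longleftrightarrow> f \<in> borel_measurable lborel \<and> integrable lborel (\<lambda>x. (norm (f x))\<^sup>2)"

definition has_weak_partial ::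
    "'n \<Rightarrow> (real ^ 'n \<Rightarrow> 'b::euclidean_space) \<Rightarrow> (real ^ 'n \<Rightarrow> 'b) \<Rightarrow> bool" where
  "has_weak_partial j f d \<longleftrightarrow> L1_loc f \<and> L1_loc d \<and>
     (\<forall>\<eta>. test_function \<eta> \<longrightarrow>
        (LINT x|lborel. frechet_derivative \<eta> (at x) (axis j 1) *\<^sub>R f x)
          = - (LINT x|lborel. \<eta> x *\<^sub>R d x))"

text \<open>Weak derivatives are unique up to a null set, so the choice of representative affects
  none of the notions below.\<close>

definition weak_partial ::
    "'n \<Rightarrow> (real ^ 'n \<Rightarrow> 'b::euclidean_space) \<Rightarrow> (real ^ 'n \<Rightarrow> 'b)" where
  "weak_partial j f = (SOME d. has_weak_partial j f d)"

definition H1 :: "(real ^ 'n \<Rightarrow> 'b::euclidean_space) \<Rightarrow> bool" where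
  "H1 f \<longleftrightarrow> L2 f \<and> (\<forall>j. (\<exists>d. has_weak_partial j f d) \<and> L2 (weak_partial j f))"

text \<open>\<open>\<complex>\<^sup>N\<close> with \<open>N\<close> even is \<open>complex ^ ('h + 'h)\<close> with \<open>N / 2 = CARD('h)\<close>: the summand
  \<open>Inl\<close> indexes the first \<open>N / 2\<close> components, \<open>Inr\<close> the last \<open>N / 2\<close>. \<open>star_mult u v\<close> is
  \<open>u\<^sup>* v\<close>, conjugate-linear in \<open>u\<close>.\<close>

definition star_mult :: "complex ^ 'm \<Rightarrow> complex ^ 'm \<Rightarrow> complex" where
  "star_mult u v = (\<Sum>i\<in>UNIV. cnj (u $ i) * v $ i)"

definition hermitian :: "complex ^ 'm ^ 'm \<Rightarrow> bool" where
  "hermitian A \<longleftrightarrow> (\<forall>i j. A $ i $ j = cnj (A $ j $ i))"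

definition dirac_beta :: "complex ^ ('h::finite + 'h) ^ ('h + 'h)" where
  "dirac_beta = (\<chi> i j. if i = j then (case i of Inl _ \<Rightarrow> 1 | Inr _ \<Rightarrow> - 1) else 0)"

text \<open>\<open>\<beta>\<^sup>* = \<beta>\<close> and \<open>\<beta>\<^sup>2 = I\<close> are automatic for the explicit \<open>\<beta>\<close> above.\<close>

definition dirac_matrices ::
    "('n \<Rightarrow> complex ^ ('h::finite + 'h) ^ ('h + 'h)) \<Rightarrow> bool" where
  "dirac_matrices \<alpha> \<longleftrightarrow>
     (\<forall>j. hermitian (\<alpha> j)) \<and>
     (\<forall>j k. \<alpha> j ** \<alpha> k + \<alpha> k ** \<alpha> j = (if j = k then mat 2 else 0)) \<and>
     (\<forall>j. \<alpha> j ** dirac_beta + dirac_beta ** \<alpha> j = 0)"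

text \<open>\<open>u\<^sup>* \<beta> u\<close> is real because \<open>\<beta>\<close> is Hermitian; \<open>Re\<close> only changes the type.\<close>

definition beta_form :: "complex ^ ('h::finite + 'h) \<Rightarrow> real" where
  "beta_form u = Re (star_mult u (dirac_beta *v u))"

text \<open>\<open>\<phi>(x) e\<^sup>-\<^sup>i\<^sup>\<omega>\<^sup>t\<close> solves the nonlinear Dirac equation: the stationary equation for the
  profile \<open>\<phi>\<close>, with weak derivatives.\<close>

definition solitary_wave ::
    "('n \<Rightarrow> complex ^ ('h::finite + 'h) ^ ('h + 'h)) \<Rightarrow> (real \<Rightarrow> real) \<Rightarrow> real \<Rightarrow>
     (real ^ 'n \<Rightarrow> complex ^ ('h + 'h)) \<Rightarrow> bool" where
  "solitary_wave \<alpha> g \<omega> \<phi> \<longleftrightarrow>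
     (AE x in lborel.
        (- \<i>) *s (\<Sum>j\<in>UNIV. \<alpha> j *v weak_partial j \<phi> x) - \<omega> *\<^sub>R \<phi> x
          + g (beta_form (\<phi> x)) *\<^sub>R (dirac_beta *v \<phi> x) = 0)"

definition T_part ::
    "('n \<Rightarrow> complex ^ ('h::finite + 'h) ^ ('h + 'h)) \<Rightarrow> 'n \<Rightarrow>
     (real ^ 'n \<Rightarrow> complex ^ ('h + 'h)) \<Rightarrow> complex" where
  "T_part \<alpha> j \<psi> = - \<i> * (LINT x|lborel. star_mult (\<psi> x) (\<alpha> j *v weak_partial j \<psi> x))"

definition T_total ::
    "('n::finite \<Rightarrow> complex ^ ('h::finite + 'h) ^ ('h + 'h)) \<Rightarrow>
     (real ^ 'n \<Rightarrow> complex ^ ('h + 'h)) \<Rightarrow> complex" where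
  "T_total \<alpha> \<psi> = (\<Sum>j\<in>UNIV. T_part \<alpha> j \<psi>)"

definition V_fun ::
    "(real \<Rightarrow> real) \<Rightarrow> (real ^ 'n \<Rightarrow> complex ^ ('h::finite + 'h)) \<Rightarrow> real" where
  "V_fun G \<psi> = (LINT x|lborel. G (beta_form (\<psi> x)))"

definition Q_fun :: "(real ^ 'n \<Rightarrow> complex ^ 'm) \<Rightarrow> complex" where
  "Q_fun \<psi> = (LINT x|lborel. star_mult (\<psi> x) (\<psi> x))"

end

theory Submission
  imports Defs
begin

text \<open>With \<open>A\<^sub>k = -\<i> \<alpha>\<^sub>k\<close>, antisymmetric for the real inner product, and \<open>s = \<phi>\<^sup>* \<beta> \<phi>\<close>,
  the stationary equation reads \<open>\<Sum>\<^sub>k A\<^sub>k \<partial>\<^sub>k \<phi> - \<omega> \<phi> + g(s) \<beta> \<phi> = 0\<close>. Pairing it with \<open>\<phi>\<close>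
  gives \<open>T + \<integral> s g(s) = \<omega> Q\<close>. Pairing it with \<open>x\<^sub>j \<partial>\<^sub>j \<phi>\<close> gives \<open>T - T\<^sub>j + V = \<omega> Q\<close>: the term
  \<open>\<partial>\<^sub>j \<phi> \<bullet> A\<^sub>j \<partial>\<^sub>j \<phi>\<close> vanishes and, for \<open>k \<noteq> j\<close>, \<open>2 \<partial>\<^sub>j \<phi> \<bullet> A\<^sub>k \<partial>\<^sub>k \<phi>\<close> is a divergence.
  The unbounded weight \<open>x\<^sub>j\<close> is replaced by \<open>R arctan (x\<^sub>j / R)\<close>, and \<open>R \<rightarrow> \<infinity>\<close>; no cutoff in the
  other variables is needed.

  Since \<open>g\<close> is not restricted at infinity, integrability of \<open>G(s)\<close> has to come from the equation: it
  puts \<open>g(s) \<phi>\<close> in \<open>L\<^sup>2\<close>, hence \<open>\<nabla> G(s) = 2 g(s) \<phi> \<bullet> \<beta> \<nabla>\<phi>\<close> in \<open>L\<^sup>1\<close>, and comparing \<open>G(s)\<close> with its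
  translates into the region where \<open>s\<close> is small bounds its \<open>L\<^sup>1\<close> norm.

  Weak derivatives are turned into limits of difference quotients in \<open>L\<^sup>2\<close>; product rule, chain rule
  and integration by parts then follow from translation invariance of Lebesgue measure.\<close>

section \<open>Smooth bump functions\<close>

text \<open>The profile has one weak derivative and no more, so the equation cannot be
  differentiated: each identity is proved for finite differences, where translation invariance does
  the work, and then passed to the limit. Averaging compares a point with translates in all
  directions, so derivatives are taken along arbitrary vectors \<open>v\<close>, not only along the
  axes.

  Write P for the integral of s g(s). The pairings give T + P = \<omega> Q and, for each j
  separately, T - T_j + V = \<omega> Q. Subtracting, T_j = V - P with a right side free of j: this
  is the equipartition, and T = n (V - P) turns the first pairing into the first identity.

  The weight depends on x_j alone, so that its other partial derivatives produce no extra terms.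
  Boundedness keeps its products with integrable functions integrable, and its derivative lies
  between 0 and 1 and tends to 1.

  Bumps serve to exploit the weak derivative: their family is stable under translation, and their
  limits are indicators of boxes, enough to identify functions almost everywhere.\<close>

lemma C_k_SucD: "C_k (Suc k) f \<Longrightarrow> C_k k f"
proof (induction k arbitrary: f)
  case 0
  then show ?case
    by (auto intro!: continuous_at_imp_continuous_on differentiable_imp_continuous_within)
next
  case (Suc k)
  then show ?case by (metis C_k.simps(2))
qed

lemma C_k_imp_continuous: "C_k k f \<Longrightarrow> continuous_on UNIV f"
  by (induction k) (use C_k_SucD in auto)

text \<open>\<open>frechet_derivative\<close> is obtained by choice; uniqueness of the derivative
  lets an explicit \<open>D\<close> replace it, which is what the inductions on k below rely
  on.\<close>

lemma C_k_SucI: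
  assumes "\<And>x. (f has_derivative D x) (at x)" and "\<And>b. b \<in> Basis \<Longrightarrow> C_k k (\<lambda>x. D x b)"
  shows "C_k (Suc k) f"
proof -
  have "frechet_derivative f (at x) = D x" for x
    using assms(1) by (metis frechet_derivative_at)
  then show ?thesis
    using assms by (auto simp: differentiable_def)
qed

lemma C_k_SucE:
  assumes "C_k (Suc k) f"
  shows "(f has_derivative frechet_derivative f (at x)) (at x)"
    and "b \<in> Basis \<Longrightarrow> C_k k (\<lambda>x. frechet_derivative f (at x) b)"
  using assms by (auto simp: frechet_derivative_works)

lemma C_k_const: "C_k k (\<lambda>_. c)"
proof (induction k arbitrary: c)
  case (Suc k)
  show ?case
    by (rule C_k_SucI[where D = "\<lambda>_ _. 0"]) (auto intro: Suc)
qed simp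

lemma C_k_inner: "C_k k (\<lambda>x. x \<bullet> v)"
proof (cases k)
  case (Suc k')
  then show ?thesis
    by (auto intro!: C_k_SucI[where D = "\<lambda>_ y. y \<bullet> v"] C_k_const derivative_eq_intros simp del: C_k.simps)
qed (auto intro!: continuous_intros)

lemma C_k_add: "C_k k f \<Longrightarrow> C_k k g \<Longrightarrow> C_k k (\<lambda>x. f x + g x)"
proof (induction k arbitrary: f g)
  case (Suc k)
  show ?case
    by (rule C_k_SucI[OF has_derivative_add[OF Suc.prems[THEN C_k_SucE(1)]]])
       (intro Suc.IH C_k_SucE(2) Suc.prems)
qed (auto intro!: continuous_intros)

lemma C_k_mult: "C_k k f \<Longrightarrow> C_k k g \<Longrightarrow> C_k k (\<lambda>x. f x * g x)"
proof (induction k arbitrary: f g)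
  case (Suc k)
  show ?case
    by (rule C_k_SucI[OF has_derivative_mult[OF Suc.prems[THEN C_k_SucE(1)]]])
       (intro C_k_add Suc.IH C_k_SucE(2) Suc.prems C_k_SucD)
qed (auto intro!: continuous_intros)

lemma C_k_prod: "finite A \<Longrightarrow> (\<And>i. i \<in> A \<Longrightarrow> C_k k (f i)) \<Longrightarrow> C_k k (\<lambda>x. \<Prod>i\<in>A. f i x)"
  by (induction A rule: finite_induct) (auto intro: C_k_const C_k_mult)

lemma C_k_compose:
  fixes g :: "real \<Rightarrow> real"
  shows "C_k k g \<Longrightarrow> C_k k f \<Longrightarrow> C_k k (\<lambda>x. g (f x))"
proof (induction k arbitrary: f g)
  case 0
  then show ?case by (auto intro: continuous_on_compose2)
next
  case (Suc k)
  \<comment> \<open>A linear map on the line is multiplication by its value at 1, so the induction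
    hypothesis is applied to the scalar derivative of \<open>g\<close>.\<close>
  have "frechet_derivative g (at (f x)) y = y * frechet_derivative g (at (f x)) 1" for x y
    using has_derivative_linear[OF C_k_SucE(1)[OF Suc.prems(1)], of "f x"]
    by (metis linear_scale mult.right_neutral real_scaleR_def)
  then have "((\<lambda>x. g (f x)) has_derivative
      (\<lambda>y. frechet_derivative f (at x) y * frechet_derivative g (at (f x)) 1)) (at x)" for x
    by (rule has_derivative_eq_rhs[OF has_derivative_compose[OF C_k_SucE(1)[OF Suc.prems(2)]
          C_k_SucE(1)[OF Suc.prems(1)]] ext])
  then show ?case
  proof (rule C_k_SucI)
    fix b :: 'a assume "b \<in> Basis"
    then show "C_k k (\<lambda>x. frechet_derivative f (at x) b * frechet_derivative g (at (f x)) 1)"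
      by (intro C_k_mult Suc.IH[of "\<lambda>t. frechet_derivative g (at t) 1"] C_k_SucE(2)[OF Suc.prems(1)]
          C_k_SucE(2)[OF Suc.prems(2)] C_k_SucD[OF Suc.prems(2)]) auto
  qed
qed

text \<open>\<open>flat 0\<close> is the classical exp(-1/t), extended by 0. The powers of 1/t make
  the span of the family closed under differentiation, so smoothness of all members is a single
  induction.\<close>

definition flat :: "nat \<Rightarrow> real \<Rightarrow> real" where
  "flat k t = (if t \<le> 0 then 0 else inverse t ^ k * exp (- inverse t))"

lemma flat_tendsto_0: "(flat k \<longlongrightarrow> 0) (at 0)"
proof -
  have "((\<lambda>t. inverse t ^ k / exp (inverse t)) \<longlongrightarrow> 0) (at_right (0::real))"
    by (rule filterlim_compose[OF tendsto_power_div_exp_0 filterlim_inverse_at_top_right])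
  then have "(flat k \<longlongrightarrow> 0) (at_right 0)"
    by (rule Lim_transform_eventually)
       (auto simp: flat_def exp_minus divide_simps eventually_at_filter)
  moreover have "(flat k \<longlongrightarrow> 0) (at_left 0)"
    by (rule tendsto_eventually) (auto simp: flat_def eventually_at_filter)
  ultimately show ?thesis by (simp add: filterlim_split_at)
qed

lemma flat_has_derivative: "(flat k has_real_derivative flat (k + 2) t - real k * flat (k + 1) t) (at t)"
proof -
  consider "t < 0" | "t = 0" | "t > 0" by linarith
  then show ?thesis
  proof cases
    case 1
    have "((\<lambda>_. 0) has_real_derivative 0) (at t)" by simp
    then have "(flat k has_real_derivative 0) (at t)"
      by (rule has_field_derivative_transform_within[where d = "-t"])
         (use 1 in \<open>auto simp: flat_def dist_real_def\<close>)
    with 1 show ?thesis by (simp add: flat_def)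
  next
    case 2
    \<comment> \<open>The difference quotient at 0 is the next member of the family, also at h = 0,
      where division by zero gives 0.\<close>
    have "(\<lambda>h. (flat k (0 + h) - flat k 0) / h) = flat (Suc k)"
      by (auto simp: flat_def fun_eq_iff field_simps)
    then have "(flat k has_real_derivative 0) (at 0)"
      unfolding DERIV_def using flat_tendsto_0[of "Suc k"] by simp
    with 2 show ?thesis by (simp add: flat_def)
  next
    case 3
    \<comment> \<open>For k = 0 the exponent k - 1 truncates to 0, harmlessly, since the factor
      \<open>real k\<close> then vanishes.\<close>
    have "((\<lambda>t. inverse t ^ k * exp (- inverse t)) has_real_derivative
        inverse t ^ k * (exp (- inverse t) * (inverse t * inverse t))
        - real k * (inverse t * inverse t * inverse t ^ (k - 1)) * exp (- inverse t)) (at t)"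
      using 3 by (auto intro!: derivative_eq_intros simp: mult_ac)
    also have "inverse t ^ k * (exp (- inverse t) * (inverse t * inverse t))
        - real k * (inverse t * inverse t * inverse t ^ (k - 1)) * exp (- inverse t)
        = flat (k + 2) t - real k * flat (k + 1) t"
      using 3 by (cases k) (simp_all add: flat_def mult_ac)
    finally have "((\<lambda>t. inverse t ^ k * exp (- inverse t)) has_real_derivative
        flat (k + 2) t - real k * flat (k + 1) t) (at t)" .
    then show ?thesis
      by (rule has_field_derivative_transform_within[where d = t])
         (use 3 in \<open>auto simp: flat_def dist_real_def\<close>)
  qed
qed

lemma C_k_flat: "C_k m (flat k)"
proof (induction m arbitrary: k)
  case 0
  show ?case
    using DERIV_continuous_on[OF flat_has_derivative] by simp
next
  case (Suc m)
  have "C_k m (\<lambda>t. flat (k + 2) t + (- real k) * flat (k + 1) t)"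
    by (intro C_k_add C_k_mult C_k_const Suc)
  then show ?case
    by (intro C_k_SucI[OF flat_has_derivative[unfolded has_field_derivative_def]]) simp
qed

text \<open>The product is positive exactly on the open box. The outer \<open>flat 0\<close> with
  the factor k keeps values in the unit interval and pushes them to 1 on the box as k grows, while
  outside it stays 0.\<close>

definition bump :: "'a::euclidean_space \<Rightarrow> 'a \<Rightarrow> nat \<Rightarrow> 'a \<Rightarrow> real" where
  "bump a b k x = flat 0 (real k * (\<Prod>i\<in>Basis. flat 0 ((x - a) \<bullet> i) * flat 0 ((b - x) \<bullet> i)))"

lemma flat_0_bounds: "0 \<le> flat 0 t" "flat 0 t \<le> 1" "flat 0 t > 0 \<longleftrightarrow> t > 0" "flat 0 t = 0 \<longleftrightarrow> t \<le> 0"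
  by (auto simp: flat_def)

lemma bump_bounds: "0 \<le> bump a b k x" "bump a b k x \<le> 1"
  by (auto simp: bump_def flat_0_bounds)

lemma bump_outside: "x \<notin> box a b \<Longrightarrow> bump a b k x = 0"
proof -
  assume "x \<notin> box a b"
  then obtain i where i: "i \<in> Basis" "(x - a) \<bullet> i \<le> 0 \<or> (b - x) \<bullet> i \<le> 0"
    by (auto simp: mem_box inner_diff_left not_less)
  then have "(\<Prod>i\<in>Basis. flat 0 ((x - a) \<bullet> i) * flat 0 ((b - x) \<bullet> i)) = 0"
    by (auto simp: flat_0_bounds intro!: prod_zero)
  then show ?thesis by (simp only: bump_def flat_0_bounds mult_zero_right order_refl)
qed

lemma bump_translate: "bump a b k (x - c) = bump (a + c) (b + c) k x"
  by (simp add: bump_def algebra_simps)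

lemma bump_tendsto: "(\<lambda>k. bump a b k x) \<longlonglongrightarrow> indicator (box a b) x"
proof (cases "x \<in> box a b")
  case True
  define p where "p = (\<Prod>i\<in>Basis. flat 0 ((x - a) \<bullet> i) * flat 0 ((b - x) \<bullet> i))"
  have bump_eq: "bump a b k x = flat 0 (real k * p)" for k
    by (simp add: bump_def p_def)
  have p: "p > 0"
    unfolding p_def using True
    by (intro prod_pos) (auto simp: flat_0_bounds mem_box inner_diff_left)
  have "filterlim (\<lambda>k. real k * p) at_top sequentially"
    by (intro filterlim_at_top_mult_tendsto_pos[OF tendsto_const p] filterlim_real_sequentially)
  then have "(\<lambda>k. inverse (real k * p)) \<longlonglongrightarrow> 0"
    by (rule tendsto_inverse_0_at_top)
  then have "(\<lambda>k. exp (- inverse (real k * p))) \<longlonglongrightarrow> exp (- 0)"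
    by (intro tendsto_intros)
  then have "(\<lambda>k. exp (- inverse (real k * p))) \<longlonglongrightarrow> 1"
    by simp
  then have "(\<lambda>k. bump a b k x) \<longlonglongrightarrow> 1"
    by (rule Lim_transform_eventually[OF _ eventually_mono[OF eventually_gt_at_top[of 0]]])
       (use p in \<open>auto simp: bump_eq flat_def mult_le_0_iff\<close>)
  with True show ?thesis by simp
qed (simp add: bump_outside)

lemma test_function_bump: "test_function (bump a b k)"
proof -
  have "C_k m (bump a b k)" for m
  proof -
    have "C_k m (\<lambda>x. flat 0 (real k *
        (\<Prod>i\<in>Basis. flat 0 (x \<bullet> i + (- (a \<bullet> i))) * flat 0 (b \<bullet> i + (-1) * (x \<bullet> i)))))"
      by (intro C_k_compose[OF C_k_flat] C_k_mult C_k_prod C_k_add C_k_const C_k_inner) auto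
    then show ?thesis
      by (simp add: bump_def[abs_def] inner_diff_left)
  qed
  moreover have "closure {x. bump a b k x \<noteq> 0} \<subseteq> cbox a b"
    by (rule closure_minimal) (use bump_outside box_subset_cbox in blast)+
  then have "compact (closure {x. bump a b k x \<noteq> 0})"
    by (meson bounded_cbox bounded_subset closed_closure compact_eq_bounded_closed)
  ultimately show ?thesis
    by (simp add: test_function_def smooth_def)
qed

lemma test_function_has_derivative:
  "test_function f \<Longrightarrow> (f has_derivative frechet_derivative f (at x)) (at x)"
  unfolding test_function_def smooth_def by (meson C_k_SucE(1))

lemma test_function_continuous:
  assumes "test_function f"
  shows "continuous_on UNIV f" "continuous_on UNIV (\<lambda>x. frechet_derivative f (at x) v)"
proof -
  have C: "C_k (Suc 0) f" using assms by (auto simp: test_function_def smooth_def simp del: C_k.simps)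
  show "continuous_on UNIV f" using C_k_imp_continuous[OF C] .
  have "frechet_derivative f (at x) v = (\<Sum>b\<in>Basis. (v \<bullet> b) * frechet_derivative f (at x) b)" for x
  proof -
    interpret linear "frechet_derivative f (at x)"
      using has_derivative_linear[OF test_function_has_derivative[OF assms]] .
    have "frechet_derivative f (at x) v = frechet_derivative f (at x) (\<Sum>b\<in>Basis. (v \<bullet> b) *\<^sub>R b)"
      by (simp add: euclidean_representation)
    then show ?thesis by (simp add: sum scale)
  qed
  moreover have "continuous_on UNIV (\<lambda>x. frechet_derivative f (at x) b)" if "b \<in> Basis" for b
    using C_k_SucE(2)[OF C that] by simp
  ultimately show "continuous_on UNIV (\<lambda>x. frechet_derivative f (at x) v)"
    by (auto intro!: continuous_intros)
qed

lemma test_function_outside: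
  assumes "test_function f" "x \<notin> closure {x. f x \<noteq> 0}"
  shows "f x = 0" "frechet_derivative f (at x) v = 0"
proof -
  show "f x = 0" using assms(2) closure_subset[of "{x. f x \<noteq> 0}"] by auto
  have "((\<lambda>_. 0) has_derivative (\<lambda>_. 0)) (at x)" by simp
  then have "(f has_derivative (\<lambda>_. 0)) (at x)"
    by (rule has_derivative_transform_within_open[where s = "- closure {x. f x \<noteq> 0}"])
       (use assms(2) closure_subset[of "{x. f x \<noteq> 0}"] in auto)
  then show "frechet_derivative f (at x) v = 0"
    by (metis frechet_derivative_at)
qed

section \<open>Square integrable functions and translations\<close>

lemma integral_translate:
  fixes f :: "'a::euclidean_space \<Rightarrow> 'b::{banach,second_countable_topology}"
  assumes "f \<in> borel_measurable lborel"
  shows "(LINT x|lborel. f (x + v)) = (LINT x|lborel. f x)"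
  using integral_distr[of "(+) v" lborel borel f] assms by (simp add: lborel_distr_plus add.commute)

lemma integrable_translate:
  fixes f :: "'a::euclidean_space \<Rightarrow> 'b::{banach,second_countable_topology}"
  assumes "integrable lborel f"
  shows "integrable lborel (\<lambda>x. f (x + v))"
  using integrable_distr[of "(+) v" lborel borel f] assms by (simp add: lborel_distr_plus add.commute)

lemma borel_measurable_vec_nth [measurable]: "(\<lambda>x::real ^ 'n. x $ j) \<in> borel_measurable borel"
  by (intro borel_measurable_continuous_onI continuous_intros)

lemma integrable_bounded_mult:
  fixes z f :: "'a \<Rightarrow> real"
  assumes "integrable M f" "z \<in> borel_measurable M" "\<And>x. \<bar>z x\<bar> \<le> Z"
  shows "integrable M (\<lambda>x. z x * f x)"
proof (rule Bochner_Integration.integrable_bound[OF integrable_mult_right[OF assms(1), of Z]])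
  show "AE x in M. norm (z x * f x) \<le> norm (Z * f x)"
    using assms(3) by (auto simp: abs_mult intro!: AE_I2 mult_right_mono order_trans[OF assms(3) abs_ge_self])
qed (use assms in measurable)

text \<open>Bumps converge boundedly to box indicators, so \<open>u\<close> integrates to 0 over
  every box. The positive and negative parts of \<open>u\<close> are then densities of measures that
  agree on boxes, an intersection-stable generator of the Borel sets, hence they agree almost
  everywhere.\<close>

lemma fundamental_lemma_bump:
  fixes u :: "'a::euclidean_space \<Rightarrow> real"
  assumes [measurable]: "u \<in> borel_measurable lborel"
    and int: "\<And>a b. integrable lborel (\<lambda>x. indicator (box a b) x * u x)"
    and zero: "\<And>a b k. (LINT x|lborel. bump a b k x * u x) = 0"
  shows "AE x in lborel. u x = 0"
proof -
  have bump_meas[measurable]: "bump a b k \<in> borel_measurable borel" for a b :: 'a and k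
    using test_function_continuous(1)[OF test_function_bump] by (rule borel_measurable_continuous_onI)
  have int0: "(LINT x|lborel. indicator (box a b) x * u x) = 0" for a b
  proof -
    have "(\<lambda>k. LINT x|lborel. bump a b k x * u x) \<longlonglongrightarrow> (LINT x|lborel. indicator (box a b) x * u x)"
    proof (rule integral_dominated_convergence)
      show "integrable lborel (\<lambda>x. \<bar>indicator (box a b) x * u x\<bar>)"
        using int by (rule integrable_abs)
      show "AE x in lborel. (\<lambda>k. bump a b k x * u x) \<longlonglongrightarrow> indicator (box a b) x * u x"
        by (intro AE_I2 tendsto_intros bump_tendsto)
      show "AE x in lborel. norm (bump a b k x * u x) \<le> \<bar>indicator (box a b) x * u x\<bar>" for k
      proof (intro AE_I2)
        fix x
        show "norm (bump a b k x * u x) \<le> \<bar>indicator (box a b) x * u x\<bar>"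
          using bump_bounds[of a b k x]
          by (cases "x \<in> box a b") (auto simp: bump_outside abs_mult intro: mult_left_le_one_le)
      qed
    qed auto
    then show ?thesis by (simp add: zero LIMSEQ_const_iff)
  qed
  have box: "(\<integral>\<^sup>+x. ennreal (u x) * indicator (box a b) x \<partial>lborel) = ennreal (LINT x|lborel. indicator (box a b) x * max 0 (u x))"
    "(\<integral>\<^sup>+x. ennreal (u x) * indicator (box a b) x \<partial>lborel) = (\<integral>\<^sup>+x. ennreal (- u x) * indicator (box a b) x \<partial>lborel)" for a b
  proof -
    have i1: "integrable lborel (\<lambda>x. indicator (box a b) x * max 0 (u x))"
      by (rule Bochner_Integration.integrable_bound[OF int[of a b]]) (auto simp: indicator_def)
    have i2: "integrable lborel (\<lambda>x. indicator (box a b) x * max 0 (- u x))"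
      by (rule Bochner_Integration.integrable_bound[OF int[of a b]]) (auto simp: indicator_def)
    have e1: "(\<integral>\<^sup>+x. ennreal (u x) * indicator (box a b) x \<partial>lborel) = ennreal (LINT x|lborel. indicator (box a b) x * max 0 (u x))"
      by (subst nn_integral_eq_integral[OF i1, symmetric]) (auto intro!: nn_integral_cong simp: max_def ennreal_neg split: split_indicator)
    have e2: "(\<integral>\<^sup>+x. ennreal (- u x) * indicator (box a b) x \<partial>lborel) = ennreal (LINT x|lborel. indicator (box a b) x * max 0 (- u x))"
      by (subst nn_integral_eq_integral[OF i2, symmetric]) (auto intro!: nn_integral_cong simp: max_def ennreal_neg split: split_indicator)
    have "(LINT x|lborel. indicator (box a b) x * max 0 (u x)) - (LINT x|lborel. indicator (box a b) x * max 0 (- u x))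
        = (LINT x|lborel. indicator (box a b) x * u x)"
      unfolding Bochner_Integration.integral_diff[OF i1 i2, symmetric]
      by (rule Bochner_Integration.integral_cong) (auto simp: indicator_def)
    then have "(LINT x|lborel. indicator (box a b) x * max 0 (u x)) = (LINT x|lborel. indicator (box a b) x * max 0 (- u x))"
      by (simp add: int0)
    with e1 e2 show "(\<integral>\<^sup>+x. ennreal (u x) * indicator (box a b) x \<partial>lborel) = ennreal (LINT x|lborel. indicator (box a b) x * max 0 (u x))"
      "(\<integral>\<^sup>+x. ennreal (u x) * indicator (box a b) x \<partial>lborel) = (\<integral>\<^sup>+x. ennreal (- u x) * indicator (box a b) x \<partial>lborel)"
      by simp_all
  qed
  have "density lborel (\<lambda>x. ennreal (u x)) = density lborel (\<lambda>x. ennreal (- u x))"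
  proof (rule measure_eqI_generator_eq)
    let ?E = "range (\<lambda>(a, b). box a b::'a set)"
    show "Int_stable ?E"
      by (auto simp: Int_stable_def box_Int_box)
    show "?E \<subseteq> Pow UNIV" "sets (density lborel (\<lambda>x. ennreal (u x))) = sigma_sets UNIV ?E"
        "sets (density lborel (\<lambda>x. ennreal (- u x))) = sigma_sets UNIV ?E"
      by (simp_all add: borel_eq_box)
    let ?A = "\<lambda>n::nat. box (- (real n *\<^sub>R One)) (real n *\<^sub>R One) :: 'a set"
    show "range ?A \<subseteq> ?E" "(\<Union>i. ?A i) = UNIV"
      unfolding UN_box_eq_UNIV by auto
    show "emeasure (density lborel (\<lambda>x. ennreal (u x))) (?A i) \<noteq> \<infinity>" for i
      by (simp add: emeasure_density box(1))
    show "emeasure (density lborel (\<lambda>x. ennreal (u x))) X = emeasure (density lborel (\<lambda>x. ennreal (- u x))) X"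
      if "X \<in> ?E" for X
      using that by (auto simp: emeasure_density box(2))
  qed
  then have "AE x in lborel. ennreal (u x) = ennreal (- u x)"
    by (subst sigma_finite_measure.density_unique_iff[OF sigma_finite_lborel, symmetric]) auto
  \<comment> \<open>\<open>ennreal\<close> sends negative reals to 0, so the two densities are the
    positive and negative parts of \<open>u\<close>; at most one of them is nonzero at a
    point.\<close>
  then show ?thesis
  proof eventually_elim
    case (elim x)
    then show ?case
      by (cases "u x" "0 :: real" rule: linorder_cases) (auto simp: ennreal_neg)
  qed
qed

lemma L2_measurable [measurable_dest]: "L2 f \<Longrightarrow> f \<in> borel_measurable borel"
  by (simp add: L2_def)

lemma L2_integrable: "L2 f \<Longrightarrow> integrable lborel (\<lambda>x. (norm (f x))\<^sup>2)"
  by (simp add: L2_def)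

lemma L2_bound:
  fixes g :: "real ^ 'n \<Rightarrow> real"
  assumes "integrable lborel g" "f \<in> borel_measurable borel" "\<And>x. (norm (f x))\<^sup>2 \<le> g x"
  shows "L2 f"
proof -
  note [measurable] = assms(2)
  show ?thesis
    unfolding L2_def
    using order_trans[OF assms(3) abs_ge_self]
    by (auto intro!: Bochner_Integration.integrable_bound[OF assms(1)])
qed

lemma L2_bound':
  assumes "L2 g" "f \<in> borel_measurable borel" "\<And>x. norm (f x) \<le> c * norm (g x)"
  shows "L2 f"
proof (rule L2_bound[OF integrable_mult_right[OF L2_integrable[OF assms(1)], of "c\<^sup>2"] assms(2)])
  show "(norm (f x))\<^sup>2 \<le> c\<^sup>2 * (norm (g x))\<^sup>2" for x
    using power_mono[OF assms(3), of x 2] by (simp add: power_mult_distrib)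
qed

lemma norm_add_square: "(norm (a + b))\<^sup>2 \<le> 2 * (norm a)\<^sup>2 + 2 * (norm (b::'a::real_normed_vector))\<^sup>2"
proof -
  have "(norm (a + b))\<^sup>2 \<le> (norm a + norm b)\<^sup>2"
    by (intro power_mono norm_triangle_ineq) auto
  also have "\<dots> \<le> 2 * (norm a)\<^sup>2 + 2 * (norm b)\<^sup>2"
    using sum_squares_bound[of "norm a" "norm b"] by (simp add: power2_sum)
  finally show ?thesis .
qed

lemma L2_translate: "L2 f \<Longrightarrow> L2 (\<lambda>x. f (x + v))"
  using integrable_translate[of "\<lambda>x. (norm (f x))\<^sup>2" v] by (auto simp: L2_def)

lemma L2_add: "L2 f \<Longrightarrow> L2 g \<Longrightarrow> L2 (\<lambda>x. f x + g x)"
  by (rule L2_bound[of "\<lambda>x. 2 * (norm (f x))\<^sup>2 + 2 * (norm (g x))\<^sup>2"])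
     (auto simp: norm_add_square L2_integrable L2_def)

lemma L2_scaleR: "L2 f \<Longrightarrow> L2 (\<lambda>x. c *\<^sub>R f x)"
  by (rule L2_bound'[of f _ "\<bar>c\<bar>"]) (auto simp: L2_def)

lemma L2_diff: "L2 f \<Longrightarrow> L2 g \<Longrightarrow> L2 (\<lambda>x. f x - g x)"
  using L2_add[of f "\<lambda>x. - 1 *\<^sub>R g x"] L2_scaleR[of g "-1"] by simp

lemma L2_zero: "L2 (\<lambda>_. 0)"
  by (simp add: L2_def)

lemma L2_sum: "finite A \<Longrightarrow> (\<And>i. i \<in> A \<Longrightarrow> L2 (f i)) \<Longrightarrow> L2 (\<lambda>x. \<Sum>i\<in>A. f i x)"
  by (induction A rule: finite_induct) (auto intro: L2_zero L2_add)

lemma L2_linear: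
  assumes "bounded_linear h" "L2 f"
  shows "L2 (\<lambda>x. h (f x))"
proof -
  obtain K where "\<And>x. norm (h x) \<le> norm x * K"
    using bounded_linear.bounded[OF assms(1)] by blast
  moreover have "(\<lambda>x. h (f x)) \<in> borel_measurable borel"
    using borel_measurable_continuous_onI[OF linear_continuous_on[OF assms(1)]] assms(2) by measurable
  ultimately show ?thesis
    by (intro L2_bound'[OF assms(2), where c = K]) (auto simp: mult.commute)
qed

lemma L2_inner: "L2 f \<Longrightarrow> L2 (\<lambda>x. f x \<bullet> b)"
  by (rule L2_linear[OF bounded_linear_inner_left])

lemma L2_mult_integrable:
  assumes "L2 f" "L2 g"
  shows "integrable lborel (\<lambda>x. norm (f x) * norm (g x))"
proof (rule Bochner_Integration.integrable_bound)
  show "integrable lborel (\<lambda>x. (norm (f x))\<^sup>2 + (norm (g x))\<^sup>2)"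
    using assms by (auto simp: L2_integrable)
  show "AE x in lborel. norm (norm (f x) * norm (g x)) \<le> norm ((norm (f x))\<^sup>2 + (norm (g x))\<^sup>2)"
  proof (intro AE_I2)
    fix x
    have "norm (f x) * norm (g x) \<le> (norm (f x))\<^sup>2 + (norm (g x))\<^sup>2"
      using sum_squares_bound[of "norm (f x)" "norm (g x)"]
        mult_nonneg_nonneg[OF norm_ge_zero norm_ge_zero, of "f x" "g x"] by linarith
    then show "norm (norm (f x) * norm (g x)) \<le> norm ((norm (f x))\<^sup>2 + (norm (g x))\<^sup>2)"
      by simp
  qed
qed (use assms in measurable)

lemma L2_bilinear_integrable:
  fixes p :: "'b::euclidean_space \<Rightarrow> 'c::euclidean_space \<Rightarrow> 'd::euclidean_space"
  assumes "bounded_bilinear p" "L2 f" "L2 g"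
  shows "integrable lborel (\<lambda>x. p (f x) (g x))"
proof -
  obtain K where K: "\<And>a b. norm (p a b) \<le> norm a * norm b * K"
    using bounded_bilinear.bounded[OF assms(1)] by blast
  have c: "continuous_on UNIV (\<lambda>z. p (fst z) (snd z))"
    by (intro bounded_bilinear.continuous_on[OF assms(1)] continuous_intros)
  have "(\<lambda>x. p (fst (f x, g x)) (snd (f x, g x))) \<in> borel_measurable borel"
    using borel_measurable_continuous_onI[OF c] assms(2,3) by measurable
  then show ?thesis
    using K by (intro Bochner_Integration.integrable_bound[OF integrable_mult_left[OF L2_mult_integrable[OF assms(2,3)], of K]])
      (auto intro: order_trans[OF _ abs_ge_self])
qed

text \<open>The squared \<open>L\<^sup>2\<close> norm, kept without the root so that it adds over
  components. It is meaningful only alongside \<open>L2\<close>, since the integral of a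
  non-integrable function is 0 by default.\<close>

definition sqn :: "(real ^ 'n \<Rightarrow> 'b::euclidean_space) \<Rightarrow> real" where
  "sqn f = (LINT x|lborel. (norm (f x))\<^sup>2)"

lemma sqn_nonneg: "0 \<le> sqn f"
  by (simp add: sqn_def)

lemma sqn_add: "L2 f \<Longrightarrow> L2 g \<Longrightarrow> sqn (\<lambda>x. f x + g x) \<le> 2 * sqn f + 2 * sqn g"
proof -
  assume fg: "L2 f" "L2 g"
  then have "sqn (\<lambda>x. f x + g x) \<le> (LINT x|lborel. 2 * (norm (f x))\<^sup>2 + 2 * (norm (g x))\<^sup>2)"
    unfolding sqn_def
    by (intro integral_mono L2_integrable L2_add) (auto simp: L2_integrable norm_add_square)
  also have "\<dots> = 2 * sqn f + 2 * sqn g"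
    using fg by (simp add: sqn_def L2_integrable)
  finally show ?thesis .
qed

lemma sqn_scaleR: "sqn (\<lambda>x. c *\<^sub>R f x) = c\<^sup>2 * sqn f"
  by (simp add: sqn_def power_mult_distrib)

lemma sqn_minus_commute: "sqn (\<lambda>x. f x - g x) = sqn (\<lambda>x. g x - f x)"
  by (simp add: sqn_def norm_minus_commute)

lemma sqn_translate: "L2 f \<Longrightarrow> sqn (\<lambda>x. f (x + v)) = sqn f"
  unfolding sqn_def by (rule integral_translate[of "\<lambda>x. (norm (f x))\<^sup>2" v]) (auto simp: L2_def)

lemma sqn_components:
  assumes "L2 f"
  shows "sqn f = (\<Sum>b\<in>Basis. sqn (\<lambda>x. f x \<bullet> b))"
proof -
  have "(norm (f x))\<^sup>2 = (\<Sum>b\<in>Basis. (norm (f x \<bullet> b))\<^sup>2)" for x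
    by (simp add: power2_norm_eq_inner) (simp add: euclidean_inner[of "f x" "f x"] power2_eq_square)
  then show ?thesis
    unfolding sqn_def using L2_integrable[OF L2_inner[OF assms]] by simp
qed

lemma sqn_cong_AE:
  "AE x in lborel. f x = g x \<Longrightarrow> f \<in> borel_measurable borel \<Longrightarrow> g \<in> borel_measurable borel \<Longrightarrow> sqn f = sqn g"
  unfolding sqn_def by (intro integral_cong_AE) auto

lemma L2_Cauchy_Schwarz:
  assumes "L2 f" "L2 g"
  shows "(LINT x|lborel. norm (f x) * norm (g x)) \<le> sqrt (sqn f) * sqrt (sqn g)"
proof -
  note [measurable] = assms[THEN L2_measurable]
  have "(\<integral>\<^sup>+x. ennreal (norm (f x)) * ennreal (norm (g x)) \<partial>lborel)\<^sup>2 \<le>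
      (\<integral>\<^sup>+x. (ennreal (norm (f x)))\<^sup>2 \<partial>lborel) * (\<integral>\<^sup>+x. (ennreal (norm (g x)))\<^sup>2 \<partial>lborel)"
    by (rule Cauchy_Schwarz_nn_integral) auto
  also have "(\<integral>\<^sup>+x. (ennreal (norm (f x)))\<^sup>2 \<partial>lborel) = ennreal (sqn f)"
    by (simp add: sqn_def ennreal_power nn_integral_eq_integral[OF L2_integrable[OF assms(1)]])
  also have "(\<integral>\<^sup>+x. (ennreal (norm (g x)))\<^sup>2 \<partial>lborel) = ennreal (sqn g)"
    by (simp add: sqn_def ennreal_power nn_integral_eq_integral[OF L2_integrable[OF assms(2)]])
  also have "(\<integral>\<^sup>+x. ennreal (norm (f x)) * ennreal (norm (g x)) \<partial>lborel) = ennreal (LINT x|lborel. norm (f x) * norm (g x))"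
    by (simp add: ennreal_mult'[symmetric] nn_integral_eq_integral[OF L2_mult_integrable[OF assms]])
  finally have "(LINT x|lborel. norm (f x) * norm (g x))\<^sup>2 \<le> sqn f * sqn g"
    by (simp add: ennreal_power ennreal_mult'[symmetric] sqn_nonneg)
  then have "sqrt ((LINT x|lborel. norm (f x) * norm (g x))\<^sup>2) \<le> sqrt (sqn f * sqn g)"
    by (rule real_sqrt_le_mono)
  then show ?thesis by (simp add: real_sqrt_mult)
qed

text \<open>Cauchy-Schwarz in the form in which every error term below is discarded: one factor
  tends to 0 in mean square, the other stays bounded.\<close>

lemma L2_product_tendsto_0:
  assumes "\<And>k. L2 (F k)" "\<And>k. L2 (G k)" "(\<lambda>k. sqn (F k)) \<longlonglongrightarrow> 0" "\<And>k. sqn (G k) \<le> B"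
  shows "(\<lambda>k. LINT x|lborel. norm (F k x) * norm (G k x)) \<longlonglongrightarrow> 0"
proof (rule tendsto_sandwich[OF _ _ tendsto_const])
  show "\<forall>\<^sub>F k in sequentially. 0 \<le> (LINT x|lborel. norm (F k x) * norm (G k x))"
    by simp
  show "\<forall>\<^sub>F k in sequentially. (LINT x|lborel. norm (F k x) * norm (G k x)) \<le> sqrt (sqn (F k)) * sqrt B"
    using assms by (intro always_eventually allI order_trans[OF L2_Cauchy_Schwarz] mult_left_mono real_sqrt_le_mono)
      (auto simp: sqn_nonneg)
  show "(\<lambda>k. sqrt (sqn (F k)) * sqrt B) \<longlonglongrightarrow> 0"
    using tendsto_mult_right[OF tendsto_real_sqrt[OF assms(3)], of "sqrt B"] by simp
qed

section \<open>Mean-square continuity of translations\<close>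

definition translation_continuous :: "(real ^ 'n \<Rightarrow> 'b::euclidean_space) \<Rightarrow> bool" where
  "translation_continuous f \<longleftrightarrow> (\<forall>v. v \<longlonglongrightarrow> 0 \<longrightarrow> (\<lambda>k. sqn (\<lambda>x. f (x + v k) - f x)) \<longlonglongrightarrow> 0)"

lemma translation_continuous_closed:
  assumes "L2 f"
    and approx: "\<And>e. e > 0 \<Longrightarrow> \<exists>g. L2 g \<and> translation_continuous g \<and> sqn (\<lambda>x. f x - g x) < e"
  shows "translation_continuous f"
  unfolding translation_continuous_def
proof (intro allI impI)
  fix v :: "nat \<Rightarrow> real ^ 'a"
  assume v: "v \<longlonglongrightarrow> 0"
  show "(\<lambda>k. sqn (\<lambda>x. f (x + v k) - f x)) \<longlonglongrightarrow> 0"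
  proof (rule LIMSEQ_I)
    fix r :: real assume r: "0 < r"
    \<comment> \<open>The splitting into \<open>g\<close> and the remainder \<open>h\<close> costs 2
      (r/8) + 8 (r/12) = 11 r/12 < r.\<close>
    then obtain g where g: "L2 g" "translation_continuous g" "sqn (\<lambda>x. f x - g x) < r / 12"
      using approx[of "r / 12"] by auto
    have "(\<lambda>k. sqn (\<lambda>x. g (x + v k) - g x)) \<longlonglongrightarrow> 0"
      using g v by (simp add: translation_continuous_def)
    then have "\<forall>\<^sub>F k in sequentially. sqn (\<lambda>x. g (x + v k) - g x) < r / 8"
      by (rule order_tendstoD) (use r in simp)
    then have "\<forall>\<^sub>F k in sequentially. norm (sqn (\<lambda>x. f (x + v k) - f x) - 0) < r"
    proof eventually_elim
      case (elim k)
      define h where "h x = f x - g x" for x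
      have h: "L2 h" unfolding h_def using L2_diff assms(1) g(1) by blast
      have "sqn (\<lambda>x. f (x + v k) - f x) = sqn (\<lambda>x. (g (x + v k) - g x) + (h (x + v k) - h x))"
        by (simp add: h_def)
      also have "\<dots> \<le> 2 * sqn (\<lambda>x. g (x + v k) - g x) + 2 * sqn (\<lambda>x. h (x + v k) - h x)"
        by (intro sqn_add L2_diff L2_translate g h)
      also have "sqn (\<lambda>x. h (x + v k) - h x) \<le> 2 * sqn h + 2 * sqn h"
        using sqn_add[OF L2_translate[OF h, of "v k"] L2_scaleR[OF h, of "-1"]]
        by (simp add: sqn_scaleR[of "-1", simplified] sqn_translate[OF h])
      finally have "sqn (\<lambda>x. f (x + v k) - f x) \<le> 2 * sqn (\<lambda>x. g (x + v k) - g x) + 8 * sqn h"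
        by simp
      then show ?case
        using elim g(3) sqn_nonneg[of "\<lambda>x. f (x + v k) - f x"] unfolding h_def by simp
    qed
    then show "\<exists>no. \<forall>n\<ge>no. norm (sqn (\<lambda>x. f (x + v n) - f x) - 0) < r"
      by (simp add: eventually_sequentially)
  qed
qed

lemma translation_continuous_scaleR:
  "translation_continuous f \<Longrightarrow> translation_continuous (\<lambda>x. c *\<^sub>R f x)"
  unfolding translation_continuous_def scaleR_diff_right[symmetric] sqn_scaleR
  by (auto intro: tendsto_mult_right_zero)

lemma translation_continuous_add:
  assumes "L2 f" "L2 g" "translation_continuous f" "translation_continuous g"
  shows "translation_continuous (\<lambda>x. f x + g x)"
  unfolding translation_continuous_def
proof (intro allI impI)
  fix v :: "nat \<Rightarrow> real ^ 'a"
  assume v: "v \<longlonglongrightarrow> 0"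
  show "(\<lambda>k. sqn (\<lambda>x. f (x + v k) + g (x + v k) - (f x + g x))) \<longlonglongrightarrow> 0"
  proof (rule tendsto_sandwich[OF _ _ tendsto_const])
    show "\<forall>\<^sub>F k in sequentially. sqn (\<lambda>x. f (x + v k) + g (x + v k) - (f x + g x))
        \<le> 2 * sqn (\<lambda>x. f (x + v k) - f x) + 2 * sqn (\<lambda>x. g (x + v k) - g x)"
      unfolding add_diff_add
      by (intro always_eventually allI sqn_add L2_diff L2_translate assms)
    have "(\<lambda>k. 2 * sqn (\<lambda>x. f (x + v k) - f x) + 2 * sqn (\<lambda>x. g (x + v k) - g x)) \<longlonglongrightarrow> 2 * 0 + 2 * 0"
      using assms v by (intro tendsto_intros) (auto simp: translation_continuous_def)
    then show "(\<lambda>k. 2 * sqn (\<lambda>x. f (x + v k) - f x) + 2 * sqn (\<lambda>x. g (x + v k) - g x)) \<longlonglongrightarrow> 0"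
      by simp
  qed (simp add: sqn_nonneg)
qed

text \<open>For an open set \<open>U\<close> the indicator of \<open>U \<inter> (U - v)\<close> tends to that of \<open>U\<close> everywhere,
  boundary points included, because \<open>x \<in> U\<close> implies \<open>x + v \<in> U\<close> for small \<open>v\<close>.\<close>

lemma translation_continuous_open:
  fixes U :: "(real ^ 'n) set"
  assumes "open U" and fin: "emeasure lborel U < \<infinity>"
  shows "translation_continuous (indicator U :: _ \<Rightarrow> real)"
  unfolding translation_continuous_def
proof (intro allI impI)
  fix v :: "nat \<Rightarrow> real ^ 'n"
  assume v: "v \<longlonglongrightarrow> 0"
  have [measurable]: "U \<in> sets borel" using assms(1) by simp
  have int: "integrable lborel (indicator U :: _ \<Rightarrow> real)"
    using fin by simp
  have lim: "(\<lambda>k. LINT x|lborel. indicator U (x + v k) * indicator U x :: real) \<longlonglongrightarrow> (LINT x|lborel. indicator U x)"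
  proof (rule integral_dominated_convergence[OF _ _ int])
    show "AE x in lborel. (\<lambda>k. indicator U (x + v k) * indicator U x :: real) \<longlonglongrightarrow> indicator U x"
    proof (intro AE_I2)
      fix x
      show "(\<lambda>k. indicator U (x + v k) * indicator U x :: real) \<longlonglongrightarrow> indicator U x"
      proof (cases "x \<in> U")
        case True
        have "(\<lambda>k. x + v k) \<longlonglongrightarrow> x" using tendsto_add[OF tendsto_const v, of x] by simp
        then have "\<forall>\<^sub>F k in sequentially. x + v k \<in> U"
          using assms(1) True by (metis topological_tendstoD)
        then show ?thesis
          by (intro tendsto_eventually) (auto simp: True elim: eventually_mono)
      qed simp
    qed
  qed (auto simp: indicator_def)
  have i2: "integrable lborel (\<lambda>x. indicator U (x + v k) * indicator U x :: real)" for k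
    by (rule Bochner_Integration.integrable_bound[OF int]) (auto simp: indicator_def)
  have "sqn (\<lambda>x. indicator U (x + v k) - indicator U x :: real) =
      2 * (LINT x|lborel. indicator U x) - 2 * (LINT x|lborel. indicator U (x + v k) * indicator U x)" for k
  proof -
    have "sqn (\<lambda>x. indicator U (x + v k) - indicator U x :: real)
        = (LINT x|lborel. indicator U (x + v k) + indicator U x - 2 * (indicator U (x + v k) * indicator U x))"
      unfolding sqn_def by (rule Bochner_Integration.integral_cong) (auto simp: indicator_def)
    also have "\<dots> = (LINT x|lborel. indicator U (x + v k)) + (LINT x|lborel. indicator U x)
        - 2 * (LINT x|lborel. indicator U (x + v k) * indicator U x)"
      using int i2 integrable_translate[OF int, of "v k"] by simp
    finally show ?thesis
      using integral_translate[of "indicator U :: _ \<Rightarrow> real" "v k"] by simp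
  qed
  moreover have "(\<lambda>k. 2 * (LINT x|lborel. indicator U x) - 2 * (LINT x|lborel. indicator U (x + v k) * indicator U x :: real))
      \<longlonglongrightarrow> 2 * (LINT x|lborel. indicator U x) - 2 * (LINT x|lborel. indicator U x)"
    by (intro tendsto_intros lim)
  ultimately show "(\<lambda>k. sqn (\<lambda>x. indicator U (x + v k) - indicator U x :: real)) \<longlonglongrightarrow> 0"
    by simp
qed

text \<open>Outer regularity gives an open U containing A with small excess, and the squared
  distance of the two indicators is exactly the measure of U - A.\<close>

lemma translation_continuous_indicator:
  fixes A :: "(real ^ 'n) set"
  assumes [measurable]: "A \<in> sets borel" and fin: "emeasure lborel A < \<infinity>"
  shows "translation_continuous (indicator A :: _ \<Rightarrow> real)"
proof (rule translation_continuous_closed)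
  have L2_ind: "L2 (indicator B :: _ \<Rightarrow> real)" if "B \<in> sets borel" "emeasure lborel B < \<infinity>" for B :: "(real ^ 'n) set"
    using that by (intro L2_bound[of "indicator B"]) (auto simp: indicator_def)
  show "L2 (indicator A :: _ \<Rightarrow> real)" by (rule L2_ind) fact+
  fix e :: real assume e: "e > 0"
  obtain U where U: "open U" "A \<subseteq> U" "emeasure lborel (U - A) < e"
    using outer_regular_lborel[OF assms(1) e] by blast
  have [measurable]: "U \<in> sets borel" using U(1) by simp
  have "emeasure lborel U = emeasure lborel A + emeasure lborel (U - A)"
    using U(2) by (subst plus_emeasure) (auto intro!: arg_cong[where f = "emeasure lborel"])
  also have "\<dots> < \<infinity>" using fin less_trans[OF U(3) ennreal_less_top] by (simp add: less_top ennreal_add_eq_top)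
  finally have Ufin: "emeasure lborel U < \<infinity>" .
  have "sqn (\<lambda>x. indicator A x - indicator U x :: real) = (LINT x|lborel. indicator (U - A) x)"
    unfolding sqn_def by (rule Bochner_Integration.integral_cong) (use U(2) in \<open>auto simp: indicator_def\<close>)
  also have "\<dots> < e"
    using U(3) less_trans[OF U(3) ennreal_less_top] by (simp add: measure_def enn2real_less_iff)
  finally show "\<exists>g. L2 g \<and> translation_continuous g \<and> sqn (\<lambda>x. indicator A x - g x :: real) < e"
    using L2_ind[OF _ Ufin] translation_continuous_open[OF U(1) Ufin] by auto
qed

text \<open>Induction over nonnegative measurable functions. Square integrability sits in the
  conclusion as an implication so that each case can pass it from the whole function to its smaller
  pieces.\<close>

lemma translation_continuous_nonneg:
  fixes f :: "real ^ 'n \<Rightarrow> real"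
  assumes "f \<in> borel_measurable lborel" "\<And>x. 0 \<le> f x"
  shows "L2 f \<longrightarrow> translation_continuous f"
  using assms
proof (induct rule: borel_measurable_induct_real)
  case (set A)
  show ?case
  proof
    assume "L2 (indicator A :: _ \<Rightarrow> real)"
    then have "integrable lborel (\<lambda>x. (norm (indicator A x :: real))\<^sup>2)" by (simp add: L2_def)
    also have "(\<lambda>x. (norm (indicator A x :: real))\<^sup>2) = indicator A" by (auto simp: indicator_def)
    finally show "translation_continuous (indicator A :: _ \<Rightarrow> real)"
      using set by (intro translation_continuous_indicator) (auto simp: integrable_indicator_iff)
  qed
next
  case (mult u c)
  show ?case
  proof
    assume L2: "L2 (\<lambda>x. c * u x)"
    show "translation_continuous (\<lambda>x. c * u x)"
    proof (cases "c = 0")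
      case True
      then show ?thesis by (simp add: translation_continuous_def sqn_def)
    next
      case False
      then have "L2 u" using L2_scaleR[OF L2, of "inverse c"] by (simp add: mult.assoc[symmetric])
      then show ?thesis using mult translation_continuous_scaleR[of u c] by simp
    qed
  qed
next
  case (add u v)
  show ?case
  proof
    assume L2: "L2 (\<lambda>x. v x + u x)"
    have "L2 u" "L2 v" using add by (auto intro!: L2_bound'[OF L2, where c = 1])
    then show "translation_continuous (\<lambda>x. v x + u x)"
      using add by (intro translation_continuous_add) auto
  qed
next
  case (seq U)
  show ?case
  proof
    assume L2: "L2 f"
    have le: "U i x \<le> f x" for i x
      using seq(4) seq(5)[of x] by (intro incseq_le[of "\<lambda>i. U i x"]) (auto simp: incseq_def le_fun_def)
    have L2U: "L2 (U i)" for i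
      using seq(1,2) order_trans[OF le abs_ge_self] by (intro L2_bound'[OF L2, where c = 1]) auto
    have "(\<lambda>i. sqn (\<lambda>x. f x - U i x)) \<longlonglongrightarrow> (LINT x|(lborel :: (real ^ 'n) measure). 0)"
      unfolding sqn_def
    proof (rule integral_dominated_convergence[OF _ _ L2_integrable[OF L2]])
      show "AE x in lborel. (\<lambda>i. (norm (f x - U i x))\<^sup>2) \<longlonglongrightarrow> 0"
      proof (intro AE_I2)
        fix x
        have "(\<lambda>i. (norm (f x - U i x))\<^sup>2) \<longlonglongrightarrow> (norm (f x - f x))\<^sup>2"
          using seq(5)[of x] by (intro tendsto_intros) auto
        then show "(\<lambda>i. (norm (f x - U i x))\<^sup>2) \<longlonglongrightarrow> 0" by simp
      qed
      show "AE x in lborel. norm ((norm (f x - U i x))\<^sup>2) \<le> (norm (f x))\<^sup>2" for i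
        using le seq(2) by (auto intro!: power_mono AE_I2)
    qed (use seq(1) L2 in measurable)
    then have lim: "(\<lambda>i. sqn (\<lambda>x. f x - U i x)) \<longlonglongrightarrow> 0" by simp
    show "translation_continuous f"
    proof (rule translation_continuous_closed[OF L2])
      fix e :: real assume "e > 0"
      then have "\<forall>\<^sub>F i in sequentially. sqn (\<lambda>x. f x - U i x) < e"
        using lim by (rule order_tendstoD(2)[rotated])
      then obtain i where "sqn (\<lambda>x. f x - U i x) < e"
        by (auto simp: eventually_sequentially)
      then show "\<exists>g. L2 g \<and> translation_continuous g \<and> sqn (\<lambda>x. f x - g x) < e"
        using L2U seq(3) by blast
    qed
  qed
qed

lemma translation_continuous_real:
  fixes f :: "real ^ 'n \<Rightarrow> real"
  assumes "L2 f"
  shows "translation_continuous f"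
proof -
  have [measurable]: "f \<in> borel_measurable borel" using assms by simp
  have L: "L2 (\<lambda>x. max 0 (f x))" "L2 (\<lambda>x. max 0 (- f x))"
    by (auto intro!: L2_bound'[OF assms, where c = 1])
  then have "translation_continuous (\<lambda>x. max 0 (f x))" "translation_continuous (\<lambda>x. max 0 (- f x))"
    using translation_continuous_nonneg[of "\<lambda>x. max 0 (f x)"] translation_continuous_nonneg[of "\<lambda>x. max 0 (- f x)"]
    by auto
  then have "translation_continuous (\<lambda>x. max 0 (f x) + (- 1) *\<^sub>R max 0 (- f x))"
    using L by (intro translation_continuous_add translation_continuous_scaleR L2_scaleR)
  also have "(\<lambda>x. max 0 (f x) + (- 1) *\<^sub>R max 0 (- f x)) = f"
    by (auto simp: max_def)
  finally show ?thesis .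
qed

lemma L2_translation_tendsto:
  assumes "L2 f" "v \<longlonglongrightarrow> 0"
  shows "(\<lambda>k. sqn (\<lambda>x. f (x + v k) - f x)) \<longlonglongrightarrow> 0"
proof -
  have "(\<lambda>k. \<Sum>b\<in>Basis. sqn (\<lambda>x. f (x + v k) \<bullet> b - f x \<bullet> b)) \<longlonglongrightarrow> (\<Sum>b\<in>(Basis::'b set). 0)"
    using translation_continuous_real[OF L2_inner[OF assms(1)]] assms(2)
    by (intro tendsto_sum) (auto simp: translation_continuous_def)
  then show ?thesis
    using sqn_components[OF L2_diff[OF L2_translate[OF assms(1)] assms(1)]] by (simp add: inner_diff_left)
qed

section \<open>Weak derivatives as limits of difference quotients\<close>

text \<open>The square bound is nonnegativity of the variance of \<open>h\<close> on the unit
  interval; integrability comes from |h| \<le> 1 + h^2.\<close>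

lemma Jensen_unit_interval:
  fixes h :: "real \<Rightarrow> real"
  assumes [measurable]: "h \<in> borel_measurable borel"
    and int: "integrable lborel (\<lambda>t. indicator {0..1} t * (h t)\<^sup>2)"
  shows "integrable lborel (\<lambda>t. indicator {0..1} t * h t)"
    and "(LINT t|lborel. indicator {0..1} t * h t)\<^sup>2 \<le> (LINT t|lborel. indicator {0..1} t * (h t)\<^sup>2)"
proof -
  have ind: "integrable lborel (indicator {0..1} :: real \<Rightarrow> real)" by simp
  show i: "integrable lborel (\<lambda>t. indicator {0..1} t * h t)"
  proof (rule Bochner_Integration.integrable_bound[OF Bochner_Integration.integrable_add[OF ind int]])
    have "\<bar>h t\<bar> \<le> 1 + (h t)\<^sup>2" for t
      using sum_squares_bound[of "\<bar>h t\<bar>" 1] abs_ge_zero[of "h t"] by simp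
    then show "AE t in lborel. norm (indicator {0..1} t * h t) \<le> norm (indicator {0..1} t + indicator {0..1} t * (h t)\<^sup>2)"
      by (auto simp: indicator_def)
  qed simp
  define m where "m = (LINT t|lborel. indicator {0..1} t * h t)"
  have "0 \<le> (LINT t|lborel. indicator {0..1} t * (h t - m)\<^sup>2)"
    by (rule integral_nonneg_AE) simp
  also have "\<dots> = (LINT t|lborel. indicator {0..1} t * (h t)\<^sup>2 - 2 * m * (indicator {0..1} t * h t) + m\<^sup>2 * indicator {0..1} t)"
    by (rule Bochner_Integration.integral_cong) (auto simp: power2_diff algebra_simps)
  also have "\<dots> = (LINT t|lborel. indicator {0..1} t * (h t)\<^sup>2) - 2 * m * m + m\<^sup>2"
    using i int by (simp add: m_def)
  finally show "(LINT t|lborel. indicator {0..1} t * h t)\<^sup>2 \<le> (LINT t|lborel. indicator {0..1} t * (h t)\<^sup>2)"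
    by (simp add: m_def power2_eq_square)
qed

text \<open>Jensen for almost every fixed x, then exchange of the integrals. The bound B, uniform in
  t, is what makes the square jointly integrable over the strip.\<close>

lemma average_L2:
  fixes F :: "real \<Rightarrow> real ^ 'n \<Rightarrow> real"
  assumes F[measurable]: "case_prod F \<in> borel_measurable (lborel \<Otimes>\<^sub>M lborel)"
    and L2: "\<And>t. L2 (F t)" and B: "\<And>t. sqn (F t) \<le> B"
  defines "\<rho> \<equiv> \<lambda>x. LINT t|lborel. indicator {0..1} t * F t x"
  shows "L2 \<rho>" "sqn \<rho> \<le> (LINT t|lborel. indicator {0..1} t * sqn (F t))"
    "AE x in lborel. integrable lborel (\<lambda>t. indicator {0..1} t * F t x)"
    "integrable (lborel \<Otimes>\<^sub>M lborel) (\<lambda>(t, x). indicator {0..1} t * (F t x)\<^sup>2)"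
proof -
  have [measurable]: "(\<lambda>t. sqn (F t)) \<in> borel_measurable borel"
    unfolding sqn_def by measurable
  have B0: "0 \<le> B" using B[of 0] sqn_nonneg[of "F 0"] by linarith
  show int: "integrable (lborel \<Otimes>\<^sub>M lborel) (\<lambda>(t, x). indicator {0..1} t * (F t x)\<^sup>2)"
  proof (rule lborel_pair.Fubini_integrable)
    have eq: "(LINT x|lborel. norm (case (t, x) of (t, x) \<Rightarrow> indicator {0..1} t * (F t x)\<^sup>2)) = indicator {0..1} t * sqn (F t)" for t
      by (simp add: sqn_def abs_mult)
    have "integrable lborel (\<lambda>t. B * indicator {0..1::real} t)" by simp
    then show "integrable lborel (\<lambda>t. LINT x|lborel. norm (case (t, x) of (t, x) \<Rightarrow> indicator {0..1} t * (F t x)\<^sup>2))"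
      unfolding eq
      by (rule Bochner_Integration.integrable_bound) (use B B0 in \<open>auto simp: indicator_def sqn_nonneg\<close>)
    show "AE t in lborel. integrable lborel (\<lambda>x. case (t, x) of (t, x) \<Rightarrow> indicator {0..1} t * (F t x)\<^sup>2)"
      using L2_integrable[OF L2] by simp
  qed measurable
  have int_x: "AE x in lborel. integrable lborel (\<lambda>t. indicator {0..1} t * (F t x)\<^sup>2)"
    by (rule lborel_pair.AE_integrable_snd[OF int])
  have meas_t: "(\<lambda>t. F t x) \<in> borel_measurable borel" for x
    using measurable_compose[OF measurable_Pair2'[of x lborel lborel] F] by simp
  show "AE x in lborel. integrable lborel (\<lambda>t. indicator {0..1} t * F t x)"
    using int_x by eventually_elim (rule Jensen_unit_interval(1)[OF meas_t])
  have le: "AE x in lborel. (\<rho> x)\<^sup>2 \<le> (LINT t|lborel. indicator {0..1} t * (F t x)\<^sup>2)"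
    using int_x unfolding \<rho>_def by eventually_elim (rule Jensen_unit_interval(2)[OF meas_t])
  have \<rho>_meas[measurable]: "\<rho> \<in> borel_measurable lborel"
    unfolding \<rho>_def by measurable
  have int_avg: "integrable lborel (\<lambda>x. LINT t|lborel. indicator {0..1} t * (F t x)\<^sup>2)"
    by (rule lborel_pair.integrable_snd[OF int])
  have int_\<rho>: "integrable lborel (\<lambda>x. (\<rho> x)\<^sup>2)"
    by (rule Bochner_Integration.integrable_bound[OF int_avg]) (use le in \<open>auto elim!: eventually_mono\<close>)
  then show "L2 \<rho>"
    by (simp add: L2_def)
  have "sqn \<rho> \<le> (LINT x|lborel. LINT t|lborel. indicator {0..1} t * (F t x)\<^sup>2)"
    unfolding sqn_def using le int_\<rho> int_avg by (intro integral_mono_AE) auto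
  also have "\<dots> = (LINT t|lborel. LINT x|lborel. indicator {0..1} t * (F t x)\<^sup>2)"
    by (rule lborel_pair.Fubini_integral[OF int])
  also have "\<dots> = (LINT t|lborel. indicator {0..1} t * sqn (F t))"
    by (simp add: sqn_def)
  finally show "sqn \<rho> \<le> (LINT t|lborel. indicator {0..1} t * sqn (F t))" .
qed

text \<open>Supplies the joint integrability for exchanging a segment average with a pairing; |a b|
  \<le> a^2 + b^2 reduces it to \<open>average_L2\<close> for each factor.\<close>

lemma integrable_segment_product:
  fixes f g :: "real ^ 'n \<Rightarrow> real"
  assumes f: "L2 f" and g: "L2 g"
  shows "integrable (lborel \<Otimes>\<^sub>M lborel) (\<lambda>(t, x). indicator {0..1} t * (f (x + t *\<^sub>R v) * g x))"
proof -
  have [measurable]: "f \<in> borel_measurable borel" "g \<in> borel_measurable borel" using f g by simp_all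
  have 1: "integrable (lborel \<Otimes>\<^sub>M lborel) (\<lambda>(t, x). indicator {0..1} t * (f (x + t *\<^sub>R v))\<^sup>2)"
    using L2_translate[OF f] sqn_translate[OF f]
    by (intro average_L2(4)[where F = "\<lambda>t x. f (x + t *\<^sub>R v)" and B = "sqn f"]) auto
  have 2: "integrable (lborel \<Otimes>\<^sub>M lborel) (\<lambda>(t :: real, x). indicator {0..1} t * (g x)\<^sup>2)"
    by (rule average_L2(4)[where F = "\<lambda>t x. g x" and B = "sqn g"]) (auto simp: g)
  have *: "\<bar>a * b\<bar> \<le> a\<^sup>2 + b\<^sup>2" for a b :: real
    using sum_squares_bound[of "\<bar>a\<bar>" "\<bar>b\<bar>"] abs_ge_zero[of "a * b"]
    unfolding abs_mult power2_abs by linarith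
  show ?thesis
    by (rule Bochner_Integration.integrable_bound[OF Bochner_Integration.integrable_add[OF 1 2]])
       (auto simp: indicator_def intro!: AE_I2 *)
qed

section \<open>Weak directional derivatives and increments along segments\<close>

lemma L2_continuous_compact_support:
  fixes f :: "real ^ 'n \<Rightarrow> real"
  assumes "continuous_on UNIV f" "compact K" "\<And>x. x \<notin> K \<Longrightarrow> f x = 0"
  shows "L2 f"
proof -
  have "integrable lborel (\<lambda>x. indicator K x *\<^sub>R (norm (f x))\<^sup>2)"
    by (intro borel_integrable_compact assms(2) continuous_intros continuous_on_subset[OF assms(1)] subset_UNIV)
  also have "(\<lambda>x. indicator K x *\<^sub>R (norm (f x))\<^sup>2) = (\<lambda>x. (norm (f x))\<^sup>2)"
    using assms(3) by (auto simp: indicator_def fun_eq_iff)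
  finally show ?thesis
    by (simp add: L2_def borel_measurable_continuous_onI[OF assms(1)])
qed

lemma test_function_L2:
  assumes "test_function \<eta>"
  shows "L2 \<eta>" "L2 (\<lambda>x. frechet_derivative \<eta> (at x) v)"
proof -
  have K: "compact (closure {x. \<eta> x \<noteq> 0})" using assms unfolding test_function_def by blast
  show "L2 \<eta>" "L2 (\<lambda>x. frechet_derivative \<eta> (at x) v)"
    by (rule L2_continuous_compact_support[OF _ K]; fact test_function_continuous[OF assms] test_function_outside[OF assms])+
qed

text \<open>Scalar valued because the fundamental lemma is, and with a free direction so that
  scaling \<open>v\<close> yields shorter increments.\<close>

definition weak_dir :: "real ^ 'n \<Rightarrow> (real ^ 'n \<Rightarrow> real) \<Rightarrow> (real ^ 'n \<Rightarrow> real) \<Rightarrow> bool" where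
  "weak_dir v u d \<longleftrightarrow> L2 u \<and> L2 d \<and> (\<forall>\<eta>. test_function \<eta> \<longrightarrow>
     (LINT x|lborel. frechet_derivative \<eta> (at x) v * u x) = - (LINT x|lborel. \<eta> x * d x))"

lemma weak_dir_scaleR:
  assumes "weak_dir v u d"
  shows "weak_dir (c *\<^sub>R v) u (\<lambda>x. c * d x)"
proof -
  have "frechet_derivative \<eta> (at x) (c *\<^sub>R v) = c * frechet_derivative \<eta> (at x) v" if "test_function \<eta>" for \<eta> x
    using linear_scale[OF has_derivative_linear[OF test_function_has_derivative[OF that]]] by simp
  moreover have "L2 (\<lambda>x. c * d x)"
    using L2_scaleR[of d c] assms by (simp add: weak_dir_def)
  moreover have "(LINT x|lborel. \<eta> x * (c * d x)) = c * (LINT x|lborel. \<eta> x * d x)" for \<eta>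
    by (simp add: mult.left_commute[of _ c])
  ultimately show ?thesis
    using assms by (simp add: weak_dir_def mult.assoc)
qed

lemma bump_segment:
  fixes v :: "'a::euclidean_space"
  shows "(LINT t|lborel. indicator {0..1} t * frechet_derivative (bump a b k) (at (x - t *\<^sub>R v)) v)
    = bump a b k x - bump a b k (x - v)"
proof -
  let ?\<eta> = "bump a b k"
  have "((\<lambda>t. ?\<eta> (x - t *\<^sub>R v)) has_vector_derivative - frechet_derivative ?\<eta> (at (x - t *\<^sub>R v)) v) (at t within {0..1})" for t
  proof -
    let ?D = "frechet_derivative ?\<eta> (at (x - t *\<^sub>R v))"
    have lin: "linear ?D"
      using has_derivative_linear[OF test_function_has_derivative[OF test_function_bump]] .
    have "((\<lambda>t. ?\<eta> (x - t *\<^sub>R v)) has_derivative (\<lambda>s. ?D (- (s *\<^sub>R v)))) (at t within {0..1})"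
      by (rule has_derivative_compose[OF _ test_function_has_derivative[OF test_function_bump]])
         (auto intro!: derivative_eq_intros)
    also have "(\<lambda>s. ?D (- (s *\<^sub>R v))) = (\<lambda>s. s *\<^sub>R (- ?D v))"
      by (simp add: linear_neg[OF lin] linear_scale[OF lin])
    finally show ?thesis by (simp add: has_vector_derivative_def)
  qed
  moreover have "continuous_on {0..1} (\<lambda>t. - frechet_derivative ?\<eta> (at (x - t *\<^sub>R v)) v)"
    by (intro continuous_intros continuous_on_compose2[OF test_function_continuous(2)[OF test_function_bump]]) auto
  ultimately have "(LINT t|lborel. indicator {0..1} t *\<^sub>R - frechet_derivative ?\<eta> (at (x - t *\<^sub>R v)) v)
      = ?\<eta> (x - 1 *\<^sub>R v) - ?\<eta> (x - 0 *\<^sub>R v)"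
    by (intro integral_FTC_atLeastAtMost) auto
  then show ?thesis by simp
qed

lemma frechet_derivative_bump_translate:
  "frechet_derivative (bump (a + c) (b + c) k) (at x) v = frechet_derivative (bump a b k) (at (x - c)) v"
proof -
  have "((\<lambda>x. bump a b k (x - c)) has_derivative frechet_derivative (bump a b k) (at (x - c))) (at x)"
    by (rule has_derivative_compose[OF _ test_function_has_derivative[OF test_function_bump]])
       (auto intro!: derivative_eq_intros)
  then show ?thesis
    unfolding bump_translate by (metis frechet_derivative_at)
qed

text \<open>Both sides are tested against a bump. Translation moves the shift t v onto the bump,
  which stays a bump, so the weak derivative can be shifted onto it as well. The segment integral of
  its derivative is a difference of bumps by \<open>bump_segment\<close>, and translating back turns
  this into the increment of \<open>u\<close>.\<close>

lemma weak_dir_increment_AE: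
  assumes "weak_dir v u d"
  shows "AE x in lborel. u (x + v) - u x = (LINT t|lborel. indicator {0..1} t * d (x + t *\<^sub>R v))"
proof -
  have u: "L2 u" and d: "L2 d" using assms by (auto simp: weak_dir_def)
  have [measurable]: "u \<in> borel_measurable borel" "d \<in> borel_measurable borel" using u d by simp_all
  define \<rho> where "\<rho> x = (LINT t|lborel. indicator {0..1} t * d (x + t *\<^sub>R v))" for x
  have \<rho>: "L2 \<rho>"
    unfolding \<rho>_def[abs_def] using L2_translate[OF d] sqn_translate[OF d]
    by (intro average_L2(1)[where B = "sqn d"]) auto
  define w where "w x = u (x + v) - u x - \<rho> x" for x
  have w: "L2 w" unfolding w_def[abs_def] by (intro L2_diff L2_translate u \<rho>)
  have "AE x in lborel. w x = 0"
  proof (rule fundamental_lemma_bump)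
    show "w \<in> borel_measurable lborel" using w by simp
    fix a b :: "real ^ 'a"
    have "L2 (indicator (box a b) :: _ \<Rightarrow> real)"
      by (rule L2_bound[OF integrable_real_indicator[OF _ emeasure_lborel_box_finite]]) (auto simp: indicator_def)
    from L2_bilinear_integrable[OF bounded_bilinear_mult this w]
    show "integrable lborel (\<lambda>x. indicator (box a b) x * w x)" .
    fix k
    let ?\<eta> = "bump a b k"
    let ?D = "\<lambda>x. frechet_derivative ?\<eta> (at x) v"
    note T = test_function_bump[of a b k]
    have \<eta>: "L2 ?\<eta>" and D: "L2 ?D" using test_function_L2[OF T] by auto
    have [measurable]: "?\<eta> \<in> borel_measurable borel" "?D \<in> borel_measurable borel" using \<eta> D by simp_all
    note I = L2_bilinear_integrable[OF bounded_bilinear_mult]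
    have weak: "(LINT x|lborel. d (x + t *\<^sub>R v) * ?\<eta> x) = - (LINT x|lborel. ?D (x + t *\<^sub>R (- v)) * u x)" for t
    proof -
      have "(LINT x|lborel. d (x + t *\<^sub>R v) * ?\<eta> x) = (LINT x|lborel. ?\<eta> (x - t *\<^sub>R v) * d x)"
        using integral_translate[of "\<lambda>x. ?\<eta> (x - t *\<^sub>R v) * d x" "t *\<^sub>R v"] by (simp add: mult.commute)
      also have "\<dots> = - (LINT x|lborel. frechet_derivative (bump (a + t *\<^sub>R v) (b + t *\<^sub>R v) k) (at x) v * u x)"
        using assms test_function_bump[of "a + t *\<^sub>R v" "b + t *\<^sub>R v" k] unfolding weak_dir_def bump_translate by simp
      finally show ?thesis by (simp add: frechet_derivative_bump_translate)
    qed
    have "(LINT x|lborel. ?\<eta> x * \<rho> x) = (LINT x|lborel. LINT t|lborel. indicator {0..1} t * (d (x + t *\<^sub>R v) * ?\<eta> x))"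
      by (simp add: \<rho>_def mult.assoc[symmetric]) (simp add: mult.commute)
    also have "\<dots> = (LINT t|lborel. LINT x|lborel. indicator {0..1} t * (d (x + t *\<^sub>R v) * ?\<eta> x))"
      by (rule lborel_pair.Fubini_integral[OF integrable_segment_product[OF d \<eta>]])
    also have "\<dots> = - (LINT t|lborel. LINT x|lborel. indicator {0..1} t * (?D (x + t *\<^sub>R (- v)) * u x))"
      by (simp add: weak)
    also have "\<dots> = - (LINT x|lborel. LINT t|lborel. indicator {0..1} t * (?D (x + t *\<^sub>R (- v)) * u x))"
      by (subst lborel_pair.Fubini_integral[OF integrable_segment_product[OF D u]]) (rule refl)
    also have "\<dots> = - (LINT x|lborel. (LINT t|lborel. indicator {0..1} t * ?D (x - t *\<^sub>R v)) * u x)"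
      by (simp add: mult.assoc[symmetric])
    also have "\<dots> = - (LINT x|lborel. ?\<eta> x * u x - ?\<eta> (x - v) * u x)"
      by (simp add: bump_segment left_diff_distrib)
    also have "\<dots> = (LINT x|lborel. ?\<eta> (x - v) * u x) - (LINT x|lborel. ?\<eta> x * u x)"
      using I[OF \<eta> u] I[OF L2_translate[OF \<eta>, of "- v"] u] by simp
    also have "(LINT x|lborel. ?\<eta> (x - v) * u x) = (LINT x|lborel. ?\<eta> x * u (x + v))"
      using integral_translate[of "\<lambda>x. ?\<eta> (x - v) * u x" v] by simp
    finally show "(LINT x|lborel. ?\<eta> x * w x) = 0"
      using I[OF \<eta> u] I[OF \<eta> L2_translate[OF u, of v]] I[OF \<eta> \<rho>]
      by (simp add: w_def right_diff_distrib)
  qed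
  then show ?thesis by (simp add: w_def \<rho>_def)
qed

text \<open>\<open>d x\<close> is its own average over the unit interval, so the error is an average
  of d(x + t v) - d x, to which Jensen applies.\<close>

lemma weak_dir_increment_sqn:
  assumes "weak_dir v u d"
  shows "sqn (\<lambda>x. u (x + v) - u x - d x) \<le> (LINT t|lborel. indicator {0..1} t * sqn (\<lambda>x. d (x + t *\<^sub>R v) - d x))"
proof -
  have u: "L2 u" and d: "L2 d" using assms by (auto simp: weak_dir_def)
  have [measurable]: "u \<in> borel_measurable borel" "d \<in> borel_measurable borel" using u d by simp_all
  define \<rho> where "\<rho> x = (LINT t|lborel. indicator {0..1} t * (d (x + t *\<^sub>R v) - d x))" for x
  have B: "sqn (\<lambda>x. d (x + t *\<^sub>R v) - d x) \<le> 4 * sqn d" for t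
    using sqn_add[OF L2_translate[OF d] L2_scaleR[OF d, of "-1"], of "t *\<^sub>R v"]
    by (simp add: sqn_scaleR[of "-1", simplified] sqn_translate[OF d])
  have \<rho>: "L2 \<rho>" "sqn \<rho> \<le> (LINT t|lborel. indicator {0..1} t * sqn (\<lambda>x. d (x + t *\<^sub>R v) - d x))"
    unfolding \<rho>_def[abs_def] using L2_diff[OF L2_translate[OF d] d] B
    by (intro average_L2(1,2)[where B = "4 * sqn d"]; simp)+
  have "AE x in lborel. integrable lborel (\<lambda>t. indicator {0..1} t * d (x + t *\<^sub>R v))"
    using L2_translate[OF d] sqn_translate[OF d] by (intro average_L2(3)[where B = "sqn d"]) auto
  with weak_dir_increment_AE[OF assms]
  have "AE x in lborel. u (x + v) - u x - d x = \<rho> x"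
  proof eventually_elim
    case (elim x)
    have "\<rho> x = (LINT t|lborel. indicator {0..1} t * d (x + t *\<^sub>R v) - d x * indicator {0..1} t)"
      unfolding \<rho>_def by (rule Bochner_Integration.integral_cong) (auto simp: algebra_simps)
    also have "\<dots> = (LINT t|lborel. indicator {0..1} t * d (x + t *\<^sub>R v)) - d x"
      using elim(2) by simp
    finally show ?case using elim(1) by simp
  qed
  then have "sqn (\<lambda>x. u (x + v) - u x - d x) = sqn \<rho>"
    using \<rho>(1) by (intro sqn_cong_AE) auto
  then show ?thesis using \<rho>(2) by simp
qed

text \<open>The steps have length exactly 1/(k+1), so that k + 1 of them recompose \<open>v\<close>;
  \<open>L1_dir_translation_bound\<close> depends on this.\<close>

definition diff_quot :: "real ^ 'n \<Rightarrow> (real ^ 'n \<Rightarrow> 'b::euclidean_space) \<Rightarrow> nat \<Rightarrow> real ^ 'n \<Rightarrow> 'b" where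
  "diff_quot v u k x = real (Suc k) *\<^sub>R (u (x + (1 / real (Suc k)) *\<^sub>R v) - u x)"

lemma LIMSEQ_step: "(\<lambda>k. (1 / real (Suc k)) *\<^sub>R v) \<longlonglongrightarrow> (0 :: 'a::real_normed_vector)"
  using tendsto_scaleR[OF LIMSEQ_inverse_real_of_nat tendsto_const, of v]
  by (simp add: inverse_eq_divide)

text \<open>The increment bound is applied to the short vector c v. Its weak derivative is c d, so
  the factor c^2 cancels the square of the quotient's 1/c and an average of translation errors of
  \<open>d\<close> remains. These tend to 0 for each t and are dominated by 4
  \<open>sqn d\<close>.\<close>

lemma weak_dir_diff_quot_tendsto:
  assumes "weak_dir v u d"
  shows "(\<lambda>k. sqn (\<lambda>x. diff_quot v u k x - d x)) \<longlonglongrightarrow> 0"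
proof -
  have u: "L2 u" and d: "L2 d" using assms by (auto simp: weak_dir_def)
  have [measurable]: "u \<in> borel_measurable borel" "d \<in> borel_measurable borel" using u d by simp_all
  define q where "q k t = sqn (\<lambda>x. d (x + t *\<^sub>R (1 / real (Suc k)) *\<^sub>R v) - d x)" for k and t :: real
  have B: "q k t \<le> 4 * sqn d" for k t
    using sqn_add[OF L2_translate[OF d] L2_scaleR[OF d, of "-1"], of "t *\<^sub>R (1 / real (Suc k)) *\<^sub>R v"]
    by (simp add: q_def sqn_scaleR[of "-1", simplified] sqn_translate[OF d])
  have le: "sqn (\<lambda>x. diff_quot v u k x - d x) \<le> (LINT t|lborel. indicator {0..1} t * q k t)" for k
  proof -
    define c where "c = 1 / real (Suc k)"
    have c: "c > 0" "real (Suc k) = inverse c" by (auto simp: c_def)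
    have "sqn (\<lambda>x. diff_quot v u k x - d x) = sqn (\<lambda>x. inverse c *\<^sub>R (u (x + c *\<^sub>R v) - u x - c * d x))"
      unfolding diff_quot_def c_def[symmetric] unfolding c(2) using c(1) by (simp add: right_diff_distrib mult.assoc[symmetric])
    also have "\<dots> = (inverse c)\<^sup>2 * sqn (\<lambda>x. u (x + c *\<^sub>R v) - u x - c * d x)"
      by (rule sqn_scaleR)
    also have "\<dots> \<le> (inverse c)\<^sup>2 * (LINT t|lborel. indicator {0..1} t * sqn (\<lambda>x. c * d (x + t *\<^sub>R c *\<^sub>R v) - c * d x))"
      by (intro mult_left_mono weak_dir_increment_sqn weak_dir_scaleR assms) simp
    also have "(\<lambda>t. sqn (\<lambda>x. c * d (x + t *\<^sub>R c *\<^sub>R v) - c * d x)) = (\<lambda>t. c\<^sup>2 * q k t)"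
      by (simp only: q_def c_def[symmetric] right_diff_distrib[symmetric] sqn_scaleR[where 'b = real, unfolded real_scaleR_def])
    also have "(inverse c)\<^sup>2 * (LINT t|lborel. indicator {0..1} t * (c\<^sup>2 * q k t)) = (LINT t|lborel. indicator {0..1} t * q k t)"
    proof -
      have "(LINT t|lborel. indicator {0..1} t * (c\<^sup>2 * q k t)) = c\<^sup>2 * (LINT t|lborel. indicator {0..1} t * q k t)"
        unfolding integral_mult_right_zero[symmetric]
        by (rule Bochner_Integration.integral_cong) (simp_all add: mult_ac)
      then show ?thesis using c(1) by (simp only:) (simp add: field_simps)
    qed
    finally show ?thesis .
  qed
  have "(\<lambda>k. LINT t|lborel. indicator {0..1} t * q k t) \<longlonglongrightarrow> (LINT t|(lborel :: real measure). 0)"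
  proof (rule integral_dominated_convergence)
    show "integrable lborel (\<lambda>t. 4 * sqn d * indicator {0..1::real} t)" by simp
    show "AE t in lborel. (\<lambda>k. indicator {0..1} t * q k t) \<longlonglongrightarrow> 0"
    proof (intro AE_I2 tendsto_mult_right_zero)
      fix t :: real
      have "(\<lambda>k. t *\<^sub>R (1 / real (Suc k)) *\<^sub>R v) \<longlonglongrightarrow> t *\<^sub>R 0"
        by (intro tendsto_intros LIMSEQ_step)
      then show "(\<lambda>k. q k t) \<longlonglongrightarrow> 0"
        unfolding q_def by (intro L2_translation_tendsto[OF d]) simp
    qed
    show "AE t in lborel. norm (indicator {0..1} t * q k t) \<le> 4 * sqn d * indicator {0..1} t" for k
      using B[of k] by (auto simp: indicator_def q_def sqn_nonneg intro!: AE_I2)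
  qed (auto simp: q_def sqn_def)
  then have lim: "(\<lambda>k. LINT t|lborel. indicator {0..1} t * q k t) \<longlonglongrightarrow> 0" by simp
  show ?thesis
    by (rule tendsto_sandwich[OF _ _ tendsto_const lim]) (auto simp: sqn_nonneg le)
qed

section \<open>Directional derivatives in the \<open>L\<^sup>1\<close> and \<open>L\<^sup>2\<close> sense\<close>

text \<open>From here on a derivative is a limit of difference quotients in norm. This form passes
  through products and compositions by direct estimates, without test functions.\<close>

definition L2_dir :: "real ^ 'n \<Rightarrow> (real ^ 'n \<Rightarrow> 'b::euclidean_space) \<Rightarrow> (real ^ 'n \<Rightarrow> 'b) \<Rightarrow> bool" where
  "L2_dir v f d \<longleftrightarrow> L2 f \<and> L2 d \<and> (\<lambda>k. sqn (\<lambda>x. diff_quot v f k x - d x)) \<longlonglongrightarrow> 0"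

definition L1_dir :: "real ^ 'n \<Rightarrow> (real ^ 'n \<Rightarrow> real) \<Rightarrow> (real ^ 'n \<Rightarrow> real) \<Rightarrow> bool" where
  "L1_dir v w d \<longleftrightarrow> integrable lborel w \<and> integrable lborel d \<and>
     (\<lambda>k. LINT x|lborel. \<bar>diff_quot v w k x - d x\<bar>) \<longlonglongrightarrow> 0"

lemma L2_diff_quot: "L2 f \<Longrightarrow> L2 (diff_quot v f k)"
  unfolding diff_quot_def[abs_def] by (intro L2_scaleR L2_diff L2_translate)

lemma integrable_diff_quot:
  fixes w :: "real ^ 'n \<Rightarrow> real"
  shows "integrable lborel w \<Longrightarrow> integrable lborel (diff_quot v w k)"
  unfolding diff_quot_def[abs_def] using integrable_translate[of w] by auto

lemma L2_dir_translate:
  assumes "L2_dir v f d"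
  shows "L2_dir v (\<lambda>x. f (x + c)) (\<lambda>x. d (x + c))"
proof -
  have f: "L2 f" and d: "L2 d" using assms by (auto simp: L2_dir_def)
  have "sqn (\<lambda>x. diff_quot v (\<lambda>x. f (x + c)) k x - d (x + c)) = sqn (\<lambda>x. diff_quot v f k x - d x)" for k
    using sqn_translate[OF L2_diff[OF L2_diff_quot[OF f] d], of v k c]
    by (simp add: diff_quot_def algebra_simps)
  then show ?thesis using assms L2_translate by (auto simp: L2_dir_def)
qed

text \<open>The discrete Leibniz rule leaves three errors: the quotient error of f against the
  translate of h, whose norm does not change (\<open>E1\<close>); the translation error of h against
  df (\<open>E2\<close>); and the quotient error of h against f (\<open>E3\<close>).\<close>

lemma L1_dir_product:
  fixes p :: "'b::euclidean_space \<Rightarrow> 'c::euclidean_space \<Rightarrow> real"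
  assumes p: "bounded_bilinear p" and "L2_dir v f df" "L2_dir v h dh"
  shows "L1_dir v (\<lambda>x. p (f x) (h x)) (\<lambda>x. p (df x) (h x) + p (f x) (dh x))"
proof -
  interpret bounded_bilinear p by fact
  have f: "L2 f" "L2 df" and h: "L2 h" "L2 dh"
    and lf: "(\<lambda>k. sqn (\<lambda>x. diff_quot v f k x - df x)) \<longlonglongrightarrow> 0"
    and lh: "(\<lambda>k. sqn (\<lambda>x. diff_quot v h k x - dh x)) \<longlonglongrightarrow> 0"
    using assms by (auto simp: L2_dir_def)
  obtain K where K: "\<And>a b. norm (p a b) \<le> norm a * norm b * K" "K \<ge> 0"
    using nonneg_bounded by auto
  define s where "s k = (1 / real (Suc k)) *\<^sub>R v" for k
  define E1 where "E1 k x = norm (diff_quot v f k x - df x) * norm (h (x + s k))" for k x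
  define E2 where "E2 k x = norm (h (x + s k) - h x) * norm (df x)" for k x
  define E3 where "E3 k x = norm (diff_quot v h k x - dh x) * norm (f x)" for k x
  have E_int: "integrable lborel (E1 k)" "integrable lborel (E2 k)" "integrable lborel (E3 k)" for k
    unfolding E1_def[abs_def] E2_def[abs_def] E3_def[abs_def]
    by (intro L2_mult_integrable L2_diff L2_diff_quot L2_translate f h)+
  have E1: "(\<lambda>k. LINT x|lborel. E1 k x) \<longlonglongrightarrow> 0"
    unfolding E1_def
    by (rule L2_product_tendsto_0[OF _ _ lf, where B = "sqn h"])
       (auto intro!: L2_diff L2_diff_quot L2_translate f h simp: sqn_translate[OF h(1)])
  have E2: "(\<lambda>k. LINT x|lborel. E2 k x) \<longlonglongrightarrow> 0"
    unfolding E2_def s_def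
    by (rule L2_product_tendsto_0[OF _ _ L2_translation_tendsto[OF h(1) LIMSEQ_step], where B = "sqn df"])
       (auto intro!: L2_diff L2_translate f h)
  have E3: "(\<lambda>k. LINT x|lborel. E3 k x) \<longlonglongrightarrow> 0"
    unfolding E3_def
    by (rule L2_product_tendsto_0[OF _ _ lh, where B = "sqn f"]) (auto intro!: L2_diff L2_diff_quot f h)
  let ?w = "\<lambda>x. p (f x) (h x)" and ?d = "\<lambda>x. p (df x) (h x) + p (f x) (dh x)"
  have w: "integrable lborel ?w" and d: "integrable lborel ?d"
    by (intro Bochner_Integration.integrable_add L2_bilinear_integrable[OF p] f h)+
  have pw: "\<bar>diff_quot v ?w k x - ?d x\<bar> \<le> K * (E1 k x + E2 k x + E3 k x)" for k x
  proof -
    have "diff_quot v ?w k x - ?d x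
      = p (diff_quot v f k x - df x) (h (x + s k)) + p (df x) (h (x + s k) - h x) + p (f x) (diff_quot v h k x - dh x)"
      unfolding diff_quot_def s_def
      by (simp only: diff_left diff_right scaleR_left scaleR_right) (simp add: algebra_simps)
    also have "\<bar>\<dots>\<bar> \<le> \<bar>p (diff_quot v f k x - df x) (h (x + s k))\<bar> + \<bar>p (df x) (h (x + s k) - h x)\<bar>
        + \<bar>p (f x) (diff_quot v h k x - dh x)\<bar>"
      by linarith
    also have "\<dots> \<le> norm (diff_quot v f k x - df x) * norm (h (x + s k)) * K
        + norm (df x) * norm (h (x + s k) - h x) * K + norm (f x) * norm (diff_quot v h k x - dh x) * K"
      using K(1) by (intro add_mono) (simp_all del: norm_conv_dist flip: real_norm_def)
    also have "\<dots> = K * (E1 k x + E2 k x + E3 k x)"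
      by (simp add: E1_def E2_def E3_def algebra_simps)
    finally show ?thesis .
  qed
  have "(\<lambda>k. LINT x|lborel. \<bar>diff_quot v ?w k x - ?d x\<bar>) \<longlonglongrightarrow> 0"
  proof (rule tendsto_sandwich[OF always_eventually always_eventually tendsto_const], safe)
    fix k
    show "0 \<le> (LINT x|lborel. \<bar>diff_quot v ?w k x - ?d x\<bar>)"
      by (rule integral_nonneg_AE) simp
    have "(LINT x|lborel. \<bar>diff_quot v ?w k x - ?d x\<bar>) \<le> (LINT x|lborel. K * (E1 k x + E2 k x + E3 k x))"
      by (intro integral_mono pw integrable_abs Bochner_Integration.integrable_diff integrable_diff_quot w d
          integrable_mult_right Bochner_Integration.integrable_add E_int)
    then show "(LINT x|lborel. \<bar>diff_quot v ?w k x - ?d x\<bar>) \<le> K * ((LINT x|lborel. E1 k x) + (LINT x|lborel. E2 k x) + (LINT x|lborel. E3 k x))"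
      using E_int[of k] by simp
  next
    have "(\<lambda>k. K * ((LINT x|lborel. E1 k x) + (LINT x|lborel. E2 k x) + (LINT x|lborel. E3 k x))) \<longlonglongrightarrow> K * (0 + 0 + 0)"
      by (intro tendsto_intros E1 E2 E3)
    then show "(\<lambda>k. K * ((LINT x|lborel. E1 k x) + (LINT x|lborel. E2 k x) + (LINT x|lborel. E3 k x))) \<longlonglongrightarrow> 0"
      by simp
  qed
  with w d show ?thesis by (simp add: L1_dir_def)
qed

text \<open>The shift by \<open>v\<close> is split into m equal steps. By translation invariance all
  of them contribute the same \<open>L\<^sup>1\<close> norm, and m times that norm is the norm of
  the difference quotient, which is close to that of \<open>d\<close>.\<close>

lemma L1_dir_translation_bound:
  assumes "L1_dir v w d"
  shows "(LINT x|lborel. \<bar>w (x + v) - w x\<bar>) \<le> (LINT x|lborel. \<bar>d x\<bar>)"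
proof -
  have w: "integrable lborel w" and d: "integrable lborel d"
    and lim: "(\<lambda>k. LINT x|lborel. \<bar>diff_quot v w k x - d x\<bar>) \<longlonglongrightarrow> 0"
    using assms by (auto simp: L1_dir_def)
  have [measurable]: "w \<in> borel_measurable borel" using w by auto
  have "(LINT x|lborel. \<bar>w (x + v) - w x\<bar>) \<le> (LINT x|lborel. \<bar>d x\<bar>) + (LINT x|lborel. \<bar>diff_quot v w k x - d x\<bar>)" for k
  proof -
    define m where "m = Suc k"
    define s where "s = (1 / real m) *\<^sub>R v"
    have it: "integrable lborel (\<lambda>x. w (x + c))" for c using integrable_translate[OF w] .
    have tel: "w (x + v) - w x = (\<Sum>i<m. w (x + real (Suc i) *\<^sub>R s) - w (x + real i *\<^sub>R s))" for x
    proof -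
      have "real m *\<^sub>R s = v" by (simp add: s_def m_def)
      with sum_lessThan_telescope[of "\<lambda>i. w (x + real i *\<^sub>R s)" m] show ?thesis by simp
    qed
    have "(LINT x|lborel. \<bar>w (x + v) - w x\<bar>) \<le> (LINT x|lborel. (\<Sum>i<m. \<bar>w (x + real (Suc i) *\<^sub>R s) - w (x + real i *\<^sub>R s)\<bar>))"
    proof (rule integral_mono)
      show "\<bar>w (x + v) - w x\<bar> \<le> (\<Sum>i<m. \<bar>w (x + real (Suc i) *\<^sub>R s) - w (x + real i *\<^sub>R s)\<bar>)" for x
        unfolding tel by (rule sum_abs)
    qed (intro Bochner_Integration.integrable_sum integrable_abs Bochner_Integration.integrable_diff it w)+
    also have "\<dots> = (\<Sum>i<m. LINT x|lborel. \<bar>w (x + real (Suc i) *\<^sub>R s) - w (x + real i *\<^sub>R s)\<bar>)"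
      by (intro Bochner_Integration.integral_sum integrable_abs Bochner_Integration.integrable_diff it)
    also have "\<dots> = (\<Sum>i<m. LINT x|lborel. \<bar>w (x + s) - w x\<bar>)"
    proof (rule sum.cong[OF refl])
      fix i
      show "(LINT x|lborel. \<bar>w (x + real (Suc i) *\<^sub>R s) - w (x + real i *\<^sub>R s)\<bar>) = (LINT x|lborel. \<bar>w (x + s) - w x\<bar>)"
        using integral_translate[of "\<lambda>x. \<bar>w (x + s) - w x\<bar>" "real i *\<^sub>R s"] by (simp add: algebra_simps)
    qed
    also have "\<dots> = (LINT x|lborel. \<bar>diff_quot v w k x\<bar>)"
      by (simp add: diff_quot_def s_def m_def abs_mult)
    also have "\<dots> \<le> (LINT x|lborel. \<bar>d x\<bar> + \<bar>diff_quot v w k x - d x\<bar>)"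
      by (intro integral_mono integrable_abs Bochner_Integration.integrable_add Bochner_Integration.integrable_diff integrable_diff_quot w d) auto
    also have "\<dots> = (LINT x|lborel. \<bar>d x\<bar>) + (LINT x|lborel. \<bar>diff_quot v w k x - d x\<bar>)"
      by (intro Bochner_Integration.integral_add integrable_abs Bochner_Integration.integrable_diff integrable_diff_quot w d)
    finally show ?thesis .
  qed
  moreover have "(\<lambda>k. (LINT x|lborel. \<bar>d x\<bar>) + (LINT x|lborel. \<bar>diff_quot v w k x - d x\<bar>)) \<longlonglongrightarrow> (LINT x|lborel. \<bar>d x\<bar>) + 0"
    by (intro tendsto_intros lim)
  ultimately show ?thesis
    using LIMSEQ_le_const by fastforce
qed

lemma L1_dir_integral_tendsto:
  assumes "L1_dir v w d" and [measurable]: "z \<in> borel_measurable borel" and Z: "\<And>x. \<bar>z x\<bar> \<le> Z"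
  shows "(\<lambda>k. LINT x|lborel. z x * diff_quot v w k x) \<longlonglongrightarrow> (LINT x|lborel. z x * d x)"
proof -
  have w: "integrable lborel w" and d: "integrable lborel d"
    and lim: "(\<lambda>k. LINT x|lborel. \<bar>diff_quot v w k x - d x\<bar>) \<longlonglongrightarrow> 0"
    using assms by (auto simp: L1_dir_def)
  have zi: "integrable lborel (\<lambda>x. z x * f x)" if "integrable lborel f" for f
    by (rule integrable_bounded_mult[OF that _ Z]) simp
  have "\<bar>(LINT x|lborel. z x * diff_quot v w k x) - (LINT x|lborel. z x * d x)\<bar> \<le> Z * (LINT x|lborel. \<bar>diff_quot v w k x - d x\<bar>)" for k
  proof -
    have i: "integrable lborel (\<lambda>x. diff_quot v w k x - d x)"
      by (intro Bochner_Integration.integrable_diff integrable_diff_quot w d)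
    have "(LINT x|lborel. z x * diff_quot v w k x) - (LINT x|lborel. z x * d x) = (LINT x|lborel. z x * (diff_quot v w k x - d x))"
      using zi[OF integrable_diff_quot[OF w]] zi[OF d] by (simp add: right_diff_distrib)
    also have "\<bar>\<dots>\<bar> \<le> (LINT x|lborel. Z * \<bar>diff_quot v w k x - d x\<bar>)"
      by (rule order_trans[OF integral_abs_bound], intro integral_mono integrable_abs zi integrable_mult_right i)
         (auto simp: abs_mult Z intro!: mult_right_mono)
    finally show ?thesis by simp
  qed
  then show ?thesis
    by (intro Lim_null_comparison[OF _ tendsto_mult_right_zero[OF lim, of Z], THEN LIM_zero_cancel]) auto
qed

lemma L1_dir_integral_zero:
  assumes "L1_dir v w d"
  shows "(LINT x|lborel. d x) = 0"
proof -
  have w: "integrable lborel w" using assms by (auto simp: L1_dir_def)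
  have "(LINT x|lborel. 1 * diff_quot v w k x) = 0" for k
    using w integrable_translate[OF w] integral_translate[of w] by (simp add: diff_quot_def)
  then show ?thesis
    using L1_dir_integral_tendsto[OF assms, of "\<lambda>_. 1" 1] by (simp add: LIMSEQ_const_iff)
qed

text \<open>Translation moves the difference quotient from \<open>w\<close> to the weight, as a
  backward quotient \<open>q\<close>. It is bounded by \<open>C\<close> through the mean value
  inequality and tends to the negative derivative of the weight, so dominated convergence against
  |w| concludes without compact support.\<close>

lemma L1_dir_integral_by_parts:
  assumes "L1_dir (axis j 1) w d"
    and \<zeta>: "\<And>t. (\<zeta> has_real_derivative \<zeta>' t) (at t)" and [measurable]: "\<zeta>' \<in> borel_measurable borel"
    and Z: "\<And>t. \<bar>\<zeta> t\<bar> \<le> Z" and C: "\<And>t. \<bar>\<zeta>' t\<bar> \<le> C"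
  shows "(LINT x|lborel. \<zeta> (x $ j) * d x) = - (LINT x|lborel. \<zeta>' (x $ j) * w x)"
proof -
  have w: "integrable lborel w" using assms by (auto simp: L1_dir_def)
  have [measurable]: "w \<in> borel_measurable borel" using w by auto
  have \<zeta>_meas[measurable]: "\<zeta> \<in> borel_measurable borel"
    using \<zeta> by (intro borel_measurable_continuous_onI DERIV_continuous_on) auto
  have lip: "\<bar>\<zeta> b - \<zeta> a\<bar> \<le> C * \<bar>b - a\<bar>" for a b
    using field_differentiable_bound[of UNIV \<zeta> \<zeta>' C b a] \<zeta> C by simp
  define q where "q k x = real (Suc k) * (\<zeta> (x $ j - 1 / real (Suc k)) - \<zeta> (x $ j))" for k and x :: "real ^ 'a"
  have q_bound: "\<bar>q k x\<bar> \<le> C" for k x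
    using mult_left_mono[OF lip[of "x $ j - 1 / real (Suc k)" "x $ j"], of "real (Suc k)"] by (simp add: q_def abs_mult)
  have q_lim: "(\<lambda>k. q k x) \<longlonglongrightarrow> - \<zeta>' (x $ j)" for x
  proof -
    have "((\<lambda>h. (\<zeta> (x $ j + h) - \<zeta> (x $ j)) / h) \<longlongrightarrow> \<zeta>' (x $ j)) (at 0)"
      using \<zeta>[of "x $ j"] by (simp add: DERIV_def)
    moreover have "filterlim (\<lambda>k. - 1 / real (Suc k)) (at 0) sequentially"
      using tendsto_minus[OF LIMSEQ_inverse_real_of_nat]
      by (auto simp: filterlim_at inverse_eq_divide)
    ultimately have "(\<lambda>k. (\<zeta> (x $ j + - 1 / real (Suc k)) - \<zeta> (x $ j)) / (- 1 / real (Suc k))) \<longlonglongrightarrow> \<zeta>' (x $ j)"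
      by (rule filterlim_compose)
    then have "(\<lambda>k. - ((\<zeta> (x $ j + - 1 / real (Suc k)) - \<zeta> (x $ j)) / (- 1 / real (Suc k)))) \<longlonglongrightarrow> - \<zeta>' (x $ j)"
      by (rule tendsto_minus)
    then show ?thesis by (simp add: q_def mult.commute)
  qed
  have z_int: "integrable lborel (\<lambda>x. \<zeta> (x $ j + c) * w x)" for c
    by (rule integrable_bounded_mult[OF w _ Z]) measurable
  have "(LINT x|lborel. \<zeta> (x $ j) * diff_quot (axis j 1) w k x) = (LINT x|lborel. q k x * w x)" for k
  proof -
    define c where "c = 1 / real (Suc k)"
    have "(LINT x|lborel. \<zeta> (x $ j) * w (x + c *\<^sub>R axis j 1)) = (LINT x|lborel. \<zeta> (x $ j - c) * w x)"
      using integral_translate[of "\<lambda>x. \<zeta> (x $ j - c) * w x" "c *\<^sub>R axis j 1"] by simp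
    moreover have "integrable lborel (\<lambda>x. \<zeta> (x $ j) * w (x + c *\<^sub>R axis j 1))"
      using integrable_translate[OF z_int[of "- c"], of "c *\<^sub>R axis j 1"] by simp
    ultimately have i: "(LINT x|lborel. \<zeta> (x $ j) * w (x + c *\<^sub>R axis j 1)) = (LINT x|lborel. \<zeta> (x $ j - c) * w x)"
      "integrable lborel (\<lambda>x. \<zeta> (x $ j) * w (x + c *\<^sub>R axis j 1))"
      "integrable lborel (\<lambda>x. \<zeta> (x $ j) * w x)" "integrable lborel (\<lambda>x. \<zeta> (x $ j - c) * w x)"
      using z_int[of 0] z_int[of "- c"] by simp_all
    have "(LINT x|lborel. \<zeta> (x $ j) * diff_quot (axis j 1) w k x)
        = (LINT x|lborel. real (Suc k) * (\<zeta> (x $ j) * w (x + c *\<^sub>R axis j 1) - \<zeta> (x $ j) * w x))"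
      unfolding diff_quot_def c_def by (rule Bochner_Integration.integral_cong) (simp_all add: algebra_simps)
    also have "\<dots> = (LINT x|lborel. real (Suc k) * (\<zeta> (x $ j - c) * w x - \<zeta> (x $ j) * w x))"
      unfolding integral_mult_right_zero by (simp only: Bochner_Integration.integral_diff i)
    also have "\<dots> = (LINT x|lborel. q k x * w x)"
      unfolding q_def c_def by (rule Bochner_Integration.integral_cong) (simp_all add: algebra_simps)
    finally show ?thesis .
  qed
  then have 1: "(\<lambda>k. LINT x|lborel. q k x * w x) \<longlonglongrightarrow> (LINT x|lborel. \<zeta> (x $ j) * d x)"
    using L1_dir_integral_tendsto[OF assms(1), of "\<lambda>x. \<zeta> (x $ j)" Z] Z by simp
  have "(\<lambda>k. LINT x|lborel. q k x * w x) \<longlonglongrightarrow> (LINT x|lborel. - \<zeta>' (x $ j) * w x)"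
  proof (rule integral_dominated_convergence)
    show "integrable lborel (\<lambda>x. C * \<bar>w x\<bar>)" using w by simp
    show "AE x in lborel. (\<lambda>k. q k x * w x) \<longlonglongrightarrow> - \<zeta>' (x $ j) * w x"
      by (intro AE_I2 tendsto_intros q_lim)
    show "AE x in lborel. norm (q k x * w x) \<le> C * \<bar>w x\<bar>" for k
      using q_bound by (auto simp: abs_mult intro!: AE_I2 mult_right_mono)
  qed (auto simp: q_def)
  from LIMSEQ_unique[OF 1 this] show ?thesis by simp
qed

section \<open>Chain rule for functions with bounded derivative\<close>

lemma LIMSEQ_subsubseq:
  fixes X :: "nat \<Rightarrow> real"
  assumes "\<And>r. strict_mono (r :: nat \<Rightarrow> nat) \<Longrightarrow> \<exists>s. strict_mono (s :: nat \<Rightarrow> nat) \<and> (\<lambda>i. X (r (s i))) \<longlonglongrightarrow> L"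
  shows "X \<longlonglongrightarrow> L"
proof (rule ccontr)
  assume "\<not> X \<longlonglongrightarrow> L"
  then obtain e where e: "e > 0" "\<exists>\<^sub>F n in sequentially. \<not> dist (X n) L < e"
    by (auto simp: tendsto_iff not_eventually)
  then have "infinite {n. \<not> dist (X n) L < e}"
    by (simp add: frequently_cofinite[symmetric] cofinite_eq_sequentially)
  then obtain r :: "nat \<Rightarrow> nat" where r: "strict_mono r" "\<And>n. r n \<in> {n. \<not> dist (X n) L < e}"
    using infinite_enumerate by blast
  obtain s :: "nat \<Rightarrow> nat" where "(\<lambda>i. X (r (s i))) \<longlonglongrightarrow> L"
    using assms[OF r(1)] by blast
  then have "\<forall>\<^sub>F i in sequentially. dist (X (r (s i))) L < e"
    using e(1) by (rule tendstoD)
  then show False using r(2) by simp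
qed

text \<open>\<open>Q a b\<close> is the difference quotient of \<Gamma>, filled in on the diagonal
  by \<gamma>, so that increments of \<Gamma> factor through increments of u even where these
  vanish. Differentiability makes \<open>Q a\<close> continuous at a, and the bound on \<gamma>
  gives |Q| \<le> C; the remainder \<open>R\<close> is therefore dominated by a multiple of
  |d|.\<close>

lemma L1_dir_chain:
  assumes "L1_dir v u d" and \<Gamma>: "\<And>t. (\<Gamma> has_real_derivative \<gamma> t) (at t)" and "\<Gamma> 0 = 0"
    and \<gamma>[measurable]: "\<gamma> \<in> borel_measurable borel" and C: "\<And>t. \<bar>\<gamma> t\<bar> \<le> C"
  shows "L1_dir v (\<lambda>x. \<Gamma> (u x)) (\<lambda>x. \<gamma> (u x) * d x)"
proof -
  have u: "integrable lborel u" and d: "integrable lborel d"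
    and lim: "(\<lambda>k. LINT x|lborel. \<bar>diff_quot v u k x - d x\<bar>) \<longlonglongrightarrow> 0"
    using assms by (auto simp: L1_dir_def)
  have [measurable]: "u \<in> borel_measurable borel" "d \<in> borel_measurable borel" using u d by auto
  have [measurable]: "\<Gamma> \<in> borel_measurable borel"
    using \<Gamma> by (intro borel_measurable_continuous_onI DERIV_continuous_on) auto
  have lip: "\<bar>\<Gamma> b - \<Gamma> a\<bar> \<le> C * \<bar>b - a\<bar>" for a b
    using field_differentiable_bound[of UNIV \<Gamma> \<gamma> C b a] \<Gamma> C by simp
  define Q where "Q a b = (if b = a then \<gamma> a else (\<Gamma> b - \<Gamma> a) / (b - a))" for a b
  have Q_eq: "\<Gamma> b - \<Gamma> a = Q a b * (b - a)" for a b by (simp add: Q_def)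
  have Q_bound: "\<bar>Q a b\<bar> \<le> C" for a b
    using lip[of b a] C[of a] by (auto simp: Q_def abs_divide divide_le_eq)
  have Q_cont: "isCont (Q a) a" for a
  proof -
    have "((\<lambda>b. (\<Gamma> b - \<Gamma> a) / (b - a)) \<longlongrightarrow> \<gamma> a) (at a)"
      using \<Gamma>[of a] by (simp add: has_field_derivative_iff)
    then have "(Q a \<longlongrightarrow> \<gamma> a) (at a)"
      by (rule Lim_transform_eventually) (auto simp: Q_def eventually_at_filter)
    then show ?thesis by (simp add: isCont_def Q_def)
  qed
  define s where "s k = (1 / real (Suc k)) *\<^sub>R v" for k
  define R where "R k x = \<bar>Q (u x) (u (x + s k)) - \<gamma> (u x)\<bar> * \<bar>d x\<bar>" for k x
  have R_meas[measurable]: "R k \<in> borel_measurable borel" for k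
    unfolding R_def[abs_def] Q_def by measurable
  have R_bound: "R k x \<le> 2 * C * \<bar>d x\<bar>" "0 \<le> R k x" for k x
    using Q_bound[of "u x" "u (x + s k)"] C[of "u x"] unfolding R_def by (auto intro!: mult_right_mono)
  have Cd: "integrable lborel (\<lambda>x. 2 * C * \<bar>d x\<bar>)" using d by simp
  have R_int: "integrable lborel (R k)" for k
    using R_bound(2) order_trans[OF R_bound(1) abs_ge_self]
    by (intro Bochner_Integration.integrable_bound[OF Cd]) auto
  \<comment> \<open>The derivative itself yields continuity of translation here: the increment is
    the step length times a difference quotient of bounded norm.\<close>
  have shift: "(\<lambda>k. LINT x|lborel. norm (u (x + s k) - u x)) \<longlonglongrightarrow> 0"
  proof (rule tendsto_sandwich[OF _ _ tendsto_const])
    show "\<forall>\<^sub>F k in sequentially. (LINT x|lborel. norm (u (x + s k) - u x))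
        \<le> inverse (real (Suc k)) * ((LINT x|lborel. \<bar>d x\<bar>) + (LINT x|lborel. \<bar>diff_quot v u k x - d x\<bar>))"
    proof (intro always_eventually allI)
      fix k
      have "(LINT x|lborel. norm (u (x + s k) - u x)) = (LINT x|lborel. inverse (real (Suc k)) * \<bar>diff_quot v u k x\<bar>)"
        by (rule Bochner_Integration.integral_cong) (auto simp: diff_quot_def s_def abs_mult)
      also have "\<dots> = inverse (real (Suc k)) * (LINT x|lborel. \<bar>diff_quot v u k x\<bar>)" by simp
      also have "(LINT x|lborel. \<bar>diff_quot v u k x\<bar>) \<le> (LINT x|lborel. \<bar>d x\<bar> + \<bar>diff_quot v u k x - d x\<bar>)"
        by (intro integral_mono integrable_abs Bochner_Integration.integrable_add Bochner_Integration.integrable_diff integrable_diff_quot u d) auto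
      also have "\<dots> = (LINT x|lborel. \<bar>d x\<bar>) + (LINT x|lborel. \<bar>diff_quot v u k x - d x\<bar>)"
        by (intro Bochner_Integration.integral_add integrable_abs Bochner_Integration.integrable_diff integrable_diff_quot u d)
      finally show "(LINT x|lborel. norm (u (x + s k) - u x))
        \<le> inverse (real (Suc k)) * ((LINT x|lborel. \<bar>d x\<bar>) + (LINT x|lborel. \<bar>diff_quot v u k x - d x\<bar>))"
        by (simp add: mult_left_mono)
    qed
    have "(\<lambda>k. inverse (real (Suc k)) * ((LINT x|lborel. \<bar>d x\<bar>) + (LINT x|lborel. \<bar>diff_quot v u k x - d x\<bar>)))
        \<longlonglongrightarrow> 0 * ((LINT x|lborel. \<bar>d x\<bar>) + 0)"
      by (intro tendsto_intros LIMSEQ_inverse_real_of_nat lim)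
    then show "(\<lambda>k. inverse (real (Suc k)) * ((LINT x|lborel. \<bar>d x\<bar>) + (LINT x|lborel. \<bar>diff_quot v u k x - d x\<bar>))) \<longlonglongrightarrow> 0"
      by simp
  qed auto
  \<comment> \<open>Convergence of translates in \<open>L\<^sup>1\<close> gives pointwise
    convergence only along subsequences, and these suffice because the limit 0 is always the
    same.\<close>
  have R_lim: "(\<lambda>k. LINT x|lborel. R k x) \<longlonglongrightarrow> 0"
  proof (rule LIMSEQ_subsubseq)
    fix r :: "nat \<Rightarrow> nat" assume r: "strict_mono r"
    have "(\<lambda>k. LINT x|lborel. norm (u (x + s (r k)) - u x)) \<longlonglongrightarrow> 0"
      using LIMSEQ_subseq_LIMSEQ[OF shift r] by (simp add: comp_def)
    moreover have "integrable lborel (\<lambda>x. u (x + s (r k)) - u x)" for k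
      by (intro Bochner_Integration.integrable_diff integrable_translate u)
    ultimately obtain t :: "nat \<Rightarrow> nat" where t: "strict_mono t"
      "AE x in lborel. (\<lambda>k. u (x + s (r (t k))) - u x) \<longlonglongrightarrow> 0"
      using tendsto_L1_AE_subseq[of lborel "\<lambda>k x. u (x + s (r k)) - u x"] by blast
    have "(\<lambda>k. LINT x|lborel. R (r (t k)) x) \<longlonglongrightarrow> (LINT x|(lborel :: (real ^ 'a) measure). 0)"
    proof (rule integral_dominated_convergence[OF _ _ Cd])
      show "AE x in lborel. (\<lambda>k. R (r (t k)) x) \<longlonglongrightarrow> 0"
        using t(2)
      proof eventually_elim
        case (elim x)
        then have "(\<lambda>k. u (x + s (r (t k)))) \<longlonglongrightarrow> u x" by (simp add: LIM_zero_iff)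
        then have "(\<lambda>k. Q (u x) (u (x + s (r (t k))))) \<longlonglongrightarrow> Q (u x) (u x)"
          by (rule isCont_tendsto_compose[OF Q_cont])
        then have "(\<lambda>k. \<bar>Q (u x) (u (x + s (r (t k)))) - \<gamma> (u x)\<bar> * \<bar>d x\<bar>) \<longlonglongrightarrow> \<bar>Q (u x) (u x) - \<gamma> (u x)\<bar> * \<bar>d x\<bar>"
          by (intro tendsto_intros)
        then show ?case by (simp add: R_def Q_def)
      qed
      show "AE x in lborel. norm (R (r (t k)) x) \<le> 2 * C * \<bar>d x\<bar>" for k
        using R_bound by (auto intro!: AE_I2)
    qed auto
    then show "\<exists>t. strict_mono (t :: nat \<Rightarrow> nat) \<and> (\<lambda>i. LINT x|lborel. R (r (t i)) x) \<longlonglongrightarrow> 0"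
      using t(1) by auto
  qed
  have Cu: "integrable lborel (\<lambda>x. C * u x)" "integrable lborel (\<lambda>x. C * d x)" using u d by simp_all
  have w_int: "integrable lborel (\<lambda>x. \<Gamma> (u x))"
    using lip[of _ 0] \<open>\<Gamma> 0 = 0\<close> C[of 0]
    by (intro Bochner_Integration.integrable_bound[OF Cu(1)]) (auto simp: abs_mult)
  have dw_int: "integrable lborel (\<lambda>x. \<gamma> (u x) * d x)"
    using C by (intro Bochner_Integration.integrable_bound[OF Cu(2)])
      (auto simp: abs_mult intro!: mult_right_mono order_trans[OF C abs_ge_self])
  have pw: "\<bar>diff_quot v (\<lambda>x. \<Gamma> (u x)) k x - \<gamma> (u x) * d x\<bar> \<le> C * \<bar>diff_quot v u k x - d x\<bar> + R k x" for k x
  proof -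
    have "diff_quot v (\<lambda>x. \<Gamma> (u x)) k x - \<gamma> (u x) * d x
        = Q (u x) (u (x + s k)) * (diff_quot v u k x - d x) + (Q (u x) (u (x + s k)) - \<gamma> (u x)) * d x"
      unfolding diff_quot_def s_def Q_eq by (simp add: algebra_simps)
    also have "\<bar>\<dots>\<bar> \<le> \<bar>Q (u x) (u (x + s k)) * (diff_quot v u k x - d x)\<bar> + \<bar>(Q (u x) (u (x + s k)) - \<gamma> (u x)) * d x\<bar>"
      by (rule abs_triangle_ineq)
    also have "\<dots> \<le> C * \<bar>diff_quot v u k x - d x\<bar> + R k x"
      unfolding abs_mult R_def by (intro add_mono mult_right_mono Q_bound) auto
    finally show ?thesis .
  qed
  have "(\<lambda>k. LINT x|lborel. \<bar>diff_quot v (\<lambda>x. \<Gamma> (u x)) k x - \<gamma> (u x) * d x\<bar>) \<longlonglongrightarrow> 0"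
  proof (rule tendsto_sandwich[OF _ _ tendsto_const])
    show "\<forall>\<^sub>F k in sequentially. (LINT x|lborel. \<bar>diff_quot v (\<lambda>x. \<Gamma> (u x)) k x - \<gamma> (u x) * d x\<bar>)
        \<le> C * (LINT x|lborel. \<bar>diff_quot v u k x - d x\<bar>) + (LINT x|lborel. R k x)"
    proof (intro always_eventually allI)
      fix k
      have i: "integrable lborel (\<lambda>x. C * \<bar>diff_quot v u k x - d x\<bar>)"
        by (intro integrable_mult_right integrable_abs Bochner_Integration.integrable_diff integrable_diff_quot u d)
      have "(LINT x|lborel. \<bar>diff_quot v (\<lambda>x. \<Gamma> (u x)) k x - \<gamma> (u x) * d x\<bar>)
          \<le> (LINT x|lborel. C * \<bar>diff_quot v u k x - d x\<bar> + R k x)"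
        by (intro integral_mono pw integrable_abs Bochner_Integration.integrable_diff
            Bochner_Integration.integrable_add integrable_diff_quot w_int dw_int i R_int)
      also have "\<dots> = C * (LINT x|lborel. \<bar>diff_quot v u k x - d x\<bar>) + (LINT x|lborel. R k x)"
        by (subst Bochner_Integration.integral_add[OF i R_int]) simp
      finally show "(LINT x|lborel. \<bar>diff_quot v (\<lambda>x. \<Gamma> (u x)) k x - \<gamma> (u x) * d x\<bar>)
        \<le> C * (LINT x|lborel. \<bar>diff_quot v u k x - d x\<bar>) + (LINT x|lborel. R k x)" .
    qed
    have "(\<lambda>k. C * (LINT x|lborel. \<bar>diff_quot v u k x - d x\<bar>) + (LINT x|lborel. R k x)) \<longlonglongrightarrow> C * 0 + 0"
      by (intro tendsto_intros lim R_lim)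
    then show "(\<lambda>k. C * (LINT x|lborel. \<bar>diff_quot v u k x - d x\<bar>) + (LINT x|lborel. R k x)) \<longlonglongrightarrow> 0" by simp
  qed auto
  then show ?thesis using w_int dw_int by (simp add: L1_dir_def)
qed

text \<open>The estimate does not involve the \<open>L\<^sup>1\<close> norm of \<open>w\<close>. For \<open>h \<in> B\<close> either
  \<open>\<bar>s (x + h)\<bar> > 1\<close>, which happens on a set of \<open>h\<close> of measure at most \<open>S\<close>, or \<open>w (x + h)\<close> is
  controlled by \<open>s (x + h)\<close>; averaging over \<open>B\<close> therefore bounds \<open>w x\<close>.\<close>

lemma L1_bound_by_averaging:
  fixes w s :: "real ^ 'n \<Rightarrow> real" and B :: "(real ^ 'n) set"
  assumes w: "integrable lborel w" and s: "integrable lborel s"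
    and small: "\<And>x. \<bar>s x\<bar> \<le> 1 \<Longrightarrow> \<bar>w x\<bar> \<le> C * \<bar>s x\<bar>" and "0 \<le> C"
    and trans: "\<And>v. (LINT x|lborel. \<bar>w (x + v) - w x\<bar>) \<le> K * norm v" and "0 \<le> K"
    and [measurable]: "B \<in> sets borel" and B: "\<And>h. h \<in> B \<Longrightarrow> norm h \<le> R" and fin: "emeasure lborel B < \<infinity>"
    and large: "1 + (LINT x|lborel. \<bar>s x\<bar>) \<le> measure lborel B"
  shows "(LINT x|lborel. \<bar>w x\<bar>) \<le> measure lborel B * (K * R)
    + C * (1 + (LINT x|lborel. \<bar>s x\<bar>)) * (LINT x|lborel. \<bar>s x\<bar>)"
proof -
  define S where "S = (LINT x|lborel. \<bar>s x\<bar>)"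
  have S0: "0 \<le> S" by (simp add: S_def)
  have [measurable]: "w \<in> borel_measurable borel" "s \<in> borel_measurable borel" using w s by auto
  have iB: "integrable lborel (indicator B :: _ \<Rightarrow> real)" using fin by simp
  define I where "I x = (LINT h|lborel. indicator B h * \<bar>w (x + h) - w x\<bar>)" for x
  have w': "integrable lborel (\<lambda>h. \<bar>w (x + h)\<bar>)" and s': "integrable lborel (\<lambda>h. \<bar>s (x + h)\<bar>)" for x
    using integrable_abs[OF integrable_translate[OF w, of x]] integrable_abs[OF integrable_translate[OF s, of x]]
    by (simp_all add: add.commute)
  have iI: "integrable lborel (\<lambda>h. indicator B h * \<bar>w (x + h) - w x\<bar>)" for x
  proof (rule Bochner_Integration.integrable_bound[OF Bochner_Integration.integrable_add[OF w'[of x] integrable_mult_right[OF iB, of "\<bar>w x\<bar>"]]])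
    show "AE h in lborel. norm (indicator B h * \<bar>w (x + h) - w x\<bar>) \<le> norm (\<bar>w (x + h)\<bar> + \<bar>w x\<bar> * indicator B h)"
      by (auto simp: indicator_def intro!: AE_I2)
  qed measurable
  have pointwise: "\<bar>w x\<bar> \<le> I x + C * S" for x
  proof -
    have "measure lborel B * \<bar>w x\<bar> = (LINT h|lborel. indicator B h * \<bar>w x\<bar>)"
      by simp
    also have "\<dots> \<le> (LINT h|lborel. indicator B h * \<bar>w (x + h) - w x\<bar> + C * \<bar>s (x + h)\<bar> + \<bar>w x\<bar> * \<bar>s (x + h)\<bar>)"
    proof (rule integral_mono)
      fix h
      show "indicator B h * \<bar>w x\<bar> \<le> indicator B h * \<bar>w (x + h) - w x\<bar> + C * \<bar>s (x + h)\<bar> + \<bar>w x\<bar> * \<bar>s (x + h)\<bar>"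
      proof (cases "h \<in> B")
        case True
        show ?thesis
        proof (cases "\<bar>s (x + h)\<bar> \<le> 1")
          case le: True
          have "0 \<le> \<bar>w x\<bar> * \<bar>s (x + h)\<bar>" by simp
          then have "\<bar>w x\<bar> \<le> \<bar>w (x + h) - w x\<bar> + C * \<bar>s (x + h)\<bar> + \<bar>w x\<bar> * \<bar>s (x + h)\<bar>"
            using small[OF le] by linarith
          then show ?thesis using True by simp
        next
          case False
          have "\<bar>w x\<bar> * 1 \<le> \<bar>w x\<bar> * \<bar>s (x + h)\<bar>" using False by (intro mult_left_mono) auto
          moreover have "0 \<le> C * \<bar>s (x + h)\<bar>" using \<open>0 \<le> C\<close> by simp
          ultimately show ?thesis using True by simp
        qed
      next
        case False
        then show ?thesis using \<open>0 \<le> C\<close> by simp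
      qed
    qed (use iI s' iB in auto)
    also have "\<dots> = I x + C * (LINT h|lborel. \<bar>s (x + h)\<bar>) + \<bar>w x\<bar> * (LINT h|lborel. \<bar>s (x + h)\<bar>)"
      using iI s' by (simp add: I_def)
    also have "(LINT h|lborel. \<bar>s (x + h)\<bar>) = S"
      using integral_translate[of "\<lambda>x. \<bar>s x\<bar>" x] by (simp add: S_def add.commute)
    finally have 1: "measure lborel B * \<bar>w x\<bar> \<le> I x + C * S + \<bar>w x\<bar> * S" .
    \<comment> \<open>The 1 in the lower bound on the measure of B is what remains of |w x| after
      the term |w x| S is absorbed.\<close>
    have "(1 + S) * \<bar>w x\<bar> \<le> measure lborel B * \<bar>w x\<bar>"
      using large by (intro mult_right_mono) (auto simp: S_def)
    with 1 show ?thesis by (simp add: algebra_simps)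
  qed
  have I0: "0 \<le> I x" for x by (simp add: I_def)
  \<comment> \<open>The constant C S is not integrable over the whole space. Where |s x| \<le> 1 the
    hypothesis \<open>small\<close> replaces it; elsewhere |s x| > 1, so it is at most C S |s
    x|.\<close>
  have pointwise': "\<bar>w x\<bar> \<le> I x + C * (1 + S) * \<bar>s x\<bar>" for x
  proof (cases "\<bar>s x\<bar> \<le> 1")
    case True
    have "C * \<bar>s x\<bar> \<le> C * (1 + S) * \<bar>s x\<bar>"
      using \<open>0 \<le> C\<close> S0 by (intro mult_right_mono) (auto simp: algebra_simps)
    then show ?thesis using small[OF True] I0[of x] by linarith
  next
    case False
    have "C * S * 1 \<le> C * (1 + S) * \<bar>s x\<bar>"
      using \<open>0 \<le> C\<close> S0 False by (intro mult_mono) (auto simp: algebra_simps)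
    then show ?thesis using pointwise[of x] by linarith
  qed
  have w'': "integrable lborel (\<lambda>x. \<bar>w (x + h) - w x\<bar>)" for h
    by (intro integrable_abs Bochner_Integration.integrable_diff integrable_translate w)
  have bnd: "indicator B h * (LINT x|lborel. \<bar>w (x + h) - w x\<bar>) \<le> K * R * indicator B h" for h
  proof (cases "h \<in> B")
    case True
    then have "K * norm h \<le> K * R" using B \<open>0 \<le> K\<close> by (intro mult_left_mono) auto
    then show ?thesis using True trans[of h] by simp
  qed simp
  have iKR: "integrable lborel (\<lambda>h. K * R * indicator B h)" using iB by simp
  have iB': "integrable lborel (\<lambda>h. indicator B h * (LINT x|lborel. \<bar>w (x + h) - w x\<bar>))"
  proof (rule Bochner_Integration.integrable_bound[OF iKR])
    show "AE h in lborel. norm (indicator B h * (LINT x|lborel. \<bar>w (x + h) - w x\<bar>)) \<le> norm (K * R * indicator B h)"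
    proof (intro AE_I2)
      fix h
      have "norm (indicator B h * (LINT x|lborel. \<bar>w (x + h) - w x\<bar>)) = indicator B h * (LINT x|lborel. \<bar>w (x + h) - w x\<bar>)"
        by simp
      also have "\<dots> \<le> norm (K * R * indicator B h)"
        using bnd[of h] unfolding real_norm_def by linarith
      finally show "norm (indicator B h * (LINT x|lborel. \<bar>w (x + h) - w x\<bar>)) \<le> norm (K * R * indicator B h)" .
    qed
  qed measurable
  have pair: "integrable (lborel \<Otimes>\<^sub>M lborel) (\<lambda>(h, x). indicator B h * \<bar>w (x + h) - w x\<bar>)"
  proof (rule lborel_pair.Fubini_integrable)
    show "integrable lborel (\<lambda>h. LINT x|lborel. norm (case (h, x) of (h, x) \<Rightarrow> indicator B h * \<bar>w (x + h) - w x\<bar>))"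
      using iB' by (simp add: abs_mult)
    show "AE h in lborel. integrable lborel (\<lambda>x. case (h, x) of (h, x) \<Rightarrow> indicator B h * \<bar>w (x + h) - w x\<bar>)"
      using w'' by (auto intro!: AE_I2)
  qed measurable
  have I_int: "integrable lborel I"
    using lborel_pair.integrable_snd[OF pair] by (simp add: I_def[abs_def])
  have "(LINT x|lborel. \<bar>w x\<bar>) \<le> (LINT x|lborel. I x + C * (1 + S) * \<bar>s x\<bar>)"
    by (intro integral_mono pointwise') (use w s I_int in auto)
  also have "\<dots> = (LINT x|lborel. I x) + C * (1 + S) * S"
    using s I_int by (simp add: S_def)
  also have "(LINT x|lborel. I x) = (LINT h|lborel. indicator B h * (LINT x|lborel. \<bar>w (x + h) - w x\<bar>))"
    using lborel_pair.Fubini_integral[OF pair] by (simp add: I_def)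
  also have "\<dots> \<le> (LINT h|lborel. K * R * indicator B h)"
    by (intro integral_mono iB' iKR bnd)
  also have "\<dots> = measure lborel B * (K * R)" by simp
  finally show ?thesis by (simp add: S_def)
qed

section \<open>The chain rule for an unbounded nonlinearity\<close>

lemma real_antiderivative:
  fixes f :: "real \<Rightarrow> real"
  assumes "continuous_on UNIV f"
  obtains F where "F 0 = 0" "\<And>t. (F has_real_derivative f t) (at t)"
proof -
  have "\<exists>F. \<forall>x::real. - \<infinity> < ereal x \<longrightarrow> ereal x < \<infinity> \<longrightarrow> (F has_vector_derivative f x) (at x)"
    using assms by (intro einterval_antiderivative) (auto simp: continuous_on_eq_continuous_at)
  then obtain F where F: "\<And>x. (F has_real_derivative f x) (at x)"
    by (auto simp: has_real_derivative_iff_has_vector_derivative)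
  show ?thesis
    by (rule that[of "\<lambda>t. F t - F 0"]) (auto intro!: derivative_eq_intros F)
qed

text \<open>H - F and H + F are both nondecreasing and vanish at 0, which settles both signs of t at
  once.\<close>

lemma abs_antiderivative_mono:
  fixes F H :: "real \<Rightarrow> real"
  assumes F: "\<And>t. (F has_real_derivative f t) (at t)" "F 0 = 0"
    and H: "\<And>t. (H has_real_derivative h t) (at t)" "H 0 = 0" and le: "\<And>t. \<bar>f t\<bar> \<le> h t"
  shows "\<bar>F t\<bar> \<le> \<bar>H t\<bar>"
proof -
  have mono: "H a - F a \<le> H b - F b" "H a + F a \<le> H b + F b" if "a \<le> b" for a b
  proof -
    show "H a - F a \<le> H b - F b"
    proof (rule DERIV_nonneg_imp_nondecreasing[OF that])
      fix x
      show "\<exists>y. ((\<lambda>x. H x - F x) has_real_derivative y) (at x) \<and> 0 \<le> y"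
        using le[of x] by (intro exI[of _ "h x - f x"] conjI DERIV_diff H F) linarith
    qed
    show "H a + F a \<le> H b + F b"
    proof (rule DERIV_nonneg_imp_nondecreasing[OF that])
      fix x
      show "\<exists>y. ((\<lambda>x. H x + F x) has_real_derivative y) (at x) \<and> 0 \<le> y"
        using le[of x] by (intro exI[of _ "h x + f x"] conjI DERIV_add H F) linarith
    qed
  qed
  show ?thesis
    using mono[of 0 t] mono[of t 0] F(2) H(2) by (cases "0 \<le> t") auto
qed

lemma antiderivative_eq_on_interval:
  fixes F G :: "real \<Rightarrow> real"
  assumes F: "\<And>t. (F has_real_derivative f t) (at t)" and G: "\<And>t. (G has_real_derivative g t) (at t)"
    and "F 0 = G 0" and eq: "\<And>t. \<bar>t\<bar> \<le> M \<Longrightarrow> f t = g t" and t: "\<bar>t\<bar> \<le> M"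
  shows "F t = G t"
proof -
  have "\<exists>c. \<forall>x\<in>{-M..M}. F x - G x = c"
  proof (rule has_field_derivative_zero_constant)
    fix x assume "x \<in> {-M..M}"
    then have "f x - g x = 0" using eq by auto
    then show "((\<lambda>x. F x - G x) has_real_derivative 0) (at x within {-M..M})"
      using DERIV_diff[OF has_field_derivative_at_within[OF F] has_field_derivative_at_within[OF G]] by metis
  qed simp
  then obtain c where "\<And>x. x \<in> {-M..M} \<Longrightarrow> F x - G x = c" by blast
  from this[of t] this[of 0] show ?thesis
    using t abs_le_D1[OF t] abs_le_D2[OF t] \<open>F 0 = G 0\<close> by force
qed

text \<open>Continuity is enough: the cutoff multiplies \<open>g\<close>, and the antiderivative of
  the product is differentiable with bounded derivative, as the chain rule requires.\<close>

definition cutoff :: "nat \<Rightarrow> real \<Rightarrow> real" where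
  "cutoff M t = max 0 (min 1 (real M + 1 - \<bar>t\<bar>))"

lemma cutoff_bounds: "0 \<le> cutoff M t" "cutoff M t \<le> 1" "\<bar>t\<bar> \<le> real M \<Longrightarrow> cutoff M t = 1"
  "\<bar>t\<bar> \<ge> real M + 1 \<Longrightarrow> cutoff M t = 0"
  by (auto simp: cutoff_def)

lemma cutoff_mult_le: "\<bar>a * cutoff M t\<bar> \<le> \<bar>a\<bar>"
  using mult_left_mono[OF cutoff_bounds(2)[of M t] abs_ge_zero[of a]] cutoff_bounds(1)[of M t] by (simp add: abs_mult)

lemma continuous_cutoff_mult:
  "continuous_on UNIV f \<Longrightarrow> continuous_on UNIV (\<lambda>t. f t * cutoff M t)"
  unfolding cutoff_def by (intro continuous_intros)

lemma bounded_cutoff_mult: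
  fixes f :: "real \<Rightarrow> real"
  assumes "continuous_on UNIV f"
  obtains C where "\<And>t. \<bar>f t * cutoff M t\<bar> \<le> C"
proof -
  have "compact (f ` {-(real M + 1)..real M + 1})"
    by (intro compact_continuous_image continuous_on_subset[OF assms]) auto
  then obtain C where C: "\<And>t. t \<in> {-(real M + 1)..real M + 1} \<Longrightarrow> \<bar>f t\<bar> \<le> C"
    by (force dest!: compact_imp_bounded simp: bounded_iff)
  have "\<bar>f t * cutoff M t\<bar> \<le> \<bar>C\<bar>" for t
  proof (cases "\<bar>t\<bar> \<le> real M + 1")
    case True
    then have "\<bar>f t\<bar> \<le> C" by (intro C) auto
    then show ?thesis using cutoff_mult_le[of "f t" M t] by linarith
  next
    case False
    then show ?thesis by (simp add: cutoff_bounds)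
  qed
  then show ?thesis by (rule that)
qed

lemma large_box:
  obtains B :: "(real ^ 'n) set" and R where "B \<in> sets borel" "emeasure lborel B < \<infinity>"
    "\<And>h. h \<in> B \<Longrightarrow> norm h \<le> R" "S \<le> measure lborel B"
proof -
  \<comment> \<open>The side is at least 1, so the volume, a positive power of it, is at least the
    side and hence at least S.\<close>
  define L where "L = max 1 S"
  let ?B = "cbox 0 (L *\<^sub>R One) :: (real ^ 'n) set"
  have "measure lborel ?B = (\<Prod>i\<in>(Basis :: (real ^ 'n) set). L)"
    by (subst content_cbox) (auto simp: L_def intro!: prod.cong)
  also have "\<dots> = L ^ DIM(real ^ 'n)" by simp
  also have "S \<le> \<dots>"
    using self_le_power[of L "DIM(real ^ 'n)"] DIM_positive[where 'a = "real ^ 'n"] by (simp add: L_def)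
  finally have "S \<le> measure lborel ?B" .
  moreover obtain R where "\<And>h. h \<in> ?B \<Longrightarrow> norm h \<le> R"
    using bounded_cbox[of 0 "L *\<^sub>R One :: real ^ 'n"] unfolding bounded_iff by blast
  ultimately show ?thesis
    by (intro that[OF _ emeasure_lborel_cbox_finite]) auto
qed

text \<open>No growth condition on \<open>g\<close> is available, so the chain rule only applies to antiderivatives of
  \<open>g\<close> cut off at level \<open>M\<close>. They are dominated, uniformly in \<open>M\<close>, by the antiderivative \<open>H\<close> of
  \<open>\<bar>g\<bar>\<close>, and \<open>H \<circ> s\<close> is integrable by Fatou and averaging.\<close>

lemma composition_integrable_and_by_parts:
  fixes s :: "real ^ 'n \<Rightarrow> real"
  assumes s: "integrable lborel s" and g: "continuous_on UNIV g"
    and G: "\<And>t. (G has_real_derivative g t) (at t)" "G 0 = 0"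
    and ds: "\<And>v. L1_dir v s (ds v)"
    and gds: "\<And>v. integrable lborel (\<lambda>x. g (s x) * ds v x)"
    and K: "\<And>v. (LINT x|lborel. \<bar>g (s x) * ds v x\<bar>) \<le> K * norm v" "0 \<le> K"
  shows "integrable lborel (\<lambda>x. G (s x))"
    and "\<And>j \<zeta> \<zeta>' Z C. (\<And>t. (\<zeta> has_real_derivative \<zeta>' t) (at t)) \<Longrightarrow> \<zeta>' \<in> borel_measurable borel \<Longrightarrow>
      (\<And>t. \<bar>\<zeta> t\<bar> \<le> Z) \<Longrightarrow> (\<And>t. \<bar>\<zeta>' t\<bar> \<le> C) \<Longrightarrow>
      (LINT x|lborel. \<zeta> (x $ j) * (g (s x) * ds (axis j 1) x)) = - (LINT x|lborel. \<zeta>' (x $ j) * G (s x))"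
proof -
  have [measurable]: "s \<in> borel_measurable borel" using s by auto
  have [measurable]: "ds v \<in> borel_measurable borel" for v using ds[of v] by (auto simp: L1_dir_def)
  have [measurable]: "g \<in> borel_measurable borel" using g by (rule borel_measurable_continuous_onI)
  have [measurable]: "cutoff M \<in> borel_measurable borel" for M unfolding cutoff_def by measurable
  have meas_DERIV: "F \<in> borel_measurable borel" if "\<And>t. (F has_real_derivative f t) (at t)" for F f :: "real \<Rightarrow> real"
    using that by (intro borel_measurable_continuous_onI DERIV_continuous_on) auto
  have [measurable]: "G \<in> borel_measurable borel" using G(1) by (rule meas_DERIV)
  have absg: "continuous_on UNIV (\<lambda>t. \<bar>g t\<bar>)" using g by (intro continuous_intros)
  obtain H where H: "H 0 = 0" "\<And>t. (H has_real_derivative \<bar>g t\<bar>) (at t)"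
    using real_antiderivative[OF absg] by blast
  have [measurable]: "H \<in> borel_measurable borel" using H(2) by (rule meas_DERIV)
  have "\<exists>F. F 0 = 0 \<and> (\<forall>t. (F has_real_derivative \<bar>g t\<bar> * cutoff M t) (at t))" for M
    using real_antiderivative[OF continuous_cutoff_mult[OF absg]] by metis
  then obtain HM where HM: "\<And>M. HM M 0 = 0" "\<And>M t. (HM M has_real_derivative \<bar>g t\<bar> * cutoff M t) (at t)"
    by metis
  have "\<exists>F. F 0 = 0 \<and> (\<forall>t. (F has_real_derivative g t * cutoff M t) (at t))" for M
    using real_antiderivative[OF continuous_cutoff_mult[OF g]] by metis
  then obtain GM where GM: "\<And>M. GM M 0 = 0" "\<And>M t. (GM M has_real_derivative g t * cutoff M t) (at t)"
    by metis
  have [measurable]: "HM M \<in> borel_measurable borel" "GM M \<in> borel_measurable borel" for M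
    by (rule meas_DERIV[OF HM(2)], rule meas_DERIV[OF GM(2)])
  have HM_le: "\<bar>HM M t\<bar> \<le> \<bar>H t\<bar>" for M t
    by (rule abs_antiderivative_mono[OF HM(2,1) H(2,1)]) (use cutoff_mult_le[of "\<bar>g _\<bar>"] in simp)
  have GM_le: "\<bar>GM M t\<bar> \<le> \<bar>H t\<bar>" for M t
    by (rule abs_antiderivative_mono[OF GM(2,1) H(2,1) cutoff_mult_le])
  have G_le: "\<bar>G t\<bar> \<le> \<bar>H t\<bar>" for t
    by (rule abs_antiderivative_mono[OF G H(2,1) order_refl])
  have HM_eq: "HM M t = H t" if "\<bar>t\<bar> \<le> real M" for M t
    by (rule antiderivative_eq_on_interval[OF HM(2) H(2) _ _ that]) (simp_all add: HM(1) H(1) cutoff_bounds)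
  have GM_eq: "GM M t = G t" if "\<bar>t\<bar> \<le> real M" for M t
    by (rule antiderivative_eq_on_interval[OF GM(2) G(1) _ _ that]) (simp_all add: GM(1) G(2) cutoff_bounds)
  have ev: "\<forall>\<^sub>F M in sequentially. \<bar>t\<bar> \<le> real M" for t
    using filterlim_real_sequentially by (simp add: filterlim_at_top)

  \<comment> \<open>On [-1, 1] all truncated antiderivatives grow at most linearly, with a constant
    \<open>C0\<close> independent of M; this is the hypothesis \<open>small\<close> of the averaging
    bound.\<close>
  have "bounded (g ` {-1..1})"
    by (intro compact_imp_bounded compact_continuous_image continuous_on_subset[OF g]) auto
  then obtain C0 where C0: "\<And>t. t \<in> {-1..1} \<Longrightarrow> \<bar>g t\<bar> \<le> C0" by (force simp: bounded_iff)
  have C0_pos: "0 \<le> C0" using C0[of 0] by simp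
  have small: "\<bar>HM M t\<bar> \<le> C0 * \<bar>t\<bar>" if "\<bar>t\<bar> \<le> 1" for M t
  proof -
    have "norm (H t - H 0) \<le> C0 * norm (t - 0)"
      by (rule field_differentiable_bound[of "{-1..1}" H "\<lambda>t. \<bar>g t\<bar>"])
         (use that C0 in \<open>auto intro: has_field_derivative_at_within H(2)\<close>)
    then show ?thesis using HM_le[of M t] by (simp add: H(1))
  qed
  have chain_H: "L1_dir v (\<lambda>x. HM M (s x)) (\<lambda>x. \<bar>g (s x)\<bar> * cutoff M (s x) * ds v x)" for M v
  proof -
    obtain C where "\<And>t. \<bar>\<bar>g t\<bar> * cutoff M t\<bar> \<le> C" using bounded_cutoff_mult[OF absg] by blast
    then show ?thesis by (intro L1_dir_chain[OF ds HM(2,1)]) auto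
  qed
  have chain_G: "L1_dir v (\<lambda>x. GM M (s x)) (\<lambda>x. g (s x) * cutoff M (s x) * ds v x)" for M v
  proof -
    obtain C where "\<And>t. \<bar>g t * cutoff M t\<bar> \<le> C" using bounded_cutoff_mult[OF g] by blast
    then show ?thesis by (intro L1_dir_chain[OF ds GM(2,1)]) auto
  qed
  \<comment> \<open>The cutoff only shrinks the integrand, so K serves for every M.\<close>
  have trans: "(LINT x|lborel. \<bar>HM M (s (x + v)) - HM M (s x)\<bar>) \<le> K * norm v" for M v
  proof -
    have "(LINT x|lborel. \<bar>HM M (s (x + v)) - HM M (s x)\<bar>) \<le> (LINT x|lborel. \<bar>\<bar>g (s x)\<bar> * cutoff M (s x) * ds v x\<bar>)"
      by (rule L1_dir_translation_bound[OF chain_H])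
    also have "\<dots> \<le> (LINT x|lborel. \<bar>g (s x) * ds v x\<bar>)"
    proof (rule integral_mono)
      show "\<bar>\<bar>g (s x)\<bar> * cutoff M (s x) * ds v x\<bar> \<le> \<bar>g (s x) * ds v x\<bar>" for x
        using mult_right_mono[OF cutoff_mult_le[of "\<bar>g (s x)\<bar>" M "s x"] abs_ge_zero[of "ds v x"]]
        by (simp add: abs_mult)
    qed (use chain_H[of v M] gds[of v] in \<open>auto simp: L1_dir_def\<close>)
    finally show ?thesis using K(1)[of v] by linarith
  qed
  obtain B :: "(real ^ 'n) set" and R where B: "B \<in> sets borel" "emeasure lborel B < \<infinity>"
    "\<And>h. h \<in> B \<Longrightarrow> norm h \<le> R" "1 + (LINT x|lborel. \<bar>s x\<bar>) \<le> measure lborel B"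
    using large_box[of "1 + (LINT x|lborel. \<bar>s x\<bar>)"] by blast
  define D where "D = measure lborel B * (K * R) + C0 * (1 + (LINT x|lborel. \<bar>s x\<bar>)) * (LINT x|lborel. \<bar>s x\<bar>)"
  \<comment> \<open>Any direction would do; integrability of the function is part of
    \<open>L1_dir\<close>.\<close>
  have HM_int: "integrable lborel (\<lambda>x. HM M (s x))" for M
    using chain_H[of 0 M] by (simp add: L1_dir_def)
  have unif: "(LINT x|lborel. \<bar>HM M (s x)\<bar>) \<le> D" for M
    unfolding D_def by (rule L1_bound_by_averaging[OF HM_int s small C0_pos trans K(2) B(1,3,2,4)])
  have "(\<integral>\<^sup>+x. ennreal \<bar>H (s x)\<bar> \<partial>lborel) = (\<integral>\<^sup>+x. liminf (\<lambda>M. ennreal \<bar>HM M (s x)\<bar>) \<partial>lborel)"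
  proof (rule nn_integral_cong)
    fix x
    have "\<forall>\<^sub>F M in sequentially. ennreal \<bar>HM M (s x)\<bar> = ennreal \<bar>H (s x)\<bar>"
      using ev[of "s x"] by eventually_elim (simp add: HM_eq)
    then have "(\<lambda>M. ennreal \<bar>HM M (s x)\<bar>) \<longlonglongrightarrow> ennreal \<bar>H (s x)\<bar>" by (rule tendsto_eventually)
    then show "ennreal \<bar>H (s x)\<bar> = liminf (\<lambda>M. ennreal \<bar>HM M (s x)\<bar>)"
      by (intro lim_imp_Liminf[symmetric]) auto
  qed
  also have "\<dots> \<le> liminf (\<lambda>M. \<integral>\<^sup>+x. ennreal \<bar>HM M (s x)\<bar> \<partial>lborel)"
    by (rule nn_integral_liminf) measurable
  also have "\<dots> \<le> ennreal D"
  proof (rule Liminf_le)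
    show "\<forall>\<^sub>F M in sequentially. (\<integral>\<^sup>+x. ennreal \<bar>HM M (s x)\<bar> \<partial>lborel) \<le> ennreal D"
      using unif by (intro always_eventually allI, subst nn_integral_eq_integral)
        (auto intro: HM_int ennreal_leI)
  qed simp
  finally have "(\<integral>\<^sup>+x. ennreal \<bar>H (s x)\<bar> \<partial>lborel) < \<infinity>"
    by (rule le_less_trans) simp
  then have H_int: "integrable lborel (\<lambda>x. H (s x))"
    by (intro integrableI_bounded) auto
  show "integrable lborel (\<lambda>x. G (s x))"
    by (rule Bochner_Integration.integrable_bound[OF H_int]) (auto simp: G_le)
  fix j \<zeta> \<zeta>' Z C
  assume \<zeta>: "\<And>t. (\<zeta> has_real_derivative \<zeta>' t) (at t)" and \<zeta>'[measurable]: "\<zeta>' \<in> borel_measurable borel"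
    and Z: "\<And>t. \<bar>\<zeta> t\<bar> \<le> Z" and C: "\<And>t. \<bar>\<zeta>' t\<bar> \<le> C"
  have [measurable]: "\<zeta> \<in> borel_measurable borel" using \<zeta> by (rule meas_DERIV)
  let ?e = "axis j 1 :: real ^ 'n"
  \<comment> \<open>Both sides of the truncated formula converge as M grows: the left dominated by
    the assumed integrable g(s) ds, the right by H(s), whose integrability was just obtained. At
    each x the integrands are eventually constant in M.\<close>
  have "(\<lambda>M. LINT x|lborel. \<zeta> (x $ j) * (g (s x) * cutoff M (s x) * ds ?e x)) \<longlonglongrightarrow> (LINT x|lborel. \<zeta> (x $ j) * (g (s x) * ds ?e x))"
  proof (rule integral_dominated_convergence)
    show "integrable lborel (\<lambda>x. Z * \<bar>g (s x) * ds ?e x\<bar>)" using gds by simp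
    show "AE x in lborel. (\<lambda>M. \<zeta> (x $ j) * (g (s x) * cutoff M (s x) * ds ?e x)) \<longlonglongrightarrow> \<zeta> (x $ j) * (g (s x) * ds ?e x)"
    proof (intro AE_I2 tendsto_eventually)
      fix x
      show "\<forall>\<^sub>F M in sequentially. \<zeta> (x $ j) * (g (s x) * cutoff M (s x) * ds ?e x) = \<zeta> (x $ j) * (g (s x) * ds ?e x)"
        using ev[of "s x"] by eventually_elim (simp add: cutoff_bounds)
    qed
    show "AE x in lborel. norm (\<zeta> (x $ j) * (g (s x) * cutoff M (s x) * ds ?e x)) \<le> Z * \<bar>g (s x) * ds ?e x\<bar>" for M
    proof (intro AE_I2)
      fix x
      have "\<bar>\<zeta> (x $ j)\<bar> * (\<bar>g (s x) * cutoff M (s x)\<bar> * \<bar>ds ?e x\<bar>) \<le> Z * (\<bar>g (s x)\<bar> * \<bar>ds ?e x\<bar>)"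
        using order_trans[OF abs_ge_zero Z] by (intro mult_mono mult_right_mono cutoff_mult_le Z) auto
      then show "norm (\<zeta> (x $ j) * (g (s x) * cutoff M (s x) * ds ?e x)) \<le> Z * \<bar>g (s x) * ds ?e x\<bar>"
        by (simp add: abs_mult)
    qed
  qed measurable
  moreover have "(LINT x|lborel. \<zeta> (x $ j) * (g (s x) * cutoff M (s x) * ds ?e x)) = (LINT x|lborel. - (\<zeta>' (x $ j) * GM M (s x)))" for M
    using L1_dir_integral_by_parts[OF chain_G \<zeta> \<zeta>' Z C] by simp
  moreover have "(\<lambda>M. LINT x|lborel. - (\<zeta>' (x $ j) * GM M (s x))) \<longlonglongrightarrow> (LINT x|lborel. - (\<zeta>' (x $ j) * G (s x)))"
  proof (rule integral_dominated_convergence)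
    show "integrable lborel (\<lambda>x. C * \<bar>H (s x)\<bar>)" using H_int by simp
    show "AE x in lborel. (\<lambda>M. - (\<zeta>' (x $ j) * GM M (s x))) \<longlonglongrightarrow> - (\<zeta>' (x $ j) * G (s x))"
    proof (intro AE_I2 tendsto_eventually)
      fix x
      show "\<forall>\<^sub>F M in sequentially. - (\<zeta>' (x $ j) * GM M (s x)) = - (\<zeta>' (x $ j) * G (s x))"
        using ev[of "s x"] by eventually_elim (simp add: GM_eq)
    qed
    show "AE x in lborel. norm (- (\<zeta>' (x $ j) * GM M (s x))) \<le> C * \<bar>H (s x)\<bar>" for M
      using C order_trans[OF abs_ge_zero C] by (auto simp: abs_mult intro!: AE_I2 mult_mono GM_le)
  qed measurable
  ultimately show "(LINT x|lborel. \<zeta> (x $ j) * (g (s x) * ds ?e x)) = - (LINT x|lborel. \<zeta>' (x $ j) * G (s x))"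
    using LIMSEQ_unique by fastforce
qed

section \<open>The virial identity for real antisymmetric first order systems\<close>

lemma bounded_bilinear_inner_linear:
  assumes "linear L"
  shows "bounded_bilinear (\<lambda>u w. u \<bullet> L (w :: 'b::euclidean_space) :: real)"
  using bounded_bilinear.comp[OF bounded_bilinear_inner bounded_linear_ident linear_conv_bounded_linear[THEN iffD1, OF assms]]
  by simp

lemma L2_pairing_tendsto:
  fixes p :: "'b::euclidean_space \<Rightarrow> 'c::euclidean_space \<Rightarrow> real"
  assumes p: "bounded_bilinear p" and f: "L2 f" and F: "\<And>k. L2 (F k)" "L2 F0"
    and lim: "(\<lambda>k. sqn (\<lambda>x. F k x - F0 x)) \<longlonglongrightarrow> 0"
    and z[measurable]: "z \<in> borel_measurable borel" and Z: "\<And>x. \<bar>z x\<bar> \<le> Z"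
  shows "(\<lambda>k. LINT x|lborel. z x * p (f x) (F k x)) \<longlonglongrightarrow> (LINT x|lborel. z x * p (f x) (F0 x))"
proof -
  interpret bounded_bilinear p by fact
  obtain K where K: "\<And>a b. norm (p a b) \<le> norm a * norm b * K" "K \<ge> 0"
    using nonneg_bounded by auto
  have Z0: "0 \<le> Z" using Z order_trans[OF abs_ge_zero] by blast
  have zi: "integrable lborel (\<lambda>x. z x * p (f x) (g x))" if "L2 g" for g
    using Z by (intro integrable_bounded_mult L2_bilinear_integrable[OF p f that]) auto
  have E: "(\<lambda>k. LINT x|lborel. norm (F k x - F0 x) * norm (f x)) \<longlonglongrightarrow> 0"
    by (rule L2_product_tendsto_0[OF _ _ lim, where B = "sqn f"]) (auto intro!: L2_diff f F)
  have le: "\<bar>(LINT x|lborel. z x * p (f x) (F k x)) - (LINT x|lborel. z x * p (f x) (F0 x))\<bar>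
      \<le> Z * K * (LINT x|lborel. norm (F k x - F0 x) * norm (f x))" for k
  proof -
    have "(LINT x|lborel. z x * p (f x) (F k x)) - (LINT x|lborel. z x * p (f x) (F0 x))
        = (LINT x|lborel. z x * p (f x) (F k x - F0 x))"
      using zi[OF F(1)[of k]] zi[OF F(2)] by (simp add: diff_right right_diff_distrib)
    also have "\<bar>\<dots>\<bar> \<le> (LINT x|lborel. \<bar>z x * p (f x) (F k x - F0 x)\<bar>)"
      by (rule integral_abs_bound)
    also have "\<dots> \<le> (LINT x|lborel. Z * K * (norm (F k x - F0 x) * norm (f x)))"
    proof (rule integral_mono)
      fix x
      have "\<bar>z x\<bar> * \<bar>p (f x) (F k x - F0 x)\<bar> \<le> Z * (norm (f x) * norm (F k x - F0 x) * K)"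
        using K(1)[of "f x" "F k x - F0 x"] Z[of x] Z0 by (intro mult_mono) auto
      then show "\<bar>z x * p (f x) (F k x - F0 x)\<bar> \<le> Z * K * (norm (F k x - F0 x) * norm (f x))"
        by (simp add: abs_mult mult_ac)
    qed (intro integrable_abs zi L2_diff F integrable_mult_right L2_mult_integrable f)+
    finally show ?thesis by simp
  qed
  show ?thesis
    using le by (intro Lim_null_comparison[OF always_eventually tendsto_mult_right_zero[OF E, of "Z * K"], THEN LIM_zero_cancel]) auto
qed

lemma axis_axis_nth: "axis k (1::real) $ j = (if j = k then 1 else 0)"
  by (simp add: axis_def)

text \<open>Formally \<open>d\<^sub>j \<bullet> A d\<^sub>k - d\<^sub>k \<bullet> A d\<^sub>j\<close> is the divergence \<open>\<partial>\<^sub>j (\<phi> \<bullet> A d\<^sub>k) - \<partial>\<^sub>k (\<phi> \<bullet> A d\<^sub>j)\<close>.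
  Second derivatives are avoided by replacing \<open>\<partial>\<^sub>k\<close> by difference quotients, which
  preserve functions of \<open>x\<^sub>j\<close>.\<close>

lemma mixed_derivative_identity:
  fixes \<phi> :: "real ^ 'n \<Rightarrow> 'b::euclidean_space"
  assumes dj: "L2_dir (axis j 1) \<phi> dj" and dk: "L2_dir (axis k 1) \<phi> dk" "L2_dir (- axis k 1) \<phi> (\<lambda>x. - dk x)"
    and A: "linear A" and anti: "\<And>u w. u \<bullet> A w = - (A u \<bullet> w)" and "j \<noteq> k"
    and \<zeta>: "\<And>t. (\<zeta> has_real_derivative \<zeta>' t) (at t)" and \<zeta>'[measurable]: "\<zeta>' \<in> borel_measurable borel"
    and Z: "\<And>t. \<bar>\<zeta> t\<bar> \<le> Z" and C: "\<And>t. \<bar>\<zeta>' t\<bar> \<le> C"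
  shows "(LINT x|lborel. \<zeta> (x $ j) * (dj x \<bullet> A (dk x))) = - (LINT x|lborel. \<zeta>' (x $ j) * (\<phi> x \<bullet> A (dk x))) / 2"
proof -
  have \<phi>: "L2 \<phi>" and L2: "L2 dj" "L2 dk" using dj dk by (auto simp: L2_dir_def)
  note [measurable] = \<phi>[THEN L2_measurable] L2[THEN L2_measurable]
  note p = bounded_bilinear_inner_linear[OF A]
  have A_meas[measurable]: "A \<in> borel_measurable borel"
    using linear_continuous_on[OF linear_conv_bounded_linear[THEN iffD1, OF A]] by (rule borel_measurable_continuous_onI)
  have [measurable]: "\<zeta> \<in> borel_measurable borel"
    using \<zeta> by (intro borel_measurable_continuous_onI DERIV_continuous_on) auto
  define c where "c m = (1 / real (Suc m)) *\<^sub>R (axis k 1 :: real ^ 'n)" for m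
  let ?Z = "\<lambda>x::real ^ 'n. \<zeta> (x $ j)" and ?Z' = "\<lambda>x::real ^ 'n. \<zeta>' (x $ j)"
  have c_j: "c m $ j = 0" for m using \<open>j \<noteq> k\<close> by (simp add: c_def axis_axis_nth)
  have iZ: "integrable lborel (\<lambda>x. ?Z x * (u x \<bullet> A (w x)))" if "L2 u" "L2 w" for u w
    using Z by (intro integrable_bounded_mult L2_bilinear_integrable[OF p] that) auto
  have iZ': "integrable lborel (\<lambda>x. ?Z' x * (u x \<bullet> A (w x)))" if "L2 u" "L2 w" for u w
    using C by (intro integrable_bounded_mult L2_bilinear_integrable[OF p] that) auto
  \<comment> \<open>The divergence in direction j is taken of \<phi>(x) paired with its translate,
    so that each factor is differentiated only once.\<close>
  have parts: "(LINT x|lborel. ?Z x * (dj x \<bullet> A (\<phi> (x + c)))) + (LINT x|lborel. ?Z x * (\<phi> x \<bullet> A (dj (x + c))))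
      = - (LINT x|lborel. ?Z' x * (\<phi> x \<bullet> A (\<phi> (x + c))))" for c
  proof -
    have "(LINT x|lborel. ?Z x * (dj x \<bullet> A (\<phi> (x + c)) + \<phi> x \<bullet> A (dj (x + c))))
      = - (LINT x|lborel. ?Z' x * (\<phi> x \<bullet> A (\<phi> (x + c))))"
      by (rule L1_dir_integral_by_parts[OF L1_dir_product[OF p dj L2_dir_translate[OF dj]] \<zeta> \<zeta>' Z C])
    then show ?thesis
      using iZ[OF L2(1) L2_translate[OF \<phi>, of c]] iZ[OF \<phi> L2_translate[OF L2(1), of c]] by (simp add: distrib_left)
  qed
  \<comment> \<open>The weight does not see the translation, so the shift passes to \<phi> with the
    opposite sign; this is where the quotient in direction -e_k comes from.\<close>
  have shift: "(LINT x|lborel. ?Z x * (\<phi> x \<bullet> A (dj (x + c m)))) = (LINT x|lborel. ?Z x * (\<phi> (x - c m) \<bullet> A (dj x)))" for m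
    using integral_translate[of "\<lambda>x. ?Z x * (\<phi> (x - c m) \<bullet> A (dj x))" "c m"] by (simp add: c_j)
  have dq: "diff_quot (axis k 1) \<phi> m x = real (Suc m) *\<^sub>R (\<phi> (x + c m) - \<phi> x)"
    "diff_quot (- axis k 1) \<phi> m x = real (Suc m) *\<^sub>R (\<phi> (x - c m) - \<phi> x)" for m x
    by (simp_all add: diff_quot_def c_def)
  interpret A: linear A by fact
  have step: "(LINT x|lborel. ?Z x * (dj x \<bullet> A (diff_quot (axis k 1) \<phi> m x)))
      - (LINT x|lborel. ?Z x * (A (dj x) \<bullet> (- diff_quot (- axis k 1) \<phi> m x)))
      = - (LINT x|lborel. ?Z' x * (\<phi> x \<bullet> A (diff_quot (axis k 1) \<phi> m x)))" for m
  proof -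
    have e1: "(LINT x|lborel. ?Z x * (dj x \<bullet> A (diff_quot (axis k 1) \<phi> m x)))
      = real (Suc m) * ((LINT x|lborel. ?Z x * (dj x \<bullet> A (\<phi> (x + c m)))) - (LINT x|lborel. ?Z x * (dj x \<bullet> A (\<phi> x))))"
      unfolding Bochner_Integration.integral_diff[OF iZ[OF L2(1) L2_translate[OF \<phi>]] iZ[OF L2(1) \<phi>], symmetric]
        integral_mult_right_zero[symmetric]
      by (rule Bochner_Integration.integral_cong) (simp_all only: dq A.scale A.diff inner_scaleR_right inner_diff_right, simp only: algebra_simps)
    have e2: "(LINT x|lborel. ?Z x * (A (dj x) \<bullet> (- diff_quot (- axis k 1) \<phi> m x)))
      = - (real (Suc m) * ((LINT x|lborel. ?Z x * (\<phi> (x - c m) \<bullet> A (dj x))) - (LINT x|lborel. ?Z x * (\<phi> x \<bullet> A (dj x)))))"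
      using iZ[OF L2_translate[OF \<phi>, of "- c m"] L2(1)]
      unfolding Bochner_Integration.integral_diff[OF iZ[OF L2_translate[OF \<phi>, of "- c m"] L2(1)] iZ[OF \<phi> L2(1)], symmetric, simplified]
        integral_mult_right_zero[symmetric] integral_minus[symmetric]
      by (intro Bochner_Integration.integral_cong) (simp_all only: dq inner_commute[of "A _"] inner_minus_left inner_scaleR_left inner_diff_left,
          simp only: algebra_simps mult_minus_right minus_diff_eq)
    have e3: "(LINT x|lborel. ?Z' x * (\<phi> x \<bullet> A (diff_quot (axis k 1) \<phi> m x)))
      = real (Suc m) * ((LINT x|lborel. ?Z' x * (\<phi> x \<bullet> A (\<phi> (x + c m)))) - (LINT x|lborel. ?Z' x * (\<phi> x \<bullet> A (\<phi> x))))"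
      unfolding Bochner_Integration.integral_diff[OF iZ'[OF \<phi> L2_translate[OF \<phi>]] iZ'[OF \<phi> \<phi>], symmetric]
        integral_mult_right_zero[symmetric]
      by (rule Bochner_Integration.integral_cong) (simp_all only: dq A.scale A.diff inner_scaleR_right inner_diff_right, simp only: algebra_simps)
    \<comment> \<open>The formula \<open>parts\<close> at shift \<open>c m\<close> minus the same
      formula at shift 0; multiplied by m + 1 it becomes the identity for difference
      quotients.\<close>
    have "(LINT x|lborel. ?Z x * (dj x \<bullet> A (\<phi> (x + c m)))) - (LINT x|lborel. ?Z x * (dj x \<bullet> A (\<phi> x)))
        + ((LINT x|lborel. ?Z x * (\<phi> (x - c m) \<bullet> A (dj x))) - (LINT x|lborel. ?Z x * (\<phi> x \<bullet> A (dj x))))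
        = - ((LINT x|lborel. ?Z' x * (\<phi> x \<bullet> A (\<phi> (x + c m)))) - (LINT x|lborel. ?Z' x * (\<phi> x \<bullet> A (\<phi> x))))"
      using parts[of "c m"] parts[of 0] shift[of m] by simp
    from arg_cong[OF this, of "\<lambda>t. real (Suc m) * t"] show ?thesis
      unfolding e1 e2 e3 by (simp only: distrib_left mult_minus_right diff_minus_eq_add)
  qed
  have lim1: "(\<lambda>m. LINT x|lborel. ?Z x * (dj x \<bullet> A (diff_quot (axis k 1) \<phi> m x))) \<longlonglongrightarrow> (LINT x|lborel. ?Z x * (dj x \<bullet> A (dk x)))"
    using dk(1) Z L2(1) by (intro L2_pairing_tendsto[OF p]) (auto simp: L2_dir_def intro: L2_diff_quot)
  have "L2 (\<lambda>x. A (dj x))" by (rule L2_linear[OF linear_conv_bounded_linear[THEN iffD1, OF A] L2(1)])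
  moreover have "(\<lambda>m. sqn (\<lambda>x. - diff_quot (- axis k 1) \<phi> m x - dk x)) \<longlonglongrightarrow> 0"
  proof -
    have "sqn (\<lambda>x. - diff_quot (- axis k 1) \<phi> m x - dk x) = sqn (\<lambda>x. diff_quot (- axis k 1) \<phi> m x - - dk x)" for m
      using sqn_minus_commute[of "\<lambda>x. - diff_quot (- axis k 1) \<phi> m x" dk] by (simp add: add.commute)
    then show ?thesis using dk(2) by (simp add: L2_dir_def)
  qed
  moreover have "L2 (\<lambda>x. - diff_quot (- axis k 1) \<phi> m x)" for m
    using L2_scaleR[OF L2_diff_quot[OF \<phi>], of "-1"] by simp
  ultimately have lim2: "(\<lambda>m. LINT x|lborel. ?Z x * (A (dj x) \<bullet> (- diff_quot (- axis k 1) \<phi> m x))) \<longlonglongrightarrow> (LINT x|lborel. ?Z x * (A (dj x) \<bullet> dk x))"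
    using Z by (intro L2_pairing_tendsto[OF bounded_bilinear_inner] L2) auto
  have lim3: "(\<lambda>m. LINT x|lborel. ?Z' x * (\<phi> x \<bullet> A (diff_quot (axis k 1) \<phi> m x))) \<longlonglongrightarrow> (LINT x|lborel. ?Z' x * (\<phi> x \<bullet> A (dk x)))"
    using dk(1) C by (intro L2_pairing_tendsto[OF p]) (auto simp: L2_dir_def intro: L2_diff_quot)
  have "(LINT x|lborel. ?Z x * (dj x \<bullet> A (dk x))) - (LINT x|lborel. ?Z x * (A (dj x) \<bullet> dk x))
      = - (LINT x|lborel. ?Z' x * (\<phi> x \<bullet> A (dk x)))"
    using LIMSEQ_unique[OF tendsto_diff[OF lim1 lim2, unfolded step] tendsto_minus[OF lim3]] .
  \<comment> \<open>By antisymmetry the subtracted integral is the negative of the first, so the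
    left side is twice the integral sought.\<close>
  then show ?thesis
    by (simp add: anti[of "dj _"])
qed

lemma arctan_scaled_has_derivative:
  assumes "0 < R"
  shows "((\<lambda>t. R * arctan (t / R)) has_real_derivative inverse (1 + (t / R)\<^sup>2)) (at t)"
proof -
  have "((\<lambda>t. arctan (t / R)) has_real_derivative inverse (1 + (t / R)\<^sup>2) * (1 / R)) (at t)"
    by (rule DERIV_chain2[OF DERIV_arctan DERIV_cdivide[OF DERIV_ident]])
  from DERIV_cmult[OF this, of R] show ?thesis using assms by simp
qed

text \<open>Formulated over a real Euclidean space, because multiplication by -i makes Hermitian
  matrices antisymmetric for the real part of the product. The complex structure returns only when
  the functionals are evaluated.\<close>

lemma virial_identities:
  fixes \<phi> :: "real ^ 'n \<Rightarrow> 'b::euclidean_space"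
  assumes dir: "\<And>v. L2_dir v \<phi> (\<lambda>x. \<Sum>i\<in>UNIV. v $ i *\<^sub>R d i x)"
    and A: "\<And>k. linear (A k)" and anti: "\<And>k u w. u \<bullet> A k w = - (A k u \<bullet> w)"
    and \<beta>: "linear \<beta>" and sym: "\<And>u w. u \<bullet> \<beta> w = \<beta> u \<bullet> w" and invol: "\<And>u. \<beta> (\<beta> u) = u"
    and g: "continuous_on UNIV g" and G: "\<And>t. (G has_real_derivative g t) (at t)" "G 0 = 0"
    and eq: "AE x in lborel. (\<Sum>k\<in>UNIV. A k (d k x)) - \<omega> *\<^sub>R \<phi> x + g (\<phi> x \<bullet> \<beta> (\<phi> x)) *\<^sub>R \<beta> (\<phi> x) = 0"
  shows "integrable lborel (\<lambda>x. G (\<phi> x \<bullet> \<beta> (\<phi> x)))"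
    and "integrable lborel (\<lambda>x. (\<phi> x \<bullet> \<beta> (\<phi> x)) * g (\<phi> x \<bullet> \<beta> (\<phi> x)))"
    and "(\<Sum>k\<in>UNIV - {j}. LINT x|lborel. \<phi> x \<bullet> A k (d k x)) + (LINT x|lborel. G (\<phi> x \<bullet> \<beta> (\<phi> x)))
      = \<omega> * (LINT x|lborel. \<phi> x \<bullet> \<phi> x)"
    and "(\<Sum>k\<in>UNIV. LINT x|lborel. \<phi> x \<bullet> A k (d k x)) + (LINT x|lborel. (\<phi> x \<bullet> \<beta> (\<phi> x)) * g (\<phi> x \<bullet> \<beta> (\<phi> x)))
      = \<omega> * (LINT x|lborel. \<phi> x \<bullet> \<phi> x)"
proof -
  define dv where "dv v x = (\<Sum>i\<in>UNIV. v $ i *\<^sub>R d i x)" for v :: "real ^ 'n" and x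
  have dv_axis: "dv (axis j 1) = d j" for j
  proof
    fix x
    have "dv (axis j 1) x = (\<Sum>i\<in>UNIV. if i = j then d i x else 0)"
      unfolding dv_def axis_axis_nth by (rule sum.cong) auto
    then show "dv (axis j 1) x = d j x" by simp
  qed
  have dir': "L2_dir v \<phi> (dv v)" for v using dir[of v] by (simp add: dv_def[abs_def])
  have dir_axis: "L2_dir (axis j 1) \<phi> (d j)" "L2_dir (- axis j 1) \<phi> (\<lambda>x. - d j x)" for j
  proof -
    show "L2_dir (axis j 1) \<phi> (d j)" using dir'[of "axis j 1"] by (simp add: dv_axis)
    have "dv (- axis j 1) x = - dv (axis j 1) x" for x
      by (simp add: dv_def sum_negf[symmetric])
    then have "dv (- axis j 1) = (\<lambda>x. - d j x)" by (simp add: dv_axis fun_eq_iff)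
    then show "L2_dir (- axis j 1) \<phi> (\<lambda>x. - d j x)" using dir'[of "- axis j 1"] by simp
  qed
  have \<phi>: "L2 \<phi>" and L2dv: "L2 (dv v)" for v using dir'[of v] by (auto simp: L2_dir_def)
  have L2d: "L2 (d j)" for j using L2dv[of "axis j 1"] by (simp add: dv_axis)
  have bA: "bounded_linear (A k)" for k using A linear_conv_bounded_linear by blast
  have b\<beta>: "bounded_linear \<beta>" using \<beta> linear_conv_bounded_linear by blast
  note pA = bounded_bilinear_inner_linear[OF A] and p\<beta> = bounded_bilinear_inner_linear[OF \<beta>]
  interpret \<beta>: linear \<beta> by fact
  define s where "s x = \<phi> x \<bullet> \<beta> (\<phi> x)" for x
  define \<psi> where "\<psi> x = g (s x) *\<^sub>R \<phi> x" for x
  have s: "integrable lborel s" unfolding s_def[abs_def] by (intro L2_bilinear_integrable[OF p\<beta>] \<phi>)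
  have [measurable]: "s \<in> borel_measurable borel" using s by auto
  have [measurable]: "\<phi> \<in> borel_measurable borel" using \<phi> by simp
  have [measurable]: "d k \<in> borel_measurable borel" for k using L2d by simp
  have [measurable]: "g \<in> borel_measurable borel" using g by (rule borel_measurable_continuous_onI)
  have eq': "AE x in lborel. (\<Sum>k\<in>UNIV. A k (d k x)) - \<omega> *\<^sub>R \<phi> x + g (s x) *\<^sub>R \<beta> (\<phi> x) = 0"
    using eq by (simp add: s_def)
  have \<psi>: "L2 \<psi>"
  proof -
    \<comment> \<open>Applying \<beta> to the equation and using that it is an involution expresses
      g(s) \<phi> through \<phi> and its derivatives, all square integrable.\<close>
    define \<xi> where "\<xi> x = \<beta> (\<omega> *\<^sub>R \<phi> x - (\<Sum>k\<in>UNIV. A k (d k x)))" for x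
    have \<xi>: "L2 \<xi>"
      unfolding \<xi>_def[abs_def]
      by (intro L2_linear[OF b\<beta>] L2_diff L2_scaleR \<phi> L2_sum L2_linear[OF bA] L2d) auto
    have [measurable]: "\<psi> \<in> borel_measurable borel" unfolding \<psi>_def[abs_def] by measurable
    have [measurable]: "\<xi> \<in> borel_measurable borel" using \<xi> by simp
    have "AE x in lborel. \<psi> x = \<xi> x"
      using eq'
    proof eventually_elim
      case (elim x)
      then have "\<omega> *\<^sub>R \<phi> x - (\<Sum>k\<in>UNIV. A k (d k x)) = g (s x) *\<^sub>R \<beta> (\<phi> x)"
        by (simp add: algebra_simps)
      then show ?case by (simp add: \<psi>_def \<xi>_def \<beta>.scale invol)
    qed
    then have "AE x in lborel. (norm (\<psi> x))\<^sup>2 = (norm (\<xi> x))\<^sup>2" by eventually_elim simp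
    then have "integrable lborel (\<lambda>x. (norm (\<psi> x))\<^sup>2) = integrable lborel (\<lambda>x. (norm (\<xi> x))\<^sup>2)"
      by (intro integrable_cong_AE) measurable
    then show ?thesis using \<xi> by (simp add: L2_def)
  qed
  define ds where "ds v x = 2 * (\<phi> x \<bullet> \<beta> (dv v x))" for v x
  have ds: "L1_dir v s (ds v)" for v
  proof -
    have "ds v = (\<lambda>x. dv v x \<bullet> \<beta> (\<phi> x) + \<phi> x \<bullet> \<beta> (dv v x))"
      using sym[of "dv v _" "\<phi> _"] by (simp add: ds_def fun_eq_iff inner_commute[of "\<beta> _"])
    then show ?thesis
      using L1_dir_product[OF p\<beta> dir'[of v] dir'[of v]] by (simp add: s_def[abs_def])
  qed
  have gds_eq: "g (s x) * ds v x = 2 * (\<psi> x \<bullet> \<beta> (dv v x))" for v x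
    by (simp add: \<psi>_def ds_def)
  have gds: "integrable lborel (\<lambda>x. g (s x) * ds v x)" for v
    unfolding gds_eq by (intro integrable_mult_right L2_bilinear_integrable[OF p\<beta>] \<psi> L2dv)
  \<comment> \<open>Each component of \<open>v\<close> is at most its norm, so the bound is linear
    in \<open>norm v\<close>, hence uniform over the bounded set of shifts used in
    averaging.\<close>
  define K where "K = (\<Sum>i\<in>UNIV. 2 * (LINT x|lborel. norm (\<psi> x) * norm (\<beta> (d i x))))"
  have K0: "0 \<le> K" by (simp add: K_def sum_nonneg)
  have K: "(LINT x|lborel. \<bar>g (s x) * ds v x\<bar>) \<le> K * norm v" for v
  proof -
    have int: "integrable lborel (\<lambda>x. norm (\<psi> x) * norm (\<beta> (d i x)))" for i
      by (intro L2_mult_integrable \<psi> L2_linear[OF b\<beta>] L2d)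
    have "(LINT x|lborel. \<bar>g (s x) * ds v x\<bar>) \<le> (LINT x|lborel. (\<Sum>i\<in>UNIV. norm v * (2 * (norm (\<psi> x) * norm (\<beta> (d i x))))))"
    proof (rule integral_mono)
      fix x
      have "\<bar>g (s x) * ds v x\<bar> = 2 * \<bar>\<Sum>i\<in>UNIV. v $ i * (\<psi> x \<bullet> \<beta> (d i x))\<bar>"
        unfolding gds_eq by (simp add: dv_def \<beta>.sum \<beta>.scale inner_sum_right abs_mult)
      also have "\<dots> \<le> 2 * (\<Sum>i\<in>UNIV. \<bar>v $ i * (\<psi> x \<bullet> \<beta> (d i x))\<bar>)"
        by (intro mult_left_mono sum_abs) simp
      also have "\<dots> \<le> 2 * (\<Sum>i\<in>UNIV. norm v * (norm (\<psi> x) * norm (\<beta> (d i x))))"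
        unfolding abs_mult
        by (intro mult_left_mono sum_mono mult_mono component_le_norm_cart Cauchy_Schwarz_ineq2) auto
      also have "\<dots> = (\<Sum>i\<in>UNIV. norm v * (2 * (norm (\<psi> x) * norm (\<beta> (d i x)))))"
        by (simp add: sum_distrib_left mult.left_commute)
      finally show "\<bar>g (s x) * ds v x\<bar> \<le> (\<Sum>i\<in>UNIV. norm v * (2 * (norm (\<psi> x) * norm (\<beta> (d i x)))))" .
    qed (use gds int in auto)
    also have "\<dots> = K * norm v"
      using int by (simp add: K_def sum_distrib_left sum_distrib_right mult.commute)
    finally show ?thesis .
  qed
  note comp = composition_integrable_and_by_parts[OF s g G ds gds K K0]
  have G_int: "integrable lborel (\<lambda>x. G (s x))" by (rule comp(1))
  then show "integrable lborel (\<lambda>x. G (\<phi> x \<bullet> \<beta> (\<phi> x)))" by (simp add: s_def)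
  have sg_eq: "s x * g (s x) = \<psi> x \<bullet> \<beta> (\<phi> x)" for x by (simp add: \<psi>_def s_def)
  have sg_int: "integrable lborel (\<lambda>x. s x * g (s x))"
    unfolding sg_eq by (intro L2_bilinear_integrable[OF p\<beta>] \<psi> \<phi>)
  then show "integrable lborel (\<lambda>x. (\<phi> x \<bullet> \<beta> (\<phi> x)) * g (\<phi> x \<bullet> \<beta> (\<phi> x)))" by (simp add: s_def)
  have iA: "integrable lborel (\<lambda>x. u x \<bullet> A k (d k x))" if "L2 u" for u k
    by (intro L2_bilinear_integrable[OF pA] that L2d)
  have i\<phi>: "integrable lborel (\<lambda>x. u x \<bullet> \<phi> x)" if "L2 u" for u
    by (intro L2_bilinear_integrable[OF bounded_bilinear_inner] that \<phi>)

  have "AE x in lborel. (\<Sum>k\<in>UNIV. \<phi> x \<bullet> A k (d k x)) + s x * g (s x) = \<omega> * (\<phi> x \<bullet> \<phi> x)"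
    using eq'
  proof eventually_elim
    case (elim x)
    from arg_cong[OF this, of "\<lambda>y. \<phi> x \<bullet> y"] show ?case
      by (simp add: inner_add_right inner_diff_right inner_sum_right s_def mult.commute)
  qed
  then have "(LINT x|lborel. (\<Sum>k\<in>UNIV. \<phi> x \<bullet> A k (d k x)) + s x * g (s x)) = (LINT x|lborel. \<omega> * (\<phi> x \<bullet> \<phi> x))"
    using iA[OF \<phi>] sg_int i\<phi>[OF \<phi>] by (intro integral_cong_AE) auto
  then show "(\<Sum>k\<in>UNIV. LINT x|lborel. \<phi> x \<bullet> A k (d k x)) + (LINT x|lborel. (\<phi> x \<bullet> \<beta> (\<phi> x)) * g (\<phi> x \<bullet> \<beta> (\<phi> x)))
      = \<omega> * (LINT x|lborel. \<phi> x \<bullet> \<phi> x)"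
    using iA[OF \<phi>] sg_int by (simp add: s_def)

  \<comment> \<open>In the j-th summand the antisymmetric form is evaluated on equal arguments and
    vanishes. Symmetry of \<beta> makes the potential term half of g(s) times the derivative of
    s.\<close>
  have eq_j: "AE x in lborel. (\<Sum>k\<in>UNIV - {j}. d j x \<bullet> A k (d k x)) - \<omega> * (d j x \<bullet> \<phi> x) + g (s x) * ds (axis j 1) x / 2 = 0"
    using eq'
  proof eventually_elim
    case (elim x)
    have "d j x \<bullet> A j (d j x) = 0" using anti[of "d j x" j "d j x"] by (simp add: inner_commute)
    then have "(\<Sum>k\<in>UNIV. d j x \<bullet> A k (d k x)) = (\<Sum>k\<in>UNIV - {j}. d j x \<bullet> A k (d k x))"
      by (subst sum.remove[of UNIV j]) auto
    moreover have "ds (axis j 1) x = 2 * (d j x \<bullet> \<beta> (\<phi> x))"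
      using sym[of "d j x" "\<phi> x"] by (simp add: ds_def dv_axis inner_commute[of "\<beta> _"])
    ultimately show ?case
      using arg_cong[OF elim, of "\<lambda>y. d j x \<bullet> y"] by (simp add: inner_add_right inner_diff_right inner_sum_right)
  qed
  \<comment> \<open>Integration by parts turns each of the three kinds of terms in
    \<open>eq_j\<close> into -1/2 times the weight's derivative against the corresponding term of
    \<open>F\<close>.\<close>
  define F where "F x = (\<Sum>k\<in>UNIV - {j}. \<phi> x \<bullet> A k (d k x)) - \<omega> * (\<phi> x \<bullet> \<phi> x) + G (s x)" for x
  have F_int: "integrable lborel F"
    unfolding F_def[abs_def] using iA[OF \<phi>] i\<phi>[OF \<phi>] G_int by auto
  have weighted: "(LINT x|lborel. inverse (1 + (x $ j / R)\<^sup>2) * F x) = 0" if R: "0 < R" for R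
  proof -
    define \<zeta> where "\<zeta> t = R * arctan (t / R)" for t
    define \<zeta>' where "\<zeta>' t = inverse (1 + (t / R)\<^sup>2)" for t
    have \<zeta>: "(\<zeta> has_real_derivative \<zeta>' t) (at t)" for t
      unfolding \<zeta>_def[abs_def] \<zeta>'_def using R by (rule arctan_scaled_has_derivative)
    have Z: "\<bar>\<zeta> t\<bar> \<le> R * (pi / 2)" for t
      using R arctan_bounded[of "t / R"] unfolding \<zeta>_def abs_mult by (intro mult_mono) auto
    have C: "\<bar>\<zeta>' t\<bar> \<le> 1" for t
      unfolding \<zeta>'_def by (auto simp: inverse_le_1_iff)
    have \<zeta>'_meas[measurable]: "\<zeta>' \<in> borel_measurable borel" unfolding \<zeta>'_def[abs_def] by measurable
    have \<zeta>_meas[measurable]: "\<zeta> \<in> borel_measurable borel"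
      using \<zeta> by (intro borel_measurable_continuous_onI DERIV_continuous_on) auto
    have iZ: "integrable lborel (\<lambda>x. \<zeta> (x $ j) * f x)" if "integrable lborel f" for f
      by (rule integrable_bounded_mult[OF that _ Z]) measurable
    have iZ': "integrable lborel (\<lambda>x. \<zeta>' (x $ j) * f x)" if "integrable lborel f" for f
      by (rule integrable_bounded_mult[OF that _ C]) measurable
    have mixed: "(LINT x|lborel. \<zeta> (x $ j) * (d j x \<bullet> A k (d k x))) = - (LINT x|lborel. \<zeta>' (x $ j) * (\<phi> x \<bullet> A k (d k x))) / 2"
      if "k \<in> UNIV - {j}" for k
      using that by (intro mixed_derivative_identity[OF dir_axis(1) dir_axis(1,2) A anti _ \<zeta> \<zeta>'_meas Z C]) auto
    have "L1_dir (axis j 1) (\<lambda>x. \<phi> x \<bullet> \<phi> x) (\<lambda>x. d j x \<bullet> \<phi> x + \<phi> x \<bullet> d j x)"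
      by (rule L1_dir_product[OF bounded_bilinear_inner dir_axis(1) dir_axis(1)])
    from L1_dir_integral_by_parts[OF this \<zeta> \<zeta>'_meas Z C]
    have charge: "(LINT x|lborel. \<zeta> (x $ j) * (d j x \<bullet> \<phi> x)) = - (LINT x|lborel. \<zeta>' (x $ j) * (\<phi> x \<bullet> \<phi> x)) / 2"
      by (simp add: inner_commute[of "\<phi> _" "d j _"] mult.left_commute[of _ "2 :: real"])
    have potential: "(LINT x|lborel. \<zeta> (x $ j) * (g (s x) * ds (axis j 1) x)) = - (LINT x|lborel. \<zeta>' (x $ j) * G (s x))"
      by (rule comp(2)[OF \<zeta> \<zeta>'_meas Z C])
    have "0 = (LINT x|lborel. \<zeta> (x $ j) * ((\<Sum>k\<in>UNIV - {j}. d j x \<bullet> A k (d k x)) - \<omega> * (d j x \<bullet> \<phi> x) + g (s x) * ds (axis j 1) x / 2))"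
    proof (rule integral_eq_zero_AE[symmetric])
      show "AE x in lborel. \<zeta> (x $ j) * ((\<Sum>k\<in>UNIV - {j}. d j x \<bullet> A k (d k x)) - \<omega> * (d j x \<bullet> \<phi> x) + g (s x) * ds (axis j 1) x / 2) = 0"
        using eq_j by eventually_elim simp
    qed
    also have "\<dots> = (LINT x|lborel. (\<Sum>k\<in>UNIV - {j}. \<zeta> (x $ j) * (d j x \<bullet> A k (d k x)))
        - \<omega> * (\<zeta> (x $ j) * (d j x \<bullet> \<phi> x)) + \<zeta> (x $ j) * (g (s x) * ds (axis j 1) x) / 2)"
      by (rule Bochner_Integration.integral_cong) (simp_all add: sum_distrib_left algebra_simps)
    also have "\<dots> = (\<Sum>k\<in>UNIV - {j}. LINT x|lborel. \<zeta> (x $ j) * (d j x \<bullet> A k (d k x)))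
        - \<omega> * (LINT x|lborel. \<zeta> (x $ j) * (d j x \<bullet> \<phi> x)) + (LINT x|lborel. \<zeta> (x $ j) * (g (s x) * ds (axis j 1) x)) / 2"
      using iZ[OF iA[OF L2d[of j]]] iZ[OF i\<phi>[OF L2d[of j]]] iZ[OF gds[of "axis j 1"]]
      by (simp add: Bochner_Integration.integral_sum)
    also have "\<dots> = - ((\<Sum>k\<in>UNIV - {j}. LINT x|lborel. \<zeta>' (x $ j) * (\<phi> x \<bullet> A k (d k x)))
        - \<omega> * (LINT x|lborel. \<zeta>' (x $ j) * (\<phi> x \<bullet> \<phi> x)) + (LINT x|lborel. \<zeta>' (x $ j) * G (s x))) / 2"
    proof -
      have "(\<Sum>k\<in>UNIV - {j}. LINT x|lborel. \<zeta> (x $ j) * (d j x \<bullet> A k (d k x)))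
          = - (\<Sum>k\<in>UNIV - {j}. LINT x|lborel. \<zeta>' (x $ j) * (\<phi> x \<bullet> A k (d k x))) / 2"
        unfolding sum_negf[symmetric] sum_divide_distrib by (rule sum.cong[OF refl mixed])
      then show ?thesis unfolding charge potential by (simp add: field_simps)
    qed
    also have "\<dots> = - (LINT x|lborel. \<zeta>' (x $ j) * F x) / 2"
    proof -
      have "(LINT x|lborel. \<zeta>' (x $ j) * F x) = (LINT x|lborel. (\<Sum>k\<in>UNIV - {j}. \<zeta>' (x $ j) * (\<phi> x \<bullet> A k (d k x)))
        - \<omega> * (\<zeta>' (x $ j) * (\<phi> x \<bullet> \<phi> x)) + \<zeta>' (x $ j) * G (s x))"
        unfolding F_def by (rule Bochner_Integration.integral_cong) (simp_all add: sum_distrib_left algebra_simps)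
      also have "\<dots> = (\<Sum>k\<in>UNIV - {j}. LINT x|lborel. \<zeta>' (x $ j) * (\<phi> x \<bullet> A k (d k x)))
        - \<omega> * (LINT x|lborel. \<zeta>' (x $ j) * (\<phi> x \<bullet> \<phi> x)) + (LINT x|lborel. \<zeta>' (x $ j) * G (s x))"
        using iZ'[OF iA[OF \<phi>]] iZ'[OF i\<phi>[OF \<phi>]] iZ'[OF G_int] by (simp add: Bochner_Integration.integral_sum)
      finally show ?thesis by simp
    qed
    finally show ?thesis by (simp add: \<zeta>'_def)
  qed
  \<comment> \<open>With R = m + 1 the derivative of the weight tends to 1 everywhere and is bounded
    by 1, so integrability of \<open>F\<close> alone justifies the limit.\<close>
  have "(\<lambda>m. LINT x|lborel. inverse (1 + (x $ j / real (Suc m))\<^sup>2) * F x) \<longlonglongrightarrow> (LINT x|lborel. F x)"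
  proof (rule integral_dominated_convergence)
    show "integrable lborel (\<lambda>x. \<bar>F x\<bar>)" using F_int by simp
    show "AE x in lborel. (\<lambda>m. inverse (1 + (x $ j / real (Suc m))\<^sup>2) * F x) \<longlonglongrightarrow> F x"
    proof (intro AE_I2)
      fix x
      have "(\<lambda>m. inverse (1 + (x $ j * inverse (real (Suc m)))\<^sup>2) * F x) \<longlonglongrightarrow> inverse (1 + (x $ j * 0)\<^sup>2) * F x"
        by (intro tendsto_intros LIMSEQ_inverse_real_of_nat) simp
      then show "(\<lambda>m. inverse (1 + (x $ j / real (Suc m))\<^sup>2) * F x) \<longlonglongrightarrow> F x"
        by (simp add: divide_inverse)
    qed
    show "AE x in lborel. norm (inverse (1 + (x $ j / real (Suc m))\<^sup>2) * F x) \<le> \<bar>F x\<bar>" for m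
      by (intro AE_I2) (auto simp: abs_mult inverse_le_1_iff intro!: mult_left_le_one_le)
  qed (use F_int in measurable)
  then have "(LINT x|lborel. F x) = 0"
    by (simp add: weighted LIMSEQ_const_iff)
  moreover have "(LINT x|lborel. F x) = (\<Sum>k\<in>UNIV - {j}. LINT x|lborel. \<phi> x \<bullet> A k (d k x))
      - \<omega> * (LINT x|lborel. \<phi> x \<bullet> \<phi> x) + (LINT x|lborel. G (s x))"
    unfolding F_def using iA[OF \<phi>] i\<phi>[OF \<phi>] G_int by (simp add: Bochner_Integration.integral_sum)
  ultimately show "(\<Sum>k\<in>UNIV - {j}. LINT x|lborel. \<phi> x \<bullet> A k (d k x)) + (LINT x|lborel. G (\<phi> x \<bullet> \<beta> (\<phi> x)))
      = \<omega> * (LINT x|lborel. \<phi> x \<bullet> \<phi> x)"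
    by (simp add: s_def)
qed

section \<open>Functions in \<open>H\<^sup>1\<close> and the Dirac operator\<close>

lemma H1_weak_partial:
  assumes "H1 f"
  shows "L2 f" "has_weak_partial j f (weak_partial j f)" "L2 (weak_partial j f)"
  using assms someI_ex[of "has_weak_partial j f"] unfolding H1_def weak_partial_def by auto

text \<open>Linearity of the derivative in its direction extends the coordinate partials to
  arbitrary \<open>v\<close>. Pairing with \<open>b\<close> passes under the vector valued integrals
  because their integrands are products of \<open>L2\<close> functions.\<close>

lemma H1_weak_dir:
  fixes f :: "real ^ 'n \<Rightarrow> 'b::euclidean_space"
  assumes "H1 f"
  shows "weak_dir v (\<lambda>x. f x \<bullet> b) (\<lambda>x. (\<Sum>j\<in>UNIV. v $ j *\<^sub>R weak_partial j f x) \<bullet> b)"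
  unfolding weak_dir_def
proof (intro conjI allI impI)
  note f = H1_weak_partial[OF assms]
  show "L2 (\<lambda>x. f x \<bullet> b)" by (intro L2_inner f)
  show "L2 (\<lambda>x. (\<Sum>j\<in>UNIV. v $ j *\<^sub>R weak_partial j f x) \<bullet> b)"
    by (intro L2_inner L2_sum L2_scaleR f) simp
  fix \<eta> :: "real ^ 'n \<Rightarrow> real" assume \<eta>: "test_function \<eta>"
  note T = test_function_L2[OF \<eta>]
  let ?D = "\<lambda>w x. frechet_derivative \<eta> (at x) w"
  have Dv: "?D v x = (\<Sum>j\<in>UNIV. v $ j * ?D (axis j 1) x)" for x
  proof -
    have lin: "linear (\<lambda>w. ?D w x)"
      using has_derivative_linear[OF test_function_has_derivative[OF \<eta>]] .
    have "?D v x = ?D (\<Sum>j\<in>UNIV. v $ j *\<^sub>R axis j 1) x"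
      using basis_expansion[of v] by (simp add: scalar_mult_eq_scaleR)
    then show ?thesis by (simp add: linear_sum[OF lin] linear_scale[OF lin])
  qed
  note IS = L2_bilinear_integrable[OF bounded_bilinear_scaleR]
  have comp: "(LINT x|lborel. ?D (axis j 1) x * (f x \<bullet> b)) = - (LINT x|lborel. \<eta> x * (weak_partial j f x \<bullet> b))" for j
  proof -
    have "(LINT x|lborel. ?D (axis j 1) x *\<^sub>R f x) \<bullet> b = - (LINT x|lborel. \<eta> x *\<^sub>R weak_partial j f x) \<bullet> b"
      using f(2)[of j] \<eta> by (simp add: has_weak_partial_def)
    then show ?thesis
      using integral_inner_left[OF IS[OF T(2)[of "axis j 1"] f(1)], of b] integral_inner_left[OF IS[OF T(1) f(3)[of j]], of b]
      by simp
  qed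
  note I = L2_bilinear_integrable[OF bounded_bilinear_mult]
  have i1: "integrable lborel (\<lambda>x. ?D (axis j 1) x * (f x \<bullet> b))"
    and i2: "integrable lborel (\<lambda>x. \<eta> x * (weak_partial j f x \<bullet> b))" for j
    by (intro I T L2_inner f)+
  have "(LINT x|lborel. ?D v x * (f x \<bullet> b)) = (LINT x|lborel. (\<Sum>j\<in>UNIV. v $ j * (?D (axis j 1) x * (f x \<bullet> b))))"
    by (simp add: Dv sum_distrib_right mult.assoc)
  also have "\<dots> = - (\<Sum>j\<in>UNIV. v $ j * (LINT x|lborel. \<eta> x * (weak_partial j f x \<bullet> b)))"
    using i1 by (simp add: Bochner_Integration.integral_sum comp sum_negf)
  also have "\<dots> = - (LINT x|lborel. (\<Sum>j\<in>UNIV. v $ j * (\<eta> x * (weak_partial j f x \<bullet> b))))"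
    using i2 by (simp add: Bochner_Integration.integral_sum)
  also have "\<dots> = - (LINT x|lborel. \<eta> x * ((\<Sum>j\<in>UNIV. v $ j *\<^sub>R weak_partial j f x) \<bullet> b))"
    by (simp add: inner_sum_left sum_distrib_left mult.left_commute)
  finally show "(LINT x|lborel. ?D v x * (f x \<bullet> b)) = - (LINT x|lborel. \<eta> x * ((\<Sum>j\<in>UNIV. v $ j *\<^sub>R weak_partial j f x) \<bullet> b))" .
qed

lemma H1_L2_dir:
  fixes f :: "real ^ 'n \<Rightarrow> 'b::euclidean_space"
  assumes "H1 f"
  shows "L2_dir v f (\<lambda>x. \<Sum>j\<in>UNIV. v $ j *\<^sub>R weak_partial j f x)"
proof -
  note f = H1_weak_partial[OF assms]
  let ?d = "\<lambda>x. \<Sum>j\<in>UNIV. v $ j *\<^sub>R weak_partial j f x"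
  have d: "L2 ?d" by (intro L2_sum L2_scaleR f) simp
  have "sqn (\<lambda>x. diff_quot v f k x - ?d x) = (\<Sum>b\<in>Basis. sqn (\<lambda>x. diff_quot v (\<lambda>x. f x \<bullet> b) k x - ?d x \<bullet> b))" for k
    unfolding sqn_components[OF L2_diff[OF L2_diff_quot[OF f(1)] d]]
    by (simp only: diff_quot_def inner_diff_left inner_scaleR_left real_scaleR_def)
  moreover have "(\<lambda>k. \<Sum>b\<in>(Basis::'b set). sqn (\<lambda>x. diff_quot v (\<lambda>x. f x \<bullet> b) k x - ?d x \<bullet> b)) \<longlonglongrightarrow> (\<Sum>b\<in>(Basis::'b set). 0)"
    by (intro tendsto_sum weak_dir_diff_quot_tendsto H1_weak_dir assms)
  ultimately show ?thesis using f(1) d by (simp add: L2_dir_def)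
qed

section \<open>Complex pairings as real inner products\<close>

lemma Re_star_mult: "Re (star_mult u w) = u \<bullet> w"
  by (simp add: star_mult_def inner_vec_def inner_complex_def)

lemma star_mult_scale: "star_mult u (c *s w) = c * star_mult u w"
  by (simp add: star_mult_def sum_distrib_left mult.left_commute)

lemma star_mult_cnj: "star_mult w u = cnj (star_mult u w)"
  by (simp add: star_mult_def mult.commute)

lemma Im_star_mult: "Im (star_mult u w) = u \<bullet> ((- \<i>) *s w)"
  unfolding Re_star_mult[symmetric] star_mult_scale by simp

lemma star_mult_eq: "star_mult u w = of_real (u \<bullet> w) + \<i> * of_real (u \<bullet> ((- \<i>) *s w))"
  by (rule complex_eqI) (simp_all add: Re_star_mult Im_star_mult)

lemma star_mult_self: "star_mult u u = of_real (u \<bullet> u)"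
proof -
  have "Im (star_mult u u) = 0"
    using arg_cong[OF star_mult_cnj[of u u], of Im] by simp
  then show ?thesis by (simp add: complex_eq_iff Re_star_mult)
qed

lemma hermitian_star_mult:
  assumes "hermitian A"
  shows "star_mult u (A *v w) = star_mult (A *v u) w"
proof -
  have "star_mult u (A *v w) = (\<Sum>i\<in>UNIV. \<Sum>j\<in>UNIV. cnj (u $ i) * (A $ i $ j * w $ j))"
    by (simp add: star_mult_def matrix_vector_mult_def sum_distrib_left)
  also have "\<dots> = (\<Sum>j\<in>UNIV. \<Sum>i\<in>UNIV. cnj (u $ i) * (A $ i $ j * w $ j))"
    by (rule sum.swap)
  also have "\<dots> = (\<Sum>j\<in>UNIV. \<Sum>i\<in>UNIV. cnj (A $ j $ i * u $ i) * w $ j)"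
  proof (intro sum.cong refl)
    fix i j
    have "A $ i $ j = cnj (A $ j $ i)" using assms unfolding hermitian_def by blast
    then show "cnj (u $ i) * (A $ i $ j * w $ j) = cnj (A $ j $ i * u $ i) * w $ j" by (simp add: mult_ac)
  qed
  also have "\<dots> = star_mult (A *v u) w"
    by (simp add: star_mult_def matrix_vector_mult_def sum_distrib_right)
  finally show ?thesis .
qed

text \<open>By conjugation symmetry of \<open>star_mult\<close>, the real part of a Hermitian form
  is symmetric and its imaginary part antisymmetric; the factor -i makes the latter visible to the
  real inner product.\<close>

lemma hermitian_inner:
  assumes "hermitian A"
  shows "u \<bullet> (A *v w) = (A *v u) \<bullet> w" "u \<bullet> ((- \<i>) *s (A *v w)) = - (((- \<i>) *s (A *v u)) \<bullet> w)"
proof -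
  show "u \<bullet> (A *v w) = (A *v u) \<bullet> w"
    by (simp add: Re_star_mult[symmetric] hermitian_star_mult[OF assms])
  have "Im (star_mult u (A *v w)) = - Im (star_mult w (A *v u))"
    unfolding hermitian_star_mult[OF assms, of u w] by (subst star_mult_cnj) simp
  then show "u \<bullet> ((- \<i>) *s (A *v w)) = - (((- \<i>) *s (A *v u)) \<bullet> w)"
    by (simp add: Im_star_mult inner_commute)
qed

lemma linear_matrix_vector_complex:
  fixes A :: "complex ^ 'm ^ 'k"
  shows "linear (\<lambda>w. A *v w)" "linear (\<lambda>w. c *s (A *v w))"
  by (rule linearI; simp add: vec_eq_iff matrix_vector_mult_def sum.distrib sum_distrib_left scaleR_sum_right algebra_simps)+

lemma dirac_beta_mult: "(dirac_beta *v u) $ i = (case i of Inl _ \<Rightarrow> 1 | Inr _ \<Rightarrow> - 1) * u $ i"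
  by (simp add: dirac_beta_def matrix_vector_mult_def if_distrib[of "\<lambda>c. c * _"] cong: if_cong)

lemma dirac_beta_involutive: "dirac_beta *v (dirac_beta *v u) = u"
  by (simp add: vec_eq_iff dirac_beta_mult split: sum.split)

lemma hermitian_dirac_beta: "hermitian dirac_beta"
  by (auto simp: hermitian_def dirac_beta_def split: sum.split)

lemma beta_form_eq: "beta_form u = u \<bullet> (dirac_beta *v u)"
  by (simp add: beta_form_def Re_star_mult)

theorem lemma3p2:
  fixes \<alpha> :: "'n::finite \<Rightarrow> complex ^ ('h::finite + 'h) ^ ('h + 'h)"
    and g G :: "real \<Rightarrow> real"
    and m \<omega> :: real
    and \<phi> :: "real ^ 'n \<Rightarrow> complex ^ ('h + 'h)"
  assumes "dirac_matrices \<alpha>"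
    and "smooth g" and "g 0 = m" and "m > 0"
    and "\<And>s. (G has_real_derivative g s) (at s)" and "G 0 = 0"
    and "H1 \<phi>"
    and "solitary_wave \<alpha> g \<omega> \<phi>"
  shows
    "(\<forall>j. integrable lborel (\<lambda>x. star_mult (\<phi> x) (\<alpha> j *v weak_partial j \<phi> x))) \<and>
     integrable lborel (\<lambda>x. G (beta_form (\<phi> x))) \<and>
     integrable lborel (\<lambda>x. star_mult (\<phi> x) (\<phi> x)) \<and>
     integrable lborel (\<lambda>x. G (beta_form (\<phi> x)) - beta_form (\<phi> x) * g (beta_form (\<phi> x))) \<and>
     (of_nat CARD('n) - 1) / of_nat CARD('n) * T_total \<alpha> \<phi> + of_real (V_fun G \<phi>)
       = of_real \<omega> * Q_fun \<phi> \<and>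
     (\<forall>j. T_part \<alpha> j \<phi> = 1 / of_nat CARD('n) * T_total \<alpha> \<phi> \<and>
       1 / of_nat CARD('n) * T_total \<alpha> \<phi>
         = of_real (LINT x|lborel. G (beta_form (\<phi> x)) - beta_form (\<phi> x) * g (beta_form (\<phi> x))))"
proof -
  define d where "d j = weak_partial j \<phi>" for j
  define A where "A k w = (- \<i>) *s (\<alpha> k *v w)" for k w
  have herm: "hermitian (\<alpha> j)" for j using assms(1) by (simp add: dirac_matrices_def)
  note H = H1_weak_partial[OF \<open>H1 \<phi>\<close>, folded d_def]
  have dir: "L2_dir v \<phi> (\<lambda>x. \<Sum>j\<in>UNIV. v $ j *\<^sub>R d j x)" for v
    using H1_L2_dir[OF \<open>H1 \<phi>\<close>] by (simp add: d_def)
  have dir_axis: "L2_dir (axis j 1) \<phi> (d j)" for j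
  proof -
    have "(\<Sum>i\<in>UNIV. axis j 1 $ i *\<^sub>R d i x) = (\<Sum>i\<in>UNIV. if i = j then d i x else 0)" for x
      unfolding axis_axis_nth by (rule sum.cong) auto
    then show ?thesis using dir[of "axis j 1"] by simp
  qed
  have lin: "linear (A k)" for k
    unfolding A_def[abs_def] by (rule linear_matrix_vector_complex)
  have anti: "u \<bullet> A k w = - (A k u \<bullet> w)" for k u w
    unfolding A_def by (rule hermitian_inner[OF herm])
  have g: "continuous_on UNIV g"
    using \<open>smooth g\<close> C_k_imp_continuous by (auto simp: smooth_def)
  have eq: "AE x in lborel. (\<Sum>k\<in>UNIV. A k (d k x)) - \<omega> *\<^sub>R \<phi> x
      + g (\<phi> x \<bullet> (dirac_beta *v \<phi> x)) *\<^sub>R (dirac_beta *v \<phi> x) = 0"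
    using assms(8) unfolding solitary_wave_def beta_form_eq
    by (simp add: A_def d_def vec.scale_sum_right)
  note virial = virial_identities[where \<beta> = "\<lambda>w. dirac_beta *v w", OF dir lin anti linear_matrix_vector_complex(1)
      hermitian_inner(1)[OF hermitian_dirac_beta] dirac_beta_involutive g assms(5,6) eq, folded beta_form_eq]
  define \<tau> where "\<tau> k = (LINT x|lborel. \<phi> x \<bullet> A k (d k x))" for k
  define V where "V = (LINT x|lborel. G (beta_form (\<phi> x)))"
  define P where "P = (LINT x|lborel. beta_form (\<phi> x) * g (beta_form (\<phi> x)))"
  define q where "q = (LINT x|lborel. \<phi> x \<bullet> \<phi> x)"
  have int_re: "integrable lborel (\<lambda>x. \<phi> x \<bullet> (\<alpha> j *v d j x))" for j
    by (intro L2_bilinear_integrable[OF bounded_bilinear_inner_linear[OF linear_matrix_vector_complex(1)]] H)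
  have int_im: "integrable lborel (\<lambda>x. \<phi> x \<bullet> A j (d j x))" for j
    by (intro L2_bilinear_integrable[OF bounded_bilinear_inner_linear[OF lin]] H)
  \<comment> \<open>\<open>T_part\<close> is complex by type; its imaginary part vanishes because
    twice this integrand is the derivative of \<phi> paired with \<alpha>_j \<phi>, and derivatives
    integrate to 0.\<close>
  have re_zero: "(LINT x|lborel. \<phi> x \<bullet> (\<alpha> j *v d j x)) = 0" for j
  proof -
    have "(LINT x|lborel. d j x \<bullet> (\<alpha> j *v \<phi> x) + \<phi> x \<bullet> (\<alpha> j *v d j x)) = 0"
      by (rule L1_dir_integral_zero[OF L1_dir_product[OF bounded_bilinear_inner_linear[OF linear_matrix_vector_complex(1)]
            dir_axis dir_axis]])
    moreover have "d j x \<bullet> (\<alpha> j *v \<phi> x) = \<phi> x \<bullet> (\<alpha> j *v d j x)" for x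
      by (simp add: hermitian_inner(1)[OF herm, of "\<phi> x"] inner_commute)
    ultimately show ?thesis by simp
  qed
  have star_eq: "star_mult (\<phi> x) (\<alpha> j *v d j x) = of_real (\<phi> x \<bullet> (\<alpha> j *v d j x)) + \<i> * of_real (\<phi> x \<bullet> A j (d j x))" for x j
    by (simp add: star_mult_eq A_def)
  have T: "T_part \<alpha> j \<phi> = of_real (\<tau> j)" for j
  proof -
    have "(LINT x|lborel. star_mult (\<phi> x) (\<alpha> j *v d j x)) = \<i> * of_real (\<tau> j)"
      unfolding star_eq using int_re[of j] int_im[of j] by (simp add: re_zero \<tau>_def)
    then show ?thesis by (simp add: T_part_def d_def)
  qed
  have Q: "Q_fun \<phi> = of_real q"
    by (simp add: Q_fun_def star_mult_self q_def)
  have TT: "T_total \<alpha> \<phi> = of_real (\<Sum>k\<in>UNIV. \<tau> k)"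
    by (simp add: T_total_def T)
  have v3: "(\<Sum>k\<in>UNIV - {j}. \<tau> k) + V = \<omega> * q" for j
    using virial(3)[of j] by (simp add: \<tau>_def V_def q_def)
  have v4: "(\<Sum>k\<in>UNIV. \<tau> k) + P = \<omega> * q"
    using virial(4) by (simp add: \<tau>_def P_def q_def)
  \<comment> \<open>Subtracting the two virial identities removes every kinetic term except the j-th
    one.\<close>
  have \<tau>: "\<tau> j = V - P" for j
    using v3[of j] v4 sum.remove[of UNIV j \<tau>] by simp
  define n where "n = real CARD('n)"
  have n: "n > 0" by (simp add: n_def)
  have sum_\<tau>: "(\<Sum>k\<in>UNIV. \<tau> k) = n * (V - P)" by (simp add: \<tau> n_def)
  have VP: "(LINT x|lborel. G (beta_form (\<phi> x)) - beta_form (\<phi> x) * g (beta_form (\<phi> x))) = V - P"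
    unfolding V_def P_def by (rule Bochner_Integration.integral_diff[OF virial(1,2)])
  \<comment> \<open>The factor (n - 1)/n removes one share V - P from T, and adding V leaves T +
    P.\<close>
  have first: "(n - 1) / n * (n * (V - P)) + V = \<omega> * q"
  proof -
    have "(n - 1) / n * (n * (V - P)) = n * (V - P) - (V - P)" using n by (simp add: field_simps)
    then show ?thesis using v4 unfolding sum_\<tau> by linarith
  qed
  have card: "of_nat CARD('n) = complex_of_real n" by (simp add: n_def)
  show ?thesis
  proof (intro conjI allI)
    show "integrable lborel (\<lambda>x. star_mult (\<phi> x) (\<alpha> j *v weak_partial j \<phi> x))" for j
      using int_re[of j] int_im[of j] unfolding d_def[symmetric] star_eq by simp
    show "integrable lborel (\<lambda>x. G (beta_form (\<phi> x)))" by (rule virial(1))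
    show "integrable lborel (\<lambda>x. star_mult (\<phi> x) (\<phi> x))"
      using L2_bilinear_integrable[OF bounded_bilinear_inner H(1) H(1)] by (simp add: star_mult_self)
    show "integrable lborel (\<lambda>x. G (beta_form (\<phi> x)) - beta_form (\<phi> x) * g (beta_form (\<phi> x)))"
      by (rule Bochner_Integration.integrable_diff[OF virial(1,2)])
    show "(of_nat CARD('n) - 1) / of_nat CARD('n) * T_total \<alpha> \<phi> + of_real (V_fun G \<phi>) = of_real \<omega> * Q_fun \<phi>"
      using arg_cong[OF first, of complex_of_real] n
      by (simp only: card TT sum_\<tau> Q V_fun_def V_def[symmetric]) simp
    show "T_part \<alpha> j \<phi> = 1 / of_nat CARD('n) * T_total \<alpha> \<phi>" for j
      using n by (simp only: card TT sum_\<tau> T) (simp add: \<tau>)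
    show "1 / of_nat CARD('n) * T_total \<alpha> \<phi>
         = of_real (LINT x|lborel. G (beta_form (\<phi> x)) - beta_form (\<phi> x) * g (beta_form (\<phi> x)))"
      using n by (simp only: card TT sum_\<tau> VP) simp
  qed
qed

end
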